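(* Let $N,n\ge1$ be integers and $1\le p\le\infty$. Then $H^p_n(\mathbb B_N)\subset H^p(\mathbb B_N)$. Moreover, a function $f\in H^p(\mathbb B_N)$ belongs to $H^p_n(\mathbb B_N)$ if and only if $$\omega_n(\delta,f)_p=\mathcal O(\delta^n),\quad 0<\delta<1.$$ In this equivalence, $\omega_n(\delta,f)_p$ may be replaced by $\omega_n^-(\delta,f)_p$ or by $\omega_n^+(\delta,f)_p$.
   Context: $\mathbb B_N$ is the unit ball of $\mathbb C^N$, $\mathbb S_N=\partial\mathbb B_N$, $\sigma$ is the normalized Lebesgue measure on $\mathbb S_N$, and $H(\mathbb B_N)$ is the space of holomorphic functions on $\mathbb B_N$. For $0<r<1$, $M_p(r,g)=\left(\int_{\mathbb S_N}|g(r\zeta)|^p\,d\sigma(\zeta)\right)^{1/p}$ for $p<\infty$ and $M_\infty(r,g)=\operatorname{ess\,sup}_{\zeta\in\mathbb S_N}|g(r\zeta)|$. $H^p(\mathbb B_N)$ is the space of $f\in H(\mathbb B_N)$ with $\|f\|_p:=\sup_{0<r<1}M_p(r,f)<\infty$. If $f\in H(\mathbb B_N)$ has homogeneous expansion $f=\sum_{k\ge0}f_k$, then $\mathcal R^nf=\sum_{k\ge1}k^nf_k$. The Hardy-Sobolev space is $H^p_n(\mathbb B_N)=\{f\in H(\mathbb B_N):\mathcal R^nf\in H^p(\mathbb B_N)\}$. Differences: for $t\in\mathbb R$, $\Delta^1_tf(z)=f(e^{it}z)-f(z)$ and $\Delta^n_tf=\Delta^1_t(\Delta^{n-1}_tf)$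 for $n\ge2$. For a linear operator $U$ mapping $\mathbb B_N$ to $\mathbb B_N$, $\Delta^1_Uf(z)=f(Uz)-f(z)$ and $\Delta^n_Uf=\Delta^1_U(\Delta^{n-1}_Uf)$ for $n\ge2$. Let $\mathcal U$ be the group of unitary transformations of $\mathbb C^N$, $\mathcal L$ the semigroup of all linear operators from $\mathbb B_N$ to $\mathbb B_N$, and $I$ the identity. The moduli of continuity are $$\omega_n(\delta,f)_p=\sup_{\|U-I\|<\delta,\,U\in\mathcal U}\|\Delta^n_Uf\|_p,\quad \omega^-_n(\delta,f)_p=\sup_{|t|<\delta}\|\Delta^n_tf\|_p,\quad \omega^+_n(\delta,f)_p=\sup_{\|U-I\|<\delta,\,U\in\mathcal L}\|\Delta^n_Uf\|_p.$$ *)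

theory Defs
  imports "HOL-Analysis.Analysis" "HOL-Probability.Probability"
begin

text \<open>
  The space of complex \<open>N\<close>-tuples is \<open>complex ^ 'N\<close>, whose library norm is the Euclidean one, so
  that the unit ball and sphere are \<open>ball 0 1\<close> and \<open>sphere 0 1\<close>. Functions on the ball are
  total functions of which only the values on \<open>ball 0 1\<close> are ever used.
\<close>

text \<open>Complex Frechet differentiability; \<open>S\<close> is meant to be open.\<close>

definition holomorphic_several ::
    "(complex ^ 'N \<Rightarrow> complex) \<Rightarrow> (complex ^ 'N) set \<Rightarrow> bool" where
  "holomorphic_several f S \<longleftrightarrow>
     (\<forall>z\<in>S. \<exists>D. Vector_Spaces.linear (*s) (*) D \<and> (f has_derivative D) (at z))"

text \<open>
  Normalized surface measure as the normalized cone measure: the measure of \<open>A\<close> is the volume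
  fraction of the ball occupied by the points whose radial projection lies in \<open>A\<close>. Its space is
  the sphere, so measurability of an integrand does not depend on values elsewhere.
\<close>

definition sphere_measure :: "(complex ^ 'N) measure" where
  "sphere_measure =
     restrict_space (distr (uniform_measure lborel (ball 0 1)) borel sgn) (sphere 0 1)"

lemma prob_space_sphere_measure:
  "prob_space (sphere_measure :: (complex ^ 'N) measure)"
proof -
  let ?B = "ball 0 1 :: (complex ^ 'N) set"
  let ?u = "uniform_measure lborel ?B"
  let ?D = "distr ?u borel sgn :: (complex ^ 'N) measure"
  have B: "emeasure lborel ?B \<noteq> 0" "emeasure lborel ?B \<noteq> \<infinity>"
    using content_ball_pos[of 1 "0 :: complex ^ 'N"] emeasure_lborel_ball_finite[of "0 :: complex ^ 'N" 1]
    by (auto simp: measure_def)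
  interpret u: prob_space ?u
    using B by (rule prob_space_uniform_measure)
  have m [measurable]: "sgn \<in> measurable ?u (borel :: (complex ^ 'N) measure)"
    by simp
  interpret D: prob_space ?D
    by (rule u.prob_space_distr) (rule m)
  have "AE z in lborel. z \<noteq> (0 :: complex ^ 'N)"
    by (rule AE_lborel_singleton)
  then have "AE z in ?u. z \<noteq> 0"
    using B by (intro AE_uniform_measureI) (auto elim: eventually_mono)
  then have "AE z in ?u. sgn z \<in> sphere 0 1"
    by (auto elim!: eventually_mono simp: norm_sgn)
  then have "AE z in ?D. z \<in> sphere 0 1"
    by (subst AE_distr_iff) auto
  then have "emeasure ?D (sphere 0 1) = 1"
    by (intro D.emeasure_eq_1_AE) auto
  then show ?thesis
    unfolding sphere_measure_def
    by (intro prob_spaceI) (simp add: space_restrict_space emeasure_restrict_space)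
qed

text \<open>
  The exponent ranges over \<open>ennreal\<close> in order to include \<open>\<infinity>\<close>. In the finite case the Bochner
  integral is adequate because it is applied to functions continuous on the sphere.
\<close>

definition int_mean :: "ennreal \<Rightarrow> real \<Rightarrow> (complex ^ 'N \<Rightarrow> complex) \<Rightarrow> ennreal" where
  "int_mean p r g =
     (if p = \<infinity> then esssup sphere_measure (\<lambda>\<zeta>. ennreal (cmod (g (r *\<^sub>R \<zeta>))))
      else ennreal ((\<integral>\<zeta>. cmod (g (r *\<^sub>R \<zeta>)) powr enn2real p \<partial>sphere_measure)
                      powr (1 / enn2real p)))"

definition hardy_norm :: "ennreal \<Rightarrow> (complex ^ 'N \<Rightarrow> complex) \<Rightarrow> ennreal" where
  "hardy_norm p f = (SUP r\<in>{0<..<1}. int_mean p r f)"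

definition hardy_space :: "ennreal \<Rightarrow> (complex ^ 'N \<Rightarrow> complex) set" where
  "hardy_space p = {f. holomorphic_several f (ball 0 1) \<and> hardy_norm p f < \<infinity>}"

definition homogeneous_poly :: "nat \<Rightarrow> (complex ^ 'N \<Rightarrow> complex) \<Rightarrow> bool" where
  "homogeneous_poly k P \<longleftrightarrow>
     (\<exists>c. \<forall>z. P z = (\<Sum>\<alpha> | (\<Sum>i\<in>UNIV. \<alpha> i) = k. c \<alpha> * (\<Prod>i\<in>UNIV. (z $ i) ^ \<alpha> i)))"

definition homogeneous_expansion ::
    "(complex ^ 'N \<Rightarrow> complex) \<Rightarrow> (nat \<Rightarrow> complex ^ 'N \<Rightarrow> complex) \<Rightarrow> bool" where
  "homogeneous_expansion f F \<longleftrightarrow>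
     (\<forall>k. homogeneous_poly k (F k)) \<and> (\<forall>z\<in>ball 0 1. (\<lambda>k. F k z) sums f z)"

text \<open>A function holomorphic on the ball has exactly one homogeneous expansion.\<close>

definition homogeneous_part :: "(complex ^ 'N \<Rightarrow> complex) \<Rightarrow> nat \<Rightarrow> complex ^ 'N \<Rightarrow> complex" where
  "homogeneous_part f = (THE F. homogeneous_expansion f F)"

text \<open>The sum over \<open>k \<ge> 1\<close>, written with a shifted index.\<close>

definition radial_deriv :: "nat \<Rightarrow> (complex ^ 'N \<Rightarrow> complex) \<Rightarrow> complex ^ 'N \<Rightarrow> complex" where
  "radial_deriv n f z = (\<Sum>k. of_nat (Suc k) ^ n * homogeneous_part f (Suc k) z)"

definition hardy_sobolev :: "nat \<Rightarrow> ennreal \<Rightarrow> (complex ^ 'N \<Rightarrow> complex) set" where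
  "hardy_sobolev n p =
     {f. holomorphic_several f (ball 0 1) \<and> radial_deriv n f \<in> hardy_space p}"

definition rot_diff :: "real \<Rightarrow> (complex ^ 'N \<Rightarrow> complex) \<Rightarrow> complex ^ 'N \<Rightarrow> complex" where
  "rot_diff t f z = f (exp (\<i> * of_real t) *s z) - f z"

definition op_diff ::
    "(complex ^ 'N \<Rightarrow> complex ^ 'N) \<Rightarrow> (complex ^ 'N \<Rightarrow> complex) \<Rightarrow> complex ^ 'N \<Rightarrow> complex" where
  "op_diff U f z = f (U z) - f z"

definition hermitian_inner :: "complex ^ 'N \<Rightarrow> complex ^ 'N \<Rightarrow> complex" where
  "hermitian_inner z w = (\<Sum>i\<in>UNIV. z $ i * cnj (w $ i))"

definition unitary_group :: "(complex ^ 'N \<Rightarrow> complex ^ 'N) set" where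
  "unitary_group =
     {U. Vector_Spaces.linear (*s) (*s) U \<and>
         (\<forall>z w. hermitian_inner (U z) (U w) = hermitian_inner z w)}"

definition ball_operators :: "(complex ^ 'N \<Rightarrow> complex ^ 'N) set" where
  "ball_operators = {U. Vector_Spaces.linear (*s) (*s) U \<and> U ` ball 0 1 \<subseteq> ball 0 1}"

definition modulus :: "nat \<Rightarrow> ennreal \<Rightarrow> (complex ^ 'N \<Rightarrow> complex) \<Rightarrow> real \<Rightarrow> ennreal" where
  "modulus n p f \<delta> =
     (SUP U\<in>{U \<in> unitary_group. onorm (\<lambda>z. U z - z) < \<delta>}. hardy_norm p ((op_diff U ^^ n) f))"

definition modulus_minus :: "nat \<Rightarrow> ennreal \<Rightarrow> (complex ^ 'N \<Rightarrow> complex) \<Rightarrow> real \<Rightarrow> ennreal" where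
  "modulus_minus n p f \<delta> = (SUP t\<in>{t. \<bar>t\<bar> < \<delta>}. hardy_norm p ((rot_diff t ^^ n) f))"

definition modulus_plus :: "nat \<Rightarrow> ennreal \<Rightarrow> (complex ^ 'N \<Rightarrow> complex) \<Rightarrow> real \<Rightarrow> ennreal" where
  "modulus_plus n p f \<delta> =
     (SUP U\<in>{U \<in> ball_operators. onorm (\<lambda>z. U z - z) < \<delta>}. hardy_norm p ((op_diff U ^^ n) f))"

text \<open>The bound is uniform over the whole interval \<open>0 < \<delta> < 1\<close>, not only near \<open>0\<close>.\<close>

definition big_O_power :: "nat \<Rightarrow> (real \<Rightarrow> ennreal) \<Rightarrow> bool" where
  "big_O_power n \<omega> \<longleftrightarrow> (\<exists>C::real. \<forall>\<delta>. 0 < \<delta> \<and> \<delta> < 1 \<longrightarrow> \<omega> \<delta> \<le> ennreal (C * \<delta> ^ n))"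

end

theory Submission
  imports Defs "HOL-Complex_Analysis.Complex_Analysis"
begin

text \<open>
  Write \<open>R f(z) = f'(z) z\<close> for the radial derivative. On the homogeneous part of degree \<open>k\<close> the
  operator \<open>R\<close> is multiplication by \<open>k\<close>, so the termwise defined \<open>R\<^sup>n\<close> is its \<open>n\<close>-th iterate
  (\<open>radial_deriv_eq_euler_op\<close>). The existence of the homogeneous expansion rests on the fact that
  the partial derivatives of \<open>f\<close> are again holomorphic, which follows by differentiating Cauchy's
  formula on complex lines.

  Along the circle \<open>e\<^sup>i\<^sup>t z\<close> the derivative of \<open>f\<close> is \<open>i R f\<close>. Integrating \<open>t R f(e\<^sup>i\<^sup>t z)\<close> by parts
  recovers \<open>f - f(0)\<close> as an average of rotations of \<open>R f\<close>, and therefore \<open>H\<^sup>p\<^sub>n\<close> is contained in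
  \<open>H\<^sup>p\<close> (\<open>means_bounded_of_euler_op\<close>). Conversely the quotients of the \<open>n\<close>-th rotational difference
  by \<open>t\<^sup>n\<close> converge pointwise to \<open>i\<^sup>n R\<^sup>n f\<close>, so that by Fatou's lemma a bound
  \<open>O(\<delta>\<^sup>n)\<close> for the smallest of the three moduli, the rotational one, already bounds \<open>R\<^sup>n f\<close>
  (\<open>modulus_minus_imp_hardy_sobolev\<close>).

  There remains the bound for the largest modulus, over all linear contractions \<open>U\<close>. As \<open>R\<close> commutes
  with composition by \<open>U\<close>, the case of order \<open>n\<close> follows by induction from the estimate
  \<open>\<parallel>f \<circ> U - f\<parallel> \<le> C \<parallel>U - I\<parallel> \<parallel>R f\<parallel>\<close>. Two facts give this estimate. First, composition with a
  linear contraction does not increase the integral means (\<open>int_mean_contraction\<close>). For finite \<open>p\<close>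
  this is a maximum principle on the convex set of all contractions: the mean depends
  subharmonically on the contraction, and every contraction that is not an isometry is the centre of a
  disc of contractions, so that the largest value is taken at the unitary maps, where it equals the
  mean of \<open>f\<close>. Secondly, all first partial derivatives are dominated by \<open>R f\<close>
  (\<open>means_bounded_partial_deriv\<close>). On a sphere they are combinations, with bounded coefficients, of
  \<open>R f\<close> and of the derivatives in the complex tangential directions \<open>u\<close> with \<open>u\<^sub>i\<close> and \<open>u\<^sub>j\<close> the
  conjugates of \<open>z\<^sub>j\<close> and \<open>- z\<^sub>i\<close>. For such \<open>u\<close>,
  \<open>f'(z) u = \<integral> (R f)'(s z) u ds\<close> over \<open>0 \<le> s \<le> 1\<close>, and since \<open>u\<close> is orthogonal to \<open>z\<close>
  the inner derivative can be taken by Cauchy's formula from a circle of the large radius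
  \<open>\<surd>(1 - s\<^sup>2)\<close> in place of \<open>1 - s\<close>; the weight \<open>1 / \<surd>(1 - s\<^sup>2)\<close> is
  integrable. For a fixed parameter on the circle the map \<open>z \<mapsto> s z + \<surd>(1 - s\<^sup>2) e\<^sup>i\<^sup>t u(z)\<close> is a
  real isometry followed by a complex linear contraction, and neither of these increases the mean of
  \<open>R f\<close>.

  The estimates rest on Jensen's inequality and Fubini's theorem, mostly in the shape of
  \<open>int_mean_average\<close>, which treats finite and infinite \<open>p\<close> together.
\<close>

(* The infix dollar sign is kept for the components of vectors. *)
no_notation fps_nth (infixl \<open>$\<close> 75)

section \<open>Cauchy formulas on complex lines\<close>

lemma norm_smult: "norm (c *s x) = cmod c * norm (x :: complex ^ 'N)"
  by (simp add: norm_vec_def norm_mult L2_set_right_distrib)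

lemma scaleR_eq_smult: "r *\<^sub>R x = complex_of_real r *s (x :: complex ^ 'N)"
  by (simp add: vec_eq_iff) (simp add: scaleR_conv_of_real)

lemma bounded_bilinear_smult: "bounded_bilinear ((*s) :: complex \<Rightarrow> complex ^ 'N \<Rightarrow> complex ^ 'N)"
proof
  show "\<exists>K. \<forall>a b. norm (a *s b :: complex ^ 'N) \<le> norm a * norm b * K"
    by (rule exI[of _ 1], simp add: norm_smult)
qed (simp_all add: vec_eq_iff algebra_simps)

lemmas continuous_on_smult [continuous_intros] =
  bounded_bilinear.continuous_on[OF bounded_bilinear_smult]

lemmas has_derivative_smult = bounded_bilinear.FDERIV[OF bounded_bilinear_smult]

abbreviation holo :: "(complex ^ 'N \<Rightarrow> complex) \<Rightarrow> bool" where
  "holo f \<equiv> holomorphic_several f (ball 0 1)"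

text \<open>
  The complex differential at a point, as a function of the direction. Outside the region of
  differentiability it is an unspecified value of \<open>frechet_derivative\<close>.\<close>
definition cderiv :: "(complex ^ 'N \<Rightarrow> complex) \<Rightarrow> complex ^ 'N \<Rightarrow> complex ^ 'N \<Rightarrow> complex" where
  "cderiv f z = frechet_derivative f (at z)"

lemma vector_space_complex: "vector_space ((*) :: complex \<Rightarrow> complex \<Rightarrow> complex)"
  by unfold_locales (simp_all add: algebra_simps)

lemma clinearI:
  assumes "(f has_derivative D) F" "\<And>c w. D (c *s w) = c * D w"
  shows "Vector_Spaces.linear (*s) (*) (D :: complex ^ 'N \<Rightarrow> complex)"
proof -
  have "D (u + w) = D u + D w" for u w
    using has_derivative_bounded_linear[OF assms(1)] by (simp add: bounded_linear.linear linear_add)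
  with assms(2) show ?thesis
    by (simp add: Vector_Spaces.linear_iff vec.vector_space_axioms vector_space_complex)
qed

lemma cderiv_unique:
  "(f has_derivative D) (at z) \<Longrightarrow> cderiv f z = D"
  unfolding cderiv_def by (metis frechet_derivative_at)

lemma holo_cderiv:
  assumes "holo f" "z \<in> ball 0 1"
  shows has_derivative_cderiv: "(f has_derivative cderiv f z) (at z)"
    and linear_cderiv: "Vector_Spaces.linear (*s) (*) (cderiv f z)"
  using assms unfolding holomorphic_several_def by (metis cderiv_unique)+

lemma cderiv_smult:
  assumes "holo f" "z \<in> ball 0 1"
  shows "cderiv f z (c *s u) = c * cderiv f z u"
  using linear_cderiv[OF assms] by (simp add: Vector_Spaces.linear_iff)

lemma holo_continuous_on: "holo f \<Longrightarrow> continuous_on (ball 0 1) f"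
  by (rule has_derivative_continuous_on, rule has_derivative_at_withinI, rule has_derivative_cderiv)

lemma continuous_on_holo_compose:
  "holo f \<Longrightarrow> continuous_on S g \<Longrightarrow> (\<And>x. x \<in> S \<Longrightarrow> g x \<in> ball 0 1) \<Longrightarrow>
    continuous_on S (\<lambda>x. f (g x))"
  by (rule continuous_on_compose2[OF holo_continuous_on]) auto

lemma holo_slice_deriv:
  assumes "holo f" "a + l *s b \<in> ball 0 1"
  shows "((\<lambda>l. f (a + l *s b)) has_field_derivative cderiv f (a + l *s b) b) (at l)"
proof -
  have "((\<lambda>l. a + l *s b) has_derivative (\<lambda>h. h *s b)) (at l)"
    by (auto intro!: derivative_eq_intros has_derivative_smult)
  from has_derivative_compose[OF this has_derivative_cderiv[OF assms]]
  show ?thesis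
    by (simp add: has_field_derivative_def cderiv_smult[OF assms] mult.commute[of _ "cderiv f _ b"])
qed

text \<open>
  Cauchy's formulas on the unit circle for the one-variable function \<open>l \<mapsto> f(a + l b)\<close>. The radius is
  absorbed in \<open>b\<close>, so that in applications both \<open>a\<close> and \<open>b\<close> may vary with a point of the sphere.\<close>
lemma slice_cauchy:
  fixes f :: "complex ^ 'N \<Rightarrow> complex"
  assumes f: "holo f" and ab: "\<And>l. cmod l \<le> 1 \<Longrightarrow> a + l *s b \<in> ball 0 1"
  shows slice_mean: "((\<lambda>t. f (a + cis t *s b)) has_integral (2 * pi * f a)) {0..2*pi}"
    and slice_mean_deriv:
      "((\<lambda>t. cis (- t) * f (a + cis t *s b)) has_integral (2 * pi * cderiv f a b)) {0..2*pi}"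
proof -
  define g where "g = (\<lambda>l. f (a + l *s b))"
  have d: "(g has_field_derivative cderiv f (a + l *s b) b) (at l)" if "cmod l \<le> 1" for l
    unfolding g_def by (rule holo_slice_deriv[OF f ab[OF that]])
  have h: "g holomorphic_on cball 0 1"
    unfolding holomorphic_on_def field_differentiable_def
    by (intro ballI exI, rule has_field_derivative_at_within, rule d) simp
  have c: "continuous_on (cball 0 1) g" and hb: "g holomorphic_on ball 0 1"
    using h by (auto intro: holomorphic_on_imp_continuous_on holomorphic_on_subset)
  have I: "((\<lambda>t. g (cis t) / cis t ^ Suc k * \<i> * cis t) has_integral
      (2 * pi * \<i> / fact k * (deriv ^^ k) g 0)) {0..2*pi}" for k
    using Cauchy_has_contour_integral_higher_derivative_circlepath[OF c hb, of 0 k]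
    by (simp add: circlepath_def has_contour_integral_part_circlepath_iff)
  \<comment> \<open>The contour integral carries the factor \<open>\<i>\<close> from the derivative of the parametrization; \<open>-\<i>\<close> removes it.\<close>
  have "((\<lambda>t. -\<i> * (g (cis t) / cis t ^ Suc 0 * \<i> * cis t)) has_integral
      -\<i> * (2 * pi * \<i> / fact 0 * (deriv ^^ 0) g 0)) {0..2*pi}"
    by (rule has_integral_mult_right[OF I])
  then show "((\<lambda>t. f (a + cis t *s b)) has_integral (2 * pi * f a)) {0..2*pi}"
    by (simp add: g_def algebra_simps)
  have "((\<lambda>t. -\<i> * (g (cis t) / cis t ^ Suc 1 * \<i> * cis t)) has_integral
      -\<i> * (2 * pi * \<i> / fact 1 * (deriv ^^ 1) g 0)) {0..2*pi}"
    by (rule has_integral_mult_right[OF I])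
  moreover have "deriv g 0 = cderiv f a b"
    using d[of 0] by (simp add: DERIV_imp_deriv)
  moreover have "-\<i> * (g (cis t) / cis t ^ Suc 1 * \<i> * cis t) = cis (- t) * g (cis t)" for t
    by (simp add: cis_inverse[symmetric] field_simps del: cis_inverse)
  ultimately show
    "((\<lambda>t. cis (- t) * f (a + cis t *s b)) has_integral (2 * pi * cderiv f a b)) {0..2*pi}"
    by (simp add: g_def algebra_simps)
qed

lemma holo_margin:
  assumes "z0 \<in> ball (0 :: complex ^ 'N) 1"
  obtains e where "e > 0" "\<And>z l. z \<in> ball z0 e \<Longrightarrow> cmod l \<le> 1 \<Longrightarrow> z + l *s (complex_of_real e *s v) \<in> ball 0 1"
proof -
  \<comment> \<open>With this choice \<open>e + e * norm v < 1 - norm z0\<close>.\<close>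
  define e where "e = (1 - norm z0) / (2 + norm v)"
  have e: "e > 0" using assms by (auto simp: e_def intro!: divide_pos_pos add_pos_nonneg)
  have "norm (z + l *s (complex_of_real e *s v)) < 1" if "z \<in> ball z0 e" "cmod l \<le> 1" for z l
  proof -
    have "norm (z + l *s (complex_of_real e *s v)) \<le> norm z + cmod l * (e * norm v)"
      using e by (intro norm_triangle_le) (simp add: norm_smult norm_mult)
    also have "\<dots> \<le> norm z + 1 * (e * norm v)"
      using that e by (intro add_left_mono mult_right_mono) auto
    also have "norm z \<le> norm z0 + norm (z - z0)"
      by (metis add.commute diff_add_cancel norm_triangle_ineq)
    also have "norm (z - z0) < e" using that by (simp add: dist_norm norm_minus_commute)
    also have "norm z0 + e + 1 * (e * norm v) < norm z0 + e * (2 + norm v)"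
      using e by (simp add: algebra_simps)
    also have "e * (2 + norm v) = 1 - norm z0"
      unfolding e_def using norm_ge_zero[of v] by (simp add: add_nonneg_eq_0_iff)
    finally show ?thesis by simp
  qed
  with e show ?thesis by (intro that[of e]) auto
qed

lemma cderiv_integral:
  fixes f :: "complex ^ 'N \<Rightarrow> complex"
  assumes f: "holo f" and ab: "\<And>l. cmod l \<le> 1 \<Longrightarrow> a + l *s (complex_of_real e *s v) \<in> ball 0 1"
    and e: "e > 0"
  shows "cderiv f a v = integral (cbox 0 (2*pi)) (\<lambda>t. cis (- t) * f (a + cis t *s (complex_of_real e *s v)))
            / (2 * pi * e)"
proof -
  have a: "a \<in> ball 0 1" using ab[of 0] by simp
  have "2 * pi * (e * cderiv f a v) = 
    integral (cbox 0 (2*pi)) (\<lambda>t. cis (- t) * f (a + cis t *s (complex_of_real e *s v)))"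
    using slice_mean_deriv[OF f ab] by (simp add: cderiv_smult[OF f a] integral_unique)
  then show ?thesis using e by (simp add: field_simps)
qed

lemma continuous_on_cderiv_dir:
  fixes f :: "complex ^ 'N \<Rightarrow> complex"
  assumes f: "holo f"
  shows "continuous_on (ball 0 1) (\<lambda>z. cderiv f z v)"
proof (rule continuous_at_imp_continuous_on, rule ballI)
  fix z0 :: "complex ^ 'N" assume z0: "z0 \<in> ball 0 1"
  obtain e where e: "e > 0"
    and m: "\<And>z l. z \<in> ball z0 e \<Longrightarrow> cmod l \<le> 1 \<Longrightarrow> z + l *s (complex_of_real e *s v) \<in> ball 0 1"
    using holo_margin[OF z0, of v] by metis
  define V where "V = complex_of_real e *s v"
  have mV: "z \<in> ball z0 e \<Longrightarrow> cmod l \<le> 1 \<Longrightarrow> z + l *s V \<in> ball 0 1" for z l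
    using m by (simp add: V_def)
  let ?I = "\<lambda>z. integral (cbox 0 (2*pi)) (\<lambda>t. cis (- t) * f (z + cis t *s V)) / (2 * pi * e)"
  have "continuous_on (ball z0 e \<times> cbox 0 (2*pi)) (\<lambda>x. f (fst x + cis (snd x) *s V))"
    by (rule continuous_on_holo_compose[OF f]) (intro continuous_intros, use mV in force)
  then have "continuous_on (ball z0 e \<times> cbox 0 (2*pi)) (\<lambda>(z, t). cis (- t) * f (z + cis t *s V))"
    unfolding split_beta by (intro continuous_intros)
  from integral_continuous_on_param[OF this] have "continuous_on (ball z0 e) ?I"
    using e by (intro continuous_on_divide continuous_on_const) auto
  then have "continuous_on (ball z0 e) (\<lambda>z. cderiv f z v)"
    by (rule continuous_on_eq) (simp only: V_def cderiv_integral[OF f m e])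
  then show "isCont (\<lambda>z. cderiv f z v) z0"
    using e by (simp add: continuous_on_eq_continuous_at)
qed

text \<open>
  Cauchy's formula expresses the derivative in direction \<open>v\<close> by values of \<open>f\<close>, and may be
  differentiated under the integral because the differential of \<open>f\<close> is continuous. The resulting
  formula shows both that directional derivatives are holomorphic and that they commute.\<close>
lemma holo_cderiv_dir_aux:
  fixes f :: "complex ^ 'N \<Rightarrow> complex"
  assumes f: "holo f" and z0: "z0 \<in> ball 0 1"
  obtains D e where "((\<lambda>z. cderiv f z v) has_derivative D) (at z0)" "e > 0"
    "\<And>l. cmod l \<le> 1 \<Longrightarrow> z0 + l *s (complex_of_real e *s v) \<in> ball 0 1"
    "\<And>w. D w = integral (cbox 0 (2*pi))
        (\<lambda>t. cis (- t) * cderiv f (z0 + cis t *s (complex_of_real e *s v)) w) / (2 * pi * e)"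
proof -
  obtain e where e: "e > 0"
    and m0: "\<And>z l. z \<in> ball z0 e \<Longrightarrow> cmod l \<le> 1 \<Longrightarrow> z + l *s (complex_of_real e *s v) \<in> ball 0 1"
    using holo_margin[OF z0, of v] by metis
  define V where "V = complex_of_real e *s v"
  have m: "z \<in> ball z0 e \<Longrightarrow> cmod l \<le> 1 \<Longrightarrow> z + l *s V \<in> ball 0 1" for z l
    unfolding V_def by (rule m0)
  define F' where "F' z t = Blinfun (\<lambda>w. cis (- t) * cderiv f (z + cis t *s V) w)" for z and t :: real
  have bl: "bounded_linear (\<lambda>w. cis (- t) * cderiv f (z + cis t *s V) w)"
    if "z \<in> ball z0 e" for z and t :: real
    using has_derivative_bounded_linear[OF has_derivative_cderiv[OF f m[OF that, of "cis t"]]]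
    by (simp add: bounded_linear_mult_const bounded_linear_const_mult)
  have F'_apply: "blinfun_apply (F' z t) w = cis (- t) * cderiv f (z + cis t *s V) w"
    if "z \<in> ball z0 e" for z w and t :: real
    unfolding F'_def using bl[OF that] by (simp add: bounded_linear_Blinfun_apply)
  have cont: "continuous_on (ball z0 e \<times> cbox 0 (2*pi)) (\<lambda>(z, t). F' z t)"
  proof (rule continuous_on_blinfun_componentwise)
    fix i :: "complex ^ 'N"
    have "continuous_on (ball z0 e \<times> cbox 0 (2*pi))
        (\<lambda>x. cis (- snd x) * cderiv f (fst x + cis (snd x) *s V) i)"
      by (intro continuous_intros continuous_on_compose2[OF continuous_on_cderiv_dir[OF f, of i]])
         (auto intro!: m simp del: mem_ball)
    then show "continuous_on (ball z0 e \<times> cbox 0 (2*pi))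
        (\<lambda>x. blinfun_apply (case x of (z, t) \<Rightarrow> F' z t) i)"
      by (rule continuous_on_eq) (auto simp: F'_apply)
  qed
  let ?F = "\<lambda>z. integral (cbox 0 (2*pi)) (\<lambda>t. cis (- t) * f (z + cis t *s V))"
  have z0e: "z0 \<in> ball z0 e" using e by simp
  have "(?F has_derivative integral (cbox 0 (2*pi)) (F' z0)) (at z0 within ball z0 e)"
  proof (rule leibniz_rule[OF _ _ cont z0e convex_ball])
    fix z t assume z: "z \<in> ball z0 e"
    have "((\<lambda>z. f (z + cis t *s V)) has_derivative cderiv f (z + cis t *s V)) (at z)"
      using has_derivative_compose[OF has_derivative_add_const[OF has_derivative_ident]
          has_derivative_cderiv[OF f m[OF z, of "cis t"]]]
      by simp
    then have "((\<lambda>z. cis (- t) * f (z + cis t *s V)) has_derivative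
        (\<lambda>w. cis (- t) * cderiv f (z + cis t *s V) w)) (at z)"
      by (rule has_derivative_mult_right)
    then show "((\<lambda>z. cis (- t) * f (z + cis t *s V)) has_derivative blinfun_apply (F' z t)) (at z within ball z0 e)"
      unfolding F'_def using bl[OF z]
      by (simp add: bounded_linear_Blinfun_apply has_derivative_at_withinI)
  next
    fix z assume z: "z \<in> ball z0 e"
    show "(\<lambda>t. cis (- t) * f (z + cis t *s V)) integrable_on cbox 0 (2*pi)"
      by (intro integrable_continuous continuous_intros continuous_on_holo_compose[OF f] m[OF z]) auto
  qed
  then have "(?F has_derivative integral (cbox 0 (2*pi)) (F' z0)) (at z0)"
    using at_within_open[OF z0e] by simp
  then have 1: "((\<lambda>z. ?F z / (2 * pi * e)) has_derivative
      (\<lambda>w. blinfun_apply (integral (cbox 0 (2*pi)) (F' z0)) w / (2 * pi * e))) (at z0)"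
    by (rule bounded_linear.has_derivative[OF bounded_linear_divide])
  have 2: "((\<lambda>z. cderiv f z v) has_derivative
      (\<lambda>w. blinfun_apply (integral (cbox 0 (2*pi)) (F' z0)) w / (2 * pi * e))) (at z0)"
    by (rule has_derivative_transform_within_open[OF 1 open_ball z0e])
       (simp only: V_def cderiv_integral[OF f m0 e])
  have "continuous_on (cbox 0 (2*pi)) (F' z0)"
    using continuous_on_compose2[OF cont, of "cbox 0 (2*pi)" "\<lambda>t. (z0, t)"] z0e
    by (simp add: image_subset_iff continuous_on_Pair)
  then have 3: "blinfun_apply (integral (cbox 0 (2*pi)) (F' z0)) w =
      integral (cbox 0 (2*pi)) (\<lambda>t. cis (- t) * cderiv f (z0 + cis t *s V) w)" for w
    by (subst blinfun_apply_integral[OF integrable_continuous]) (simp_all add: F'_apply[OF z0e])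
  show ?thesis
    by (rule that[OF 2 e m0[OF z0e]]) (assumption, simp only: 3 V_def)
qed

lemma holo_cderiv_dir:
  fixes f :: "complex ^ 'N \<Rightarrow> complex"
  assumes f: "holo f"
  shows "holo (\<lambda>z. cderiv f z v)"
  unfolding holomorphic_several_def
proof
  fix z0 :: "complex ^ 'N" assume z0: "z0 \<in> ball 0 1"
  obtain D e where D: "((\<lambda>z. cderiv f z v) has_derivative D) (at z0)" and e: "e > 0"
    and m: "\<And>l. cmod l \<le> 1 \<Longrightarrow> z0 + l *s (complex_of_real e *s v) \<in> ball 0 1"
    and I: "\<And>w. D w = integral (cbox 0 (2*pi))
        (\<lambda>t. cis (- t) * cderiv f (z0 + cis t *s (complex_of_real e *s v)) w) / (2 * pi * e)"
    by (rule holo_cderiv_dir_aux[OF f z0, of v]) (rule that, assumption+)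
  have "D (c *s w) = c * D w" for c w
  proof -
    have "(\<lambda>t. cis (- t) * cderiv f (z0 + cis t *s (complex_of_real e *s v)) (c *s w)) =
        (\<lambda>t. c * (cis (- t) * cderiv f (z0 + cis t *s (complex_of_real e *s v)) w))"
      by (rule ext) (subst cderiv_smult[OF f m], simp, simp add: mult_ac)
    then show ?thesis unfolding I by (simp only: integral_mult_right times_divide_eq_right)
  qed
  then have "Vector_Spaces.linear (*s) (*) D"
    by (rule clinearI[OF D])
  with D show "\<exists>D. Vector_Spaces.linear (*s) (*) D \<and> ((\<lambda>z. cderiv f z v) has_derivative D) (at z0)"
    by blast
qed

lemma cderiv_commute:
  fixes f :: "complex ^ 'N \<Rightarrow> complex"
  assumes f: "holo f" and z0: "z0 \<in> ball 0 1"
  shows "cderiv (\<lambda>z. cderiv f z v) z0 w = cderiv (\<lambda>z. cderiv f z w) z0 v"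
proof -
  obtain D e where D: "((\<lambda>z. cderiv f z v) has_derivative D) (at z0)" and e: "e > 0"
    and m: "\<And>l. cmod l \<le> 1 \<Longrightarrow> z0 + l *s (complex_of_real e *s v) \<in> ball 0 1"
    and I: "\<And>w. D w = integral (cbox 0 (2*pi))
        (\<lambda>t. cis (- t) * cderiv f (z0 + cis t *s (complex_of_real e *s v)) w) / (2 * pi * e)"
    by (rule holo_cderiv_dir_aux[OF f z0, of v]) (rule that, assumption+)
  show ?thesis
    using cderiv_integral[OF holo_cderiv_dir[OF f, of w] m e] I[of w] cderiv_unique[OF D] by simp
qed

section \<open>Partial derivatives and the Euler operator\<close>

lemma holoI:
  fixes f :: "complex ^ 'N \<Rightarrow> complex"
  assumes "\<And>z. z \<in> ball 0 1 \<Longrightarrow> (f has_derivative D z) (at z)"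
    and "\<And>z c w. z \<in> ball 0 1 \<Longrightarrow> D z (c *s w) = c * D z w"
  shows "holo f"
  unfolding holomorphic_several_def using assms clinearI[OF assms(1)] by blast

lemma holo_cong:
  fixes f :: "complex ^ 'N \<Rightarrow> complex"
  assumes g: "holo g" and eq: "\<And>z. z \<in> ball 0 1 \<Longrightarrow> f z = g z"
  shows "holo f"
proof (rule holoI)
  fix z :: "complex ^ 'N" assume z: "z \<in> ball 0 1"
  show "(f has_derivative cderiv g z) (at z)"
    by (rule has_derivative_transform_within_open[OF has_derivative_cderiv[OF g z] open_ball z])
       (simp add: eq)
qed (rule cderiv_smult[OF g])

lemma cderiv_cong:
  fixes f :: "complex ^ 'N \<Rightarrow> complex"
  assumes g: "holo g" and eq: "\<And>z. z \<in> ball 0 1 \<Longrightarrow> f z = g z" and z: "z \<in> ball 0 1"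
  shows "cderiv f z = cderiv g z"
  by (rule cderiv_unique, rule has_derivative_transform_within_open[OF has_derivative_cderiv[OF g z] open_ball z])
     (simp add: eq)

lemma cderiv_diff:
  assumes "holo f" "holo g" "z \<in> ball 0 1"
  shows "cderiv (\<lambda>z. f z - g z) z = (\<lambda>w. cderiv f z w - cderiv g z w)"
  by (rule cderiv_unique, rule has_derivative_diff) (rule has_derivative_cderiv assms)+

lemma holo_diff: "holo f \<Longrightarrow> holo g \<Longrightarrow> holo (\<lambda>z. f z - g z)"
  by (rule holoI, rule has_derivative_diff)
     (assumption | rule has_derivative_cderiv | simp add: cderiv_smult algebra_simps)+

lemma has_derivative_mult_cderiv:
  assumes "holo f" "holo g" "z \<in> ball 0 1"
  shows "((\<lambda>z. f z * g z) has_derivative (\<lambda>w. f z * cderiv g z w + cderiv f z w * g z)) (at z)"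
  by (rule has_derivative_mult) (rule has_derivative_cderiv assms)+

lemma holo_mult:
  assumes "holo f" "holo g" shows "holo (\<lambda>z. f z * g z)"
  by (rule holoI, rule has_derivative_mult_cderiv[OF assms])
     (simp_all add: cderiv_smult assms algebra_simps)

lemma has_derivative_vec_nth: "((\<lambda>z. z $ i) has_derivative (\<lambda>w. w $ i)) F"
  by (rule bounded_linear.has_derivative[OF bounded_linear_vec_nth has_derivative_ident])

lemma holo_coord: "holo (\<lambda>z. z $ i)"
  by (rule holoI, rule has_derivative_vec_nth) simp

lemma holo_sum:
  fixes f :: "'i \<Rightarrow> complex ^ 'N \<Rightarrow> complex"
  assumes "\<And>i. i \<in> I \<Longrightarrow> holo (f i)"
  shows "holo (\<lambda>z. \<Sum>i\<in>I. f i z)"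
proof (rule holoI)
  fix z :: "complex ^ 'N" assume z: "z \<in> ball 0 1"
  show "((\<lambda>z. \<Sum>i\<in>I. f i z) has_derivative (\<lambda>w. \<Sum>i\<in>I. cderiv (f i) z w)) (at z)"
    by (rule has_derivative_sum) (rule has_derivative_cderiv[OF assms z])
qed (simp add: assms cderiv_smult sum_distrib_left)

definition partial_deriv :: "'N \<Rightarrow> (complex ^ 'N \<Rightarrow> complex) \<Rightarrow> complex ^ 'N \<Rightarrow> complex" where
  "partial_deriv i f z = cderiv f z (axis i 1)"

lemma partial_deriv_eq: "partial_deriv i f = (\<lambda>z. cderiv f z (axis i 1))"
  by (simp add: fun_eq_iff partial_deriv_def)

lemma holo_partial_deriv: "holo f \<Longrightarrow> holo (partial_deriv i f)"
  unfolding partial_deriv_def by (rule holo_cderiv_dir)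

lemma cderiv_eq_sum_partial_deriv:
  fixes f :: "complex ^ 'N \<Rightarrow> complex"
  assumes f: "holo f" "z \<in> ball 0 1"
  shows "cderiv f z u = (\<Sum>i\<in>UNIV. u $ i * partial_deriv i f z)"
proof -
  have lin: "linear (cderiv f z)"
    using has_derivative_bounded_linear[OF has_derivative_cderiv[OF f]] by (rule bounded_linear.linear)
  have "cderiv f z u = cderiv f z (\<Sum>i\<in>UNIV. u $ i *s axis i 1)"
    by (simp only: basis_expansion)
  also have "\<dots> = (\<Sum>i\<in>UNIV. u $ i * partial_deriv i f z)"
    by (simp add: linear_sum[OF lin] cderiv_smult[OF f] partial_deriv_def)
  finally show ?thesis .
qed

text \<open>
  The radial derivative \<open>R\<close> in coordinate-free form. The iterates of this operator are compared with
  the series \<open>radial_deriv\<close> once homogeneous expansions are available.\<close>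
definition euler_op :: "(complex ^ 'N \<Rightarrow> complex) \<Rightarrow> complex ^ 'N \<Rightarrow> complex" where
  "euler_op f z = cderiv f z z"

lemma euler_op_cong:
  fixes f :: "complex ^ 'N \<Rightarrow> complex"
  assumes "holo g" "\<And>z. z \<in> ball 0 1 \<Longrightarrow> f z = g z" "z \<in> ball 0 1"
  shows "euler_op f z = euler_op g z"
  by (simp only: euler_op_def cderiv_cong[OF assms])

lemma euler_op_eq_sum_partial_deriv: "holo f \<Longrightarrow> z \<in> ball 0 1 \<Longrightarrow> euler_op f z = (\<Sum>i\<in>UNIV. z $ i * partial_deriv i f z)"
  unfolding euler_op_def by (rule cderiv_eq_sum_partial_deriv)

lemma holo_euler_op: "holo f \<Longrightarrow> holo (euler_op f)"
  by (rule holo_cong[OF _ euler_op_eq_sum_partial_deriv]) (auto intro!: holo_sum holo_mult holo_coord holo_partial_deriv)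

lemma holo_euler_op_funpow: "holo f \<Longrightarrow> holo ((euler_op ^^ n) f)"
  by (induction n) (auto intro: holo_euler_op)

text \<open>
  The right-hand side, taken at \<open>s z\<close>, is the derivative of \<open>s \<mapsto> s f'(s z) u\<close>. In this way the
  derivative of \<open>f\<close> in a fixed direction is recovered from that of \<open>R f\<close> by integration along a ray.
  The product rule needs mixed second derivatives to be symmetric.\<close>
lemma cderiv_euler_op:
  fixes f :: "complex ^ 'N \<Rightarrow> complex"
  assumes f: "holo f" and z: "z \<in> ball 0 1"
  shows "cderiv (euler_op f) z u = cderiv f z u + cderiv (\<lambda>x. cderiv f x u) z z"
proof -
  have 1: "((\<lambda>z. \<Sum>i\<in>UNIV. z $ i * partial_deriv i f z) has_derivative
      (\<lambda>w. \<Sum>i\<in>UNIV. z $ i * cderiv (partial_deriv i f) z w + w $ i * partial_deriv i f z)) (at z)"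
    by (rule has_derivative_sum, rule has_derivative_mult[OF has_derivative_vec_nth])
       (rule has_derivative_cderiv[OF holo_partial_deriv[OF f] z])
  have "(euler_op f has_derivative
      (\<lambda>w. \<Sum>i\<in>UNIV. z $ i * cderiv (partial_deriv i f) z w + w $ i * partial_deriv i f z)) (at z)"
    by (rule has_derivative_transform_within_open[OF 1 open_ball z]) (simp add: euler_op_eq_sum_partial_deriv[OF f])
  then have "cderiv (euler_op f) z u = (\<Sum>i\<in>UNIV. z $ i * cderiv (partial_deriv i f) z u + u $ i * partial_deriv i f z)"
    by (simp only: cderiv_unique)
  also have "\<dots> = (\<Sum>i\<in>UNIV. z $ i * partial_deriv i (\<lambda>x. cderiv f x u) z) + cderiv f z u"
    using cderiv_commute[OF f z]
    by (simp add: partial_deriv_eq[of _ f] sum.distrib cderiv_eq_sum_partial_deriv[OF f z, of u] partial_deriv_def)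
  also have "(\<Sum>i\<in>UNIV. z $ i * partial_deriv i (\<lambda>x. cderiv f x u) z) = cderiv (\<lambda>x. cderiv f x u) z z"
    by (rule cderiv_eq_sum_partial_deriv[OF holo_cderiv_dir[OF f] z, symmetric])
  finally show ?thesis by (simp add: add.commute)
qed

lemma ball_operators_bounded_linear:
  assumes "U \<in> ball_operators" shows "bounded_linear U"
proof -
  have "Vector_Spaces.linear (*s) (*s) U" using assms by (simp add: ball_operators_def)
  then have "linear U"
    by (intro linearI) (simp_all add: Vector_Spaces.linear_iff scaleR_eq_smult)
  then show ?thesis by (rule linear_conv_bounded_linear[THEN iffD1])
qed

lemma ball_operators_smult: "U \<in> ball_operators \<Longrightarrow> U (c *s x) = c *s U x"
  by (simp add: ball_operators_def Vector_Spaces.linear_iff)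

lemma ball_operators_ball: "U \<in> ball_operators \<Longrightarrow> z \<in> ball 0 1 \<Longrightarrow> U z \<in> ball 0 1"
  unfolding ball_operators_def by blast

lemma has_derivative_compose_operator:
  assumes U: "U \<in> ball_operators" and f: "holo f" and z: "z \<in> ball 0 1"
  shows "((\<lambda>z. f (U z)) has_derivative (\<lambda>w. cderiv f (U z) (U w))) (at z)"
  using has_derivative_compose[OF bounded_linear_imp_has_derivative[OF ball_operators_bounded_linear[OF U]]
      has_derivative_cderiv[OF f ball_operators_ball[OF U z]]] .

lemma holo_compose_operator:
  assumes U: "U \<in> ball_operators" and f: "holo f"
  shows "holo (\<lambda>z. f (U z))"
  by (rule holoI[OF has_derivative_compose_operator[OF U f]])
     (simp_all add: ball_operators_smult[OF U] cderiv_smult[OF f ball_operators_ball[OF U]] del: mem_ball)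

lemma holo_op_diff: "U \<in> ball_operators \<Longrightarrow> holo f \<Longrightarrow> holo (op_diff U f)"
  unfolding op_diff_def by (rule holo_diff[OF holo_compose_operator])

lemma euler_op_op_diff:
  assumes U: "U \<in> ball_operators" and f: "holo f" and z: "z \<in> ball 0 1"
  shows "euler_op (op_diff U f) z = op_diff U (euler_op f) z"
  unfolding euler_op_def op_diff_def
  by (simp add: cderiv_diff[OF holo_compose_operator[OF U f] f z]
      cderiv_unique[OF has_derivative_compose_operator[OF U f z]])

text \<open>
  Because \<open>U\<close> is linear, \<open>R (f \<circ> U) = (R f) \<circ> U\<close>. This is what makes an induction on the order of
  the difference possible.\<close>
lemma euler_op_funpow_op_diff:
  assumes U: "U \<in> ball_operators" and f: "holo f" and z: "z \<in> ball 0 1"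
  shows "(euler_op ^^ n) (op_diff U f) z = op_diff U ((euler_op ^^ n) f) z"
  using z
proof (induction n arbitrary: z)
  case (Suc n)
  have h: "holo (op_diff U ((euler_op ^^ n) f))" by (rule holo_op_diff[OF U holo_euler_op_funpow[OF f]])
  have "euler_op ((euler_op ^^ n) (op_diff U f)) z = euler_op (op_diff U ((euler_op ^^ n) f)) z"
    by (rule euler_op_cong[OF h Suc.IH Suc.prems])
  then show ?case using euler_op_op_diff[OF U holo_euler_op_funpow[OF f] Suc.prems] by simp
qed simp

section \<open>Homogeneous expansions\<close>

lemma finite_multi_indices: "finite {\<alpha> :: 'N::finite \<Rightarrow> nat. (\<Sum>i\<in>UNIV. \<alpha> i) = k}"
proof (rule finite_subset)
  show "finite (PiE UNIV (\<lambda>_ :: 'N. {..k}))" by (intro finite_PiE) auto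
  show "{\<alpha>. (\<Sum>i\<in>UNIV. \<alpha> i) = k} \<subseteq> PiE UNIV (\<lambda>_ :: 'N. {..k})"
    by (auto simp: PiE_def intro: member_le_sum)
qed

lemma homogeneous_poly_const: "homogeneous_poly 0 (\<lambda>z :: complex ^ 'N. a)"
proof -
  have "{\<alpha> :: 'N \<Rightarrow> nat. (\<Sum>i\<in>UNIV. \<alpha> i) = 0} = {\<lambda>_. 0}" by (auto simp: fun_eq_iff)
  then show ?thesis
    unfolding homogeneous_poly_def by (intro exI[of _ "\<lambda>_. a"]) simp
qed

lemma homogeneous_poly_cmult:
  assumes "homogeneous_poly k P" shows "homogeneous_poly k (\<lambda>z. a * P z)"
proof -
  from assms obtain c where "\<And>z. P z = (\<Sum>\<alpha> | (\<Sum>i\<in>UNIV. \<alpha> i) = k. c \<alpha> * (\<Prod>i\<in>UNIV. (z $ i) ^ \<alpha> i))"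
    unfolding homogeneous_poly_def by blast
  then show ?thesis
    unfolding homogeneous_poly_def by (intro exI[of _ "\<lambda>\<alpha>. a * c \<alpha>"]) (simp add: sum_distrib_left mult_ac)
qed

lemma homogeneous_poly_sum:
  fixes P :: "'i \<Rightarrow> complex ^ 'N \<Rightarrow> complex"
  assumes "\<And>i. i \<in> I \<Longrightarrow> homogeneous_poly k (P i)"
  shows "homogeneous_poly k (\<lambda>z. \<Sum>i\<in>I. P i z)"
proof -
  from assms have "\<forall>i\<in>I. \<exists>c. \<forall>z. P i z = (\<Sum>\<alpha> | (\<Sum>i\<in>UNIV. \<alpha> i) = k. c \<alpha> * (\<Prod>i\<in>UNIV. (z $ i) ^ \<alpha> i))"
    unfolding homogeneous_poly_def by blast
  then obtain c where c: "\<And>i z. i \<in> I \<Longrightarrow>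
      P i z = (\<Sum>\<alpha> | (\<Sum>i\<in>UNIV. \<alpha> i) = k. c i \<alpha> * (\<Prod>i\<in>UNIV. (z $ i) ^ \<alpha> i))"
    by metis
  have "(\<Sum>i\<in>I. P i z) = (\<Sum>\<alpha> | (\<Sum>i\<in>UNIV. \<alpha> i) = k. (\<Sum>i\<in>I. c i \<alpha>) * (\<Prod>i\<in>UNIV. (z $ i) ^ \<alpha> i))" for z
    by (simp add: c sum_distrib_right) (rule sum.swap)
  then show ?thesis unfolding homogeneous_poly_def by (intro exI[of _ "\<lambda>\<alpha>. \<Sum>i\<in>I. c i \<alpha>"]) blast
qed

lemma homogeneous_poly_coord_mult:
  fixes P :: "complex ^ 'N \<Rightarrow> complex"
  assumes "homogeneous_poly k P"
  shows "homogeneous_poly (Suc k) (\<lambda>z. z $ j * P z)"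
proof -
  from assms obtain c where c: "\<And>z. P z = (\<Sum>\<alpha> | (\<Sum>i\<in>UNIV. \<alpha> i) = k. c \<alpha> * (\<Prod>i\<in>UNIV. (z $ i) ^ \<alpha> i))"
    unfolding homogeneous_poly_def by blast
  define up :: "('N \<Rightarrow> nat) \<Rightarrow> ('N \<Rightarrow> nat)" where "up \<alpha> = \<alpha>(j := Suc (\<alpha> j))" for \<alpha>
  define down :: "('N \<Rightarrow> nat) \<Rightarrow> ('N \<Rightarrow> nat)" where "down \<alpha> = \<alpha>(j := \<alpha> j - 1)" for \<alpha>
  have du: "down (up \<alpha>) = \<alpha>" for \<alpha> by (simp add: up_def down_def)
  have sup: "(\<Sum>i\<in>UNIV. up \<alpha> i) = Suc (\<Sum>i\<in>UNIV. \<alpha> i)" for \<alpha>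
    by (simp add: up_def sum.remove[of UNIV j])
  have prod_up: "(\<Prod>i\<in>UNIV. (z $ i) ^ up \<alpha> i) = z $ j * (\<Prod>i\<in>UNIV. (z $ i) ^ \<alpha> i)" for z :: "complex ^ 'N" and \<alpha>
    by (simp add: up_def prod.remove[of UNIV j])
  define c' where "c' \<beta> = (if \<beta> j > 0 then c (down \<beta>) else 0)" for \<beta>
  have up_pos: "up \<alpha> j > 0" for \<alpha> by (simp add: up_def)
  have c'_up: "c' (up \<alpha>) = c \<alpha>" for \<alpha> using up_pos[of \<alpha>] by (simp add: c'_def du)
  have "z $ j * P z = (\<Sum>\<beta> | (\<Sum>i\<in>UNIV. \<beta> i) = Suc k. c' \<beta> * (\<Prod>i\<in>UNIV. (z $ i) ^ \<beta> i))" for z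
  proof -
    let ?A = "{\<alpha> :: 'N \<Rightarrow> nat. (\<Sum>i\<in>UNIV. \<alpha> i) = k}"
    have inj: "inj_on up ?A" by (rule inj_on_inverseI[of _ down]) (rule du)
    have "z $ j * P z = (\<Sum>\<alpha>\<in>?A. c' (up \<alpha>) * (\<Prod>i\<in>UNIV. (z $ i) ^ up \<alpha> i))"
      by (simp add: c sum_distrib_left prod_up c'_up mult_ac)
    also have "\<dots> = (\<Sum>\<beta>\<in>up ` ?A. c' \<beta> * (\<Prod>i\<in>UNIV. (z $ i) ^ \<beta> i))"
      by (simp add: sum.reindex[OF inj])
    also have "\<dots> = (\<Sum>\<beta> | (\<Sum>i\<in>UNIV. \<beta> i) = Suc k. c' \<beta> * (\<Prod>i\<in>UNIV. (z $ i) ^ \<beta> i))"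
    proof (rule sum.mono_neutral_left[OF finite_multi_indices])
      show "up ` ?A \<subseteq> {\<beta>. (\<Sum>i\<in>UNIV. \<beta> i) = Suc k}" by (auto simp: sup)
      show "\<forall>\<beta>\<in>{\<beta>. (\<Sum>i\<in>UNIV. \<beta> i) = Suc k} - up ` ?A. c' \<beta> * (\<Prod>i\<in>UNIV. (z $ i) ^ \<beta> i) = 0"
      proof
        fix \<beta> assume b: "\<beta> \<in> {\<beta>. (\<Sum>i\<in>UNIV. \<beta> i) = Suc k} - up ` ?A"
        have "\<beta> j = 0"
        proof (rule ccontr)
          assume "\<beta> j \<noteq> 0"
          then have u: "up (down \<beta>) = \<beta>" by (simp add: up_def down_def fun_eq_iff)
          have "Suc (\<Sum>i\<in>UNIV. down \<beta> i) = Suc k" using b sup[of "down \<beta>"] by (simp add: u)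
          then have "\<beta> \<in> up ` ?A" by (intro image_eqI[of _ _ "down \<beta>"]) (simp_all add: u)
          with b show False by blast
        qed
        then show "c' \<beta> * (\<Prod>i\<in>UNIV. (z $ i) ^ \<beta> i) = 0" by (simp add: c'_def)
      qed
    qed
    finally show ?thesis .
  qed
  then show ?thesis unfolding homogeneous_poly_def by blast
qed

lemma homogeneous_poly_smult:
  assumes "homogeneous_poly k P" shows "P (l *s z) = l ^ k * P z"
proof -
  from assms obtain c where c: "\<And>z. P z = (\<Sum>\<alpha> | (\<Sum>i\<in>UNIV. \<alpha> i) = k. c \<alpha> * (\<Prod>i\<in>UNIV. (z $ i) ^ \<alpha> i))"
    unfolding homogeneous_poly_def by blast
  show ?thesis
    unfolding c[of "l *s z"] c[of z] sum_distrib_left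
    by (rule sum.cong) (auto simp: power_mult_distrib prod.distrib power_sum mult_ac)
qed

text \<open>
  The homogeneous part of degree \<open>k\<close> is constructed as the \<open>k\<close>-th Taylor coefficient of
  \<open>l \<mapsto> f(l z)\<close> at \<open>0\<close>. It makes sense for every \<open>z\<close>, also outside the ball.\<close>
definition slice_fps :: "(complex ^ 'N \<Rightarrow> complex) \<Rightarrow> complex ^ 'N \<Rightarrow> complex fps" where
  "slice_fps f z = fps_expansion (\<lambda>l. f (l *s z)) 0"

abbreviation slice_coef :: "(complex ^ 'N \<Rightarrow> complex) \<Rightarrow> nat \<Rightarrow> complex ^ 'N \<Rightarrow> complex" where
  "slice_coef f k z \<equiv> fps_nth (slice_fps f z) k"

lemma slice_region:
  fixes z :: "complex ^ 'N"
  shows "open {l. l *s z \<in> ball 0 1}" "0 \<in> {l. l *s z \<in> ball 0 1}"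
proof -
  have "{l. l *s z \<in> ball 0 1} = (\<lambda>l. l *s z) -` ball 0 1" by auto
  moreover have "continuous_on UNIV (\<lambda>l. l *s z)" by (intro continuous_intros)
  ultimately show "open {l. l *s z \<in> ball 0 1}" by (simp add: open_vimage del: mem_ball)
qed simp

lemma holo_slice_deriv0:
  assumes "holo f" "l *s z \<in> ball 0 1"
  shows "((\<lambda>l. f (l *s z)) has_field_derivative cderiv f (l *s z) z) (at l)"
  using holo_slice_deriv[of f 0 l z] assms by simp

lemma slice_holomorphic:
  assumes "holo f" "\<And>l. l \<in> S \<Longrightarrow> l *s z \<in> ball 0 1"
  shows "(\<lambda>l. f (l *s z)) holomorphic_on S"
  unfolding holomorphic_on_def field_differentiable_def
  by (intro ballI exI, rule has_field_derivative_at_within, rule holo_slice_deriv0) (use assms in auto)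

lemma slice_has_fps_expansion:
  assumes "holo f" shows "(\<lambda>l. f (l *s z)) has_fps_expansion slice_fps f z"
  unfolding slice_fps_def
  by (rule has_fps_expansion_fps_expansion[OF slice_region slice_holomorphic[OF assms]]) simp

lemma slice_fps_eqI:
  assumes "holo f" "(\<lambda>l. f (l *s z)) has_fps_expansion F" shows "slice_fps f z = F"
  unfolding slice_fps_def using assms(2) by (rule fps_expansion_eqI)

lemma slice_deriv_fps:
  assumes f: "holo f"
  shows "(\<lambda>l. cderiv f (l *s z) z) has_fps_expansion fps_deriv (slice_fps f z)"
proof -
  have "eventually (\<lambda>l. l \<in> {l. l *s z \<in> ball 0 1}) (nhds 0)"
    by (rule eventually_nhds_in_open[OF slice_region])
  then have "eventually (\<lambda>l. deriv (\<lambda>l. f (l *s z)) l = cderiv f (l *s z) z) (nhds 0)"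
    by eventually_elim (simp add: DERIV_imp_deriv[OF holo_slice_deriv0[OF f]])
  from has_fps_expansion_cong[OF this refl] show ?thesis
    using has_fps_expansion_deriv[OF slice_has_fps_expansion[OF f, of z]] by simp
qed

lemma slice_coef_0: "holo f \<Longrightarrow> slice_coef f 0 z = f 0"
  using has_fps_expansion_imp_0_eq_fps_nth_0[OF slice_has_fps_expansion[of f z]] by simp

text \<open>
  Differentiating \<open>l \<mapsto> f(l z)\<close> gives Euler's identity in each degree. It reduces the degree by one
  at the price of replacing \<open>f\<close> by its partial derivatives, and so proves by induction on the degree,
  for all holomorphic functions at once, that the coefficients are homogeneous polynomials.\<close>
lemma slice_coef_Suc:
  fixes f :: "complex ^ 'N \<Rightarrow> complex"
  assumes f: "holo f"
  shows "of_nat (Suc k) * slice_coef f (Suc k) z = (\<Sum>i\<in>UNIV. z $ i * slice_coef (partial_deriv i f) k z)"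
proof -
  have "(\<lambda>l. \<Sum>i\<in>UNIV. z $ i * partial_deriv i f (l *s z)) has_fps_expansion
      (\<Sum>i\<in>UNIV. fps_const (z $ i) * slice_fps (partial_deriv i f) z)"
    by (intro has_fps_expansion_sum has_fps_expansion_cmult_left slice_has_fps_expansion holo_partial_deriv f)
  moreover have "eventually (\<lambda>l. l \<in> {l. l *s z \<in> ball 0 1}) (nhds 0)"
    by (rule eventually_nhds_in_open[OF slice_region])
  then have "eventually (\<lambda>l. cderiv f (l *s z) z = (\<Sum>i\<in>UNIV. z $ i * partial_deriv i f (l *s z))) (nhds 0)"
    by eventually_elim (simp add: cderiv_eq_sum_partial_deriv[OF f])
  ultimately have "(\<lambda>l. cderiv f (l *s z) z) has_fps_expansion
      (\<Sum>i\<in>UNIV. fps_const (z $ i) * slice_fps (partial_deriv i f) z)"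
    by (simp add: has_fps_expansion_cong)
  from fps_expansion_unique_complex[OF slice_deriv_fps[OF f] this]
  have "fps_nth (fps_deriv (slice_fps f z)) k = fps_nth (\<Sum>i\<in>UNIV. fps_const (z $ i) * slice_fps (partial_deriv i f) z) k"
    by simp
  then show ?thesis by (simp add: fps_sum_nth)
qed

lemma homogeneous_poly_slice_coef: "holo f \<Longrightarrow> homogeneous_poly k (slice_coef f k)"
proof (induction k arbitrary: f)
  case 0
  then show ?case using homogeneous_poly_const[of "f 0"] by (simp add: slice_coef_0)
next
  case (Suc k)
  have "slice_coef f (Suc k) = (\<lambda>z. inverse (of_nat (Suc k)) * (\<Sum>i\<in>UNIV. z $ i * slice_coef (partial_deriv i f) k z))"
    unfolding slice_coef_Suc[OF Suc.prems, symmetric] by (simp add: fun_eq_iff del: of_nat_Suc)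
  then show ?case
    by (simp only:) (intro homogeneous_poly_cmult homogeneous_poly_sum homogeneous_poly_coord_mult
        Suc.IH holo_partial_deriv Suc.prems)
qed

lemma slice_coef_smult: "holo f \<Longrightarrow> slice_coef f k (l *s z) = l ^ k * slice_coef f k z"
  by (rule homogeneous_poly_smult[OF homogeneous_poly_slice_coef])

lemma slice_coef_sums_summable:
  fixes f :: "complex ^ 'N \<Rightarrow> complex"
  assumes f: "holo f" and z: "z \<in> ball 0 1"
  shows slice_coef_sums: "(\<lambda>k. slice_coef f k z) sums f z"
    and slice_coef_summable: "summable (\<lambda>k. cmod (slice_coef f k z))"
proof -
  \<comment> \<open>A radius with \<open>r > 1\<close> and \<open>r * norm z < 1\<close>: the slice is holomorphic beyond the closed unit disc.\<close>
  define r where "r = 2 / (1 + norm z)"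
  have r: "r > 1" "r * norm z \<le> 1" "r > 0" using z norm_ge_zero[of z]
    by (auto simp: r_def field_simps intro!: divide_pos_pos add_pos_nonneg simp del: norm_ge_zero)
  have b: "l *s z \<in> ball 0 1" if "l \<in> ball 0 r" for l
  proof -
    have "cmod l * norm z < 1"
    proof (cases "z = 0")
      case False
      then have "cmod l * norm z < r * norm z" using that by (intro mult_strict_right_mono) auto
      with r show ?thesis by linarith
    qed simp
    then show ?thesis by (simp add: norm_smult)
  qed
  have h: "(\<lambda>l. f (l *s z)) holomorphic_on eball 0 (ereal r)"
    by (simp only: eball_ereal) (rule slice_holomorphic[OF f b])
  have e: "(\<lambda>l. f (l *s z)) has_fps_expansion slice_fps f z" by (rule slice_has_fps_expansion[OF f])
  show "(\<lambda>k. slice_coef f k z) sums f z"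
    using has_fps_expansion_imp_sums_complex[OF e h, of 1] r by simp
  have "fps_conv_radius (slice_fps f z) \<ge> r" using e h by (rule holomorphic_on_imp_fps_conv_radius_ge)
  then have "ereal (norm (1::complex)) < fps_conv_radius (slice_fps f z)" using r
    by (metis ereal_less_eq(3) less_ereal.simps(1) norm_one order_less_le_trans)
  from norm_summable_fps[OF this] show "summable (\<lambda>k. cmod (slice_coef f k z))" by simp
qed

text \<open>
  Uniqueness: by homogeneity any expansion restricts on each complex line to a power series of the
  slice, whose coefficients are determined.\<close>
lemma homogeneous_part_eq:
  fixes f :: "complex ^ 'N \<Rightarrow> complex"
  assumes f: "holo f" shows "homogeneous_part f = slice_coef f"
  unfolding homogeneous_part_def
proof (rule the_equality)
  show "homogeneous_expansion f (slice_coef f)"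
    unfolding homogeneous_expansion_def using homogeneous_poly_slice_coef[OF f] slice_coef_sums[OF f] by blast
  fix F assume F: "homogeneous_expansion f F"
  show "F = slice_coef f"
  proof (intro ext)
    fix k and z :: "complex ^ 'N"
    have "eventually (\<lambda>l. l \<in> {l. l *s z \<in> ball 0 1}) (nhds 0)"
      by (rule eventually_nhds_in_open[OF slice_region])
    then have "eventually (\<lambda>l. (\<lambda>k. fps_nth (Abs_fps (\<lambda>k. F k z)) k * l ^ k) sums f (l *s z)) (nhds 0)"
    proof eventually_elim
      case (elim l)
      then have "(\<lambda>k. F k (l *s z)) sums f (l *s z)"
        using F unfolding homogeneous_expansion_def by blast
      moreover have "F k (l *s z) = l ^ k * F k z" for k
        using F homogeneous_poly_smult unfolding homogeneous_expansion_def by blast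
      ultimately show ?case by (simp add: mult.commute)
    qed
    from slice_fps_eqI[OF f has_fps_expansionI[OF this]] show "F k z = slice_coef f k z" by simp
  qed
qed

lemma slice_coef_euler_op:
  fixes f :: "complex ^ 'N \<Rightarrow> complex"
  assumes f: "holo f" shows "slice_coef (euler_op f) k z = of_nat k * slice_coef f k z"
proof -
  have 1: "(\<lambda>l. l * cderiv f (l *s z) z) has_fps_expansion fps_X * fps_deriv (slice_fps f z)"
    by (intro has_fps_expansion_mult has_fps_expansion_fps_X slice_deriv_fps f)
  have "eventually (\<lambda>l. l \<in> {l. l *s z \<in> ball 0 1}) (nhds 0)"
    by (rule eventually_nhds_in_open[OF slice_region])
  then have 2: "eventually (\<lambda>l. euler_op f (l *s z) = l * cderiv f (l *s z) z) (nhds 0)"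
    by eventually_elim (simp add: euler_op_def cderiv_smult[OF f])
  have "slice_fps (euler_op f) z = fps_X * fps_deriv (slice_fps f z)"
    using has_fps_expansion_cong[OF 2 refl] 1 by (intro slice_fps_eqI holo_euler_op f) simp
  then show ?thesis by (cases k) simp_all
qed

lemma slice_coef_euler_op_funpow:
  assumes f: "holo f" shows "slice_coef ((euler_op ^^ n) f) k z = of_nat k ^ n * slice_coef f k z"
  by (induction n) (simp_all add: slice_coef_euler_op[OF holo_euler_op_funpow[OF f]])

text \<open>
  The condition on \<open>n\<close> matters: for \<open>n = 0\<close> the series omits the constant term of \<open>f\<close>.\<close>
lemma radial_deriv_eq_euler_op:
  fixes f :: "complex ^ 'N \<Rightarrow> complex"
  assumes f: "holo f" and n: "n \<ge> 1" and z: "z \<in> ball 0 1"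
  shows "radial_deriv n f z = (euler_op ^^ n) f z"
proof -
  have "(\<lambda>k. of_nat k ^ n * slice_coef f k z) sums (euler_op ^^ n) f z"
    using slice_coef_sums[OF holo_euler_op_funpow[OF f] z, of n] by (simp add: slice_coef_euler_op_funpow[OF f])
  then have "(\<lambda>k. of_nat (Suc k) ^ n * slice_coef f (Suc k) z) sums (euler_op ^^ n) f z"
    using n by (subst sums_Suc_iff) (auto simp: power_0_left)
  then show ?thesis unfolding radial_deriv_def homogeneous_part_eq[OF f] by (simp only: sums_iff)
qed

text \<open>
  A rotation by \<open>t\<close> multiplies the part of degree \<open>k\<close> by \<open>e\<^sup>i\<^sup>k\<^sup>t\<close>.\<close>
lemma rot_diff_sums:
  fixes f :: "complex ^ 'N \<Rightarrow> complex"
  assumes f: "holo f" and z: "z \<in> ball 0 1"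
  shows "(\<lambda>k. (cis (real k * t) - 1) ^ n * slice_coef f k z) sums (rot_diff t ^^ n) f z"
  using z
proof (induction n arbitrary: z)
  case 0
  then show ?case using slice_coef_sums[OF f] by simp
next
  case (Suc n)
  have z': "cis t *s z \<in> ball 0 1" using Suc.prems by (simp add: norm_smult)
  have "(cis (real k * t) - 1) ^ Suc n * slice_coef f k z =
      (cis (real k * t) - 1) ^ n * slice_coef f k (cis t *s z) - (cis (real k * t) - 1) ^ n * slice_coef f k z" for k
    by (simp add: slice_coef_smult[OF f] Complex.DeMoivre algebra_simps)
  moreover have "(rot_diff t ^^ Suc n) f z = (rot_diff t ^^ n) f (cis t *s z) - (rot_diff t ^^ n) f z"
    by (simp add: rot_diff_def cis_conv_exp)
  ultimately show ?case
    using sums_diff[OF Suc.IH[OF z'] Suc.IH[OF Suc.prems]] by simp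
qed

lemma cmod_cis_diff_1_le: "cmod (cis x - 1) \<le> \<bar>x\<bar>"
  using dist_exp_i_1[of x] abs_sin_x_le_abs_x[of "x / 2"] by (simp add: cis_conv_exp)

text \<open>
  In degree \<open>k\<close> the quotient is \<open>((e\<^sup>i\<^sup>k\<^sup>t - 1) / t)\<^sup>n\<close>, which tends to \<open>(i k)\<^sup>n\<close> and is at most \<open>k\<^sup>n\<close> in
  absolute value; the series with these majorants converges since \<open>R\<^sup>n f\<close> has an absolutely convergent
  expansion. So the limit may be taken termwise by Tannery's theorem.\<close>
lemma rot_diff_quotient_tendsto:
  fixes f :: "complex ^ 'N \<Rightarrow> complex" and t :: "nat \<Rightarrow> real"
  assumes f: "holo f" and z: "z \<in> ball 0 1" and t: "t \<longlonglongrightarrow> 0" and t0: "\<And>m. t m \<noteq> 0"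
  shows "(\<lambda>m. (rot_diff (t m) ^^ n) f z / of_real (t m) ^ n) \<longlonglongrightarrow> \<i> ^ n * (euler_op ^^ n) f z"
proof -
  define a where "a k m = ((cis (real k * t m) - 1) / of_real (t m)) ^ n * slice_coef f k z" for k m
  define b where "b k = (\<i> * of_nat k) ^ n * slice_coef f k z" for k
  have lim: "(\<lambda>m. a k m) \<longlonglongrightarrow> b k" for k
  proof -
    have "((\<lambda>s. exp (\<i> * of_nat k * s)) has_field_derivative (\<i> * of_nat k)) (at 0)"
      by (auto intro!: derivative_eq_intros)
    then have "(\<lambda>s. (exp (\<i> * of_nat k * s) - 1) / s) \<midarrow>0\<rightarrow> \<i> * of_nat k"
      by (simp add: DERIV_def)
    moreover have "filterlim (\<lambda>m. complex_of_real (t m)) (at 0) sequentially"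
      unfolding filterlim_at using tendsto_of_real[OF t] t0 by auto
    ultimately have "(\<lambda>m. (exp (\<i> * of_nat k * of_real (t m)) - 1) / of_real (t m)) \<longlonglongrightarrow> \<i> * of_nat k"
      by (rule filterlim_compose)
    then have "(\<lambda>m. (cis (real k * t m) - 1) / of_real (t m)) \<longlonglongrightarrow> \<i> * of_nat k"
      by (simp add: cis_conv_exp mult_ac)
    then show ?thesis unfolding a_def b_def by (intro tendsto_intros)
  qed
  have bound: "cmod (a k m) \<le> real k ^ n * cmod (slice_coef f k z)" for k m
  proof -
    have "cmod (cis (real k * t m) - 1) \<le> real k * \<bar>t m\<bar>"
      using cmod_cis_diff_1_le[of "real k * t m"] by (simp add: abs_mult)
    then have "cmod ((cis (real k * t m) - 1) / of_real (t m)) \<le> real k"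
      using t0[of m] by (simp add: norm_divide divide_simps)
    then show ?thesis
      unfolding a_def by (simp add: norm_mult norm_power mult_right_mono power_mono)
  qed
  have bound_ev: "eventually (\<lambda>(k, m). cmod (a k m) \<le> real k ^ n * cmod (slice_coef f k z)) (at_top \<times>\<^sub>F sequentially)"
    by (rule always_eventually) (auto intro: bound)
  have "summable (\<lambda>k. real k ^ n * cmod (slice_coef f k z))"
    using slice_coef_summable[OF holo_euler_op_funpow[OF f] z, of n]
    by (simp add: slice_coef_euler_op_funpow[OF f] norm_mult norm_power)
  from tannerys_theorem[OF lim bound_ev this]
  have "(\<lambda>m. suminf (\<lambda>k. a k m)) \<longlonglongrightarrow> suminf b" by simp
  moreover have "suminf (\<lambda>k. a k m) = (rot_diff (t m) ^^ n) f z / of_real (t m) ^ n" for m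
    using sums_divide[OF rot_diff_sums[OF f z, of "t m" n], of "of_real (t m) ^ n"]
    unfolding a_def by (simp add: sums_iff power_divide)
  moreover have "suminf b = \<i> ^ n * (euler_op ^^ n) f z"
    using sums_mult[OF slice_coef_sums[OF holo_euler_op_funpow[OF f] z], of "\<i> ^ n" n]
    unfolding b_def by (simp add: sums_iff slice_coef_euler_op_funpow[OF f] power_mult_distrib mult_ac)
  ultimately show ?thesis by simp
qed

section \<open>Isometry invariance of the surface measure\<close>

lemma lborel_distr_reflect: "distr lborel borel (\<lambda>y. x - y) = (lborel :: 'a::euclidean_space measure)"
  using lborel_affine[of "-1" x, symmetric] by (simp add: density_1)

text \<open>
  The classical proof that Haar measure is unique. The double integral of \<open>1\<^sub>A(x) 1\<^sub>B(x + y)\<close> against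
  \<open>\<mu>\<close> in \<open>x\<close> and Lebesgue measure in \<open>y\<close> is evaluated in both orders, translating the variable of
  the inner integral.\<close>
lemma translation_invariant_unique:
  fixes \<mu> :: "'a::euclidean_space measure"
  assumes sets: "sets \<mu> = sets borel" and sf: "sigma_finite_measure \<mu>"
    and inv: "\<And>c. distr \<mu> borel ((+) c) = \<mu>"
    and A: "A \<in> sets borel" and B: "B \<in> sets borel"
  shows "emeasure \<mu> A * emeasure lborel B = emeasure lborel A * emeasure \<mu> B"
proof -
  note [measurable_cong] = sets
  note [measurable] = A B
  interpret M: sigma_finite_measure \<mu> by (rule sf)
  interpret P: pair_sigma_finite \<mu> "lborel :: 'a measure" by unfold_locales
  have trans_l: "(\<integral>\<^sup>+y. h (c + y) \<partial>lborel) = (\<integral>\<^sup>+y. h y \<partial>lborel)"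
    if [measurable]: "h \<in> borel_measurable borel" for h :: "'a \<Rightarrow> ennreal" and c
    by (subst (2) lborel_distr_plus[of c, symmetric]) (simp add: nn_integral_distr)
  have trans_m: "(\<integral>\<^sup>+y. h (c + y) \<partial>\<mu>) = (\<integral>\<^sup>+y. h y \<partial>\<mu>)"
    if [measurable]: "h \<in> borel_measurable borel" for h :: "'a \<Rightarrow> ennreal" and c
    by (subst (2) inv[of c, symmetric]) (simp add: nn_integral_distr)
  have refl_l: "(\<integral>\<^sup>+y. h (x - y) \<partial>lborel) = (\<integral>\<^sup>+y. h y \<partial>lborel)"
    if [measurable]: "h \<in> borel_measurable borel" for h :: "'a \<Rightarrow> ennreal" and x
    by (subst (2) lborel_distr_reflect[of x, symmetric]) (simp add: nn_integral_distr)
  have "emeasure \<mu> A * emeasure lborel B = (\<integral>\<^sup>+x. indicator A x * (\<integral>\<^sup>+y. indicator B y \<partial>lborel) \<partial>\<mu>)"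
    using A B by (simp add: nn_integral_multc sets)
  also have "\<dots> = (\<integral>\<^sup>+x. indicator A x * (\<integral>\<^sup>+y. indicator B (x + y) \<partial>lborel) \<partial>\<mu>)"
    by (simp add: trans_l[of "indicator B"])
  also have "\<dots> = (\<integral>\<^sup>+x. (\<integral>\<^sup>+y. indicator A x * indicator B (x + y) \<partial>lborel) \<partial>\<mu>)"
    by (simp add: nn_integral_cmult)
  also have "\<dots> = (\<integral>\<^sup>+y. (\<integral>\<^sup>+x. indicator A x * indicator B (x + y) \<partial>\<mu>) \<partial>lborel)"
    by (rule P.Fubini'[symmetric]) measurable
  also have "\<dots> = (\<integral>\<^sup>+y. (\<integral>\<^sup>+x. indicator A (x - y) * indicator B x \<partial>\<mu>) \<partial>lborel)"
  proof (rule nn_integral_cong)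
    fix y :: 'a
    show "(\<integral>\<^sup>+x. indicator A x * indicator B (x + y) \<partial>\<mu>) = (\<integral>\<^sup>+x. indicator A (x - y) * indicator B x \<partial>\<mu>)"
      using trans_m[of "\<lambda>x. indicator A x * indicator B (x + y)" "- y"] by simp
  qed
  also have "\<dots> = (\<integral>\<^sup>+x. (\<integral>\<^sup>+y. indicator A (x - y) * indicator B x \<partial>lborel) \<partial>\<mu>)"
    by (rule P.Fubini') measurable
  also have "\<dots> = (\<integral>\<^sup>+x. emeasure lborel A * indicator B x \<partial>\<mu>)"
    using A by (simp add: nn_integral_multc refl_l[of "indicator A"])
  also have "\<dots> = emeasure lborel A * emeasure \<mu> B"
    using B by (simp add: nn_integral_cmult sets)
  finally show ?thesis .
qed

text \<open>
  The image of Lebesgue measure under a linear isometry is translation invariant and has the same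
  value on the unit ball, which fixes the constant of proportionality.\<close>
lemma lborel_distr_isometry:
  fixes T :: "'a::euclidean_space \<Rightarrow> 'a"
  assumes lin: "linear T" and iso: "\<And>x. norm (T x) = norm x"
  shows "distr lborel borel T = lborel"
proof (rule measure_eqI)
  have ot: "orthogonal_transformation T" using lin iso by (simp add: orthogonal_transformation)
  have [measurable]: "T \<in> borel_measurable borel"
    by (intro borel_measurable_continuous_onI linear_continuous_on) (simp add: lin linear_conv_bounded_linear[symmetric])
  let ?\<mu> = "distr lborel borel T"
  have vol: "emeasure ?\<mu> (ball 0 r) = emeasure lborel (ball 0 r :: 'a set)" for r
  proof -
    have "T -` ball 0 r = ball 0 r" by (auto simp: iso)
    then show ?thesis by (simp add: emeasure_distr)
  qed
  have sf: "sigma_finite_measure ?\<mu>"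
  proof (rule sigma_finite_measure.intro, intro exI conjI)
    show "countable (range (\<lambda>n. ball 0 (real n) :: 'a set))" by simp
    show "\<Union> (range (\<lambda>n. ball 0 (real n))) = space ?\<mu>"
      using reals_Archimedean2 by (auto simp: space_distr)
    show "\<forall>a\<in>range (\<lambda>n. ball 0 (real n)). emeasure ?\<mu> a \<noteq> \<infinity>"
      using emeasure_lborel_ball_finite[of "0::'a"] by (auto simp: vol less_top[symmetric])
  qed auto
  have inv: "distr ?\<mu> borel ((+) c) = ?\<mu>" for c
  proof -
    obtain d where d: "c = T d" using orthogonal_transformation_surj[OF ot] by (metis surjD)
    have "distr ?\<mu> borel ((+) c) = distr lborel borel ((+) c \<circ> T)" by (simp add: distr_distr)
    also have "(+) c \<circ> T = T \<circ> (+) d" by (auto simp: d linear_add[OF lin])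
    also have "distr lborel borel (T \<circ> (+) d) = distr (distr lborel borel ((+) d)) borel T"
      by (simp add: distr_distr)
    finally show ?thesis by (simp add: lborel_distr_plus)
  qed
  fix A :: "'a set" assume "A \<in> sets ?\<mu>"
  then have A: "A \<in> sets borel" by simp
  let ?b = "emeasure lborel (ball 0 1 :: 'a set)"
  have "emeasure ?\<mu> A * ?b = emeasure lborel A * ?b"
    using translation_invariant_unique[OF _ sf inv A, of "ball 0 1"] by (simp add: vol)
  moreover have "?b \<noteq> 0" "?b \<noteq> \<infinity>"
    using content_ball_pos[of 1 "0::'a"] emeasure_lborel_ball_finite[of "0::'a" 1]
    by (auto simp: measure_def)
  ultimately show "emeasure ?\<mu> A = emeasure lborel A"
    by (metis ennreal_mult_cancel_left infinity_ennreal_def mult.commute)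
qed simp

abbreviation sph :: "(complex ^ 'N) set" where "sph \<equiv> sphere 0 1"

lemma sets_sphere_measure: "sets (sphere_measure :: (complex ^ 'N) measure) = sets (restrict_space borel sph)"
  unfolding sphere_measure_def by (rule sets_restrict_space_cong) simp

lemma space_sphere_measure: "space (sphere_measure :: (complex ^ 'N) measure) = sph"
  unfolding sphere_measure_def by (simp add: space_restrict_space)

interpretation sphere_prob: prob_space "sphere_measure :: (complex ^ 'N) measure"
  by (rule prob_space_sphere_measure)

lemma emeasure_sph: "emeasure sphere_measure (sph :: (complex ^ 'N) set) = 1"
  using sphere_prob.emeasure_space_1[where ?'N = 'N] by (simp only: space_sphere_measure)

lemma emeasure_sphere_measure:
  fixes A :: "(complex ^ 'N) set"
  assumes A: "A \<in> sets borel" "A \<subseteq> sph"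
  shows "emeasure sphere_measure A =
    emeasure lborel (ball 0 1 \<inter> sgn -` A) / emeasure lborel (ball 0 1 :: (complex ^ 'N) set)"
proof -
  have [measurable]: "(sgn :: complex ^ 'N \<Rightarrow> _) \<in> borel_measurable borel" by simp
  have "sgn -` A \<in> sets (borel :: (complex ^ 'N) measure)"
    using measurable_sets[of sgn borel borel A] A by simp
  then show ?thesis
    using A by (simp add: sphere_measure_def emeasure_restrict_space emeasure_distr)
qed

lemma sgn_isometry:
  fixes T :: "'a::euclidean_space \<Rightarrow> 'a"
  assumes "linear T" "\<And>x. norm (T x) = norm x"
  shows "sgn (T x) = T (sgn x)"
  using assms by (simp add: sgn_div_norm linear_scale)

text \<open>
  The cone measure inherits the invariance from Lebesgue measure on the ball, because radial
  projection commutes with linear isometries.\<close>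
lemma sphere_measure_distr_isometry:
  fixes T :: "complex ^ 'N \<Rightarrow> complex ^ 'N"
  assumes lin: "linear T" and iso: "\<And>x. norm (T x) = norm x"
  shows "T \<in> measurable sphere_measure sphere_measure"
    and "distr sphere_measure sphere_measure T = sphere_measure"
proof -
  have contO: "continuous_on UNIV T"
    by (rule linear_continuous_on) (simp add: lin linear_conv_bounded_linear[symmetric])
  then have T[measurable]: "T \<in> borel_measurable borel" by (rule borel_measurable_continuous_onI)
  have "T \<in> measurable (restrict_space borel sph) (restrict_space borel sph)"
    by (rule measurable_restrict_space3) (auto simp: iso)
  then show m: "T \<in> measurable sphere_measure sphere_measure"
    by (simp add: measurable_cong_sets[OF sets_sphere_measure sets_sphere_measure])
  show "distr sphere_measure sphere_measure T = sphere_measure"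
  proof (rule measure_eqI)
    fix A assume "A \<in> sets (distr sphere_measure sphere_measure T)"
    then have A: "A \<in> sets borel" "A \<subseteq> sph"
      by (auto simp: sets_sphere_measure sets_restrict_space_iff)
    have OA: "T -` A \<in> sets borel" using measurable_sets[OF T A(1)] by simp
    have sub: "T -` A \<subseteq> sph" using A by (auto simp: iso)
    have C: "sgn -` A \<in> sets (borel :: (complex ^ 'N) measure)"
      using measurable_sets[of sgn borel borel A] A by simp
    have "emeasure (distr sphere_measure sphere_measure T) A = emeasure sphere_measure (T -` A)"
      using A sub by (simp add: emeasure_distr[OF m] sets_sphere_measure sets_restrict_space_iff
          space_sphere_measure Int_absorb2)
    also have "\<dots> = emeasure lborel (ball 0 1 \<inter> sgn -` (T -` A)) / emeasure lborel (ball 0 1 :: (complex ^ 'N) set)"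
      by (rule emeasure_sphere_measure[OF OA sub])
    also have "ball 0 1 \<inter> sgn -` (T -` A) = T -` (ball 0 1 \<inter> sgn -` A)"
      by (auto simp: iso sgn_isometry[OF lin iso])
    also have "emeasure lborel (T -` (ball 0 1 \<inter> sgn -` A)) = emeasure (distr lborel borel T) (ball 0 1 \<inter> sgn -` A)"
      using C by (subst emeasure_distr) auto
    also have "\<dots> = emeasure lborel (ball 0 1 \<inter> sgn -` A)"
      by (simp add: lborel_distr_isometry[OF lin iso])
    also have "\<dots> / emeasure lborel (ball 0 1 :: (complex ^ 'N) set) = emeasure sphere_measure A"
      by (rule emeasure_sphere_measure[OF A, symmetric])
    finally show "emeasure (distr sphere_measure sphere_measure T) A = emeasure sphere_measure A" .
  qed simp
qed

text \<open>
  This turns an essential supremum of a continuous function over the sphere into a supremum.\<close>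
lemma sphere_measure_open_pos:
  fixes U :: "(complex ^ 'N) set"
  assumes U: "open U" "U \<inter> sph \<noteq> {}"
  shows "emeasure sphere_measure (U \<inter> sph) > 0"
proof -
  obtain x where x: "x \<in> U" "norm x = 1" using U by auto
  let ?V = "ball 0 1 \<inter> sgn -` (U \<inter> sph)"
  have eq: "?V = (ball 0 1 - {0}) \<inter> sgn -` U"
    by (auto simp: norm_sgn sgn_zero split: if_splits)
  have "continuous_on (ball 0 1 - {0} :: (complex ^ 'N) set) sgn"
    by (intro continuous_intros) auto
  then have "open ?V" unfolding eq
    using U by (intro continuous_open_preimage) (auto intro: open_delete)
  moreover have "(1/2) *\<^sub>R x \<in> ?V" using x by (auto simp: eq sgn_div_norm)
  ultimately obtain e where e: "e > 0" "ball ((1/2) *\<^sub>R x) e \<subseteq> ?V"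
    by (meson open_contains_ball)
  have "0 < emeasure lborel (ball ((1/2) *\<^sub>R x) e)"
    using content_ball_pos[OF e(1), of "(1/2) *\<^sub>R x"] by (simp add: measure_def enn2real_positive_iff)
  also have "\<dots> \<le> emeasure lborel ?V"
    using e \<open>open ?V\<close> by (intro emeasure_mono) auto
  finally have "0 < emeasure lborel ?V" .
  moreover have "emeasure lborel (ball 0 1 :: (complex ^ 'N) set) \<noteq> \<infinity>"
    using emeasure_lborel_ball_finite[of "0::complex ^ 'N" 1] by auto
  ultimately have "emeasure lborel ?V / emeasure lborel (ball 0 1 :: (complex ^ 'N) set) > 0"
    by (simp add: ennreal_zero_less_divide less_top[symmetric])
  then show ?thesis using U by (subst emeasure_sphere_measure) auto
qed

lemma borel_measurable_sphere_measure:
  fixes h :: "complex ^ 'N \<Rightarrow> 'b::topological_space"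
  assumes "continuous_on sph h" shows "h \<in> borel_measurable sphere_measure"
  using borel_measurable_continuous_on_restrict[OF assms]
  by (simp add: measurable_cong_sets[OF sets_sphere_measure refl])

lemma compact_sph: "compact (sph :: (complex ^ 'N) set)" by simp

lemma integrable_sphere_measure:
  fixes h :: "complex ^ 'N \<Rightarrow> real"
  assumes h: "continuous_on sph h" shows "integrable sphere_measure h"
proof -
  have "bounded (h ` sph)" by (intro compact_imp_bounded compact_continuous_image h compact_sph)
  then obtain B where B: "\<And>x. x \<in> sph \<Longrightarrow> norm (h x) \<le> B" unfolding bounded_iff by blast
  show ?thesis
    by (rule sphere_prob.integrable_const_bound[of _ B])
       (use B borel_measurable_sphere_measure[OF h] in \<open>auto simp: space_sphere_measure intro!: AE_I2\<close>)
qed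

section \<open>Jensen's inequality for averages over an interval\<close>

text \<open>
  Convexity on the open half-line, together with the boundary point \<open>x = 0\<close>.\<close>
lemma powr_above_tangent:
  fixes x A q :: real
  assumes "q \<ge> 1" "A > 0" "x \<ge> 0"
  shows "A powr q + q * A powr (q - 1) * (x - A) \<le> x powr q"
proof (cases "x = 0")
  case True
  have "A powr q = A powr (q - 1) * A" using assms by (simp add: powr_mult_base mult.commute)
  then have "A powr q + q * A powr (q - 1) * (0 - A) = (1 - q) * A powr q" by (simp add: algebra_simps)
  also have "\<dots> \<le> 0" using assms by (simp add: mult_nonpos_nonneg)
  finally show ?thesis using True by simp
next
  case False
  have "((\<lambda>x. x powr q) has_real_derivative q * A powr (q - 1)) (at A within {0<..})"
    by (rule has_field_derivative_at_within[OF has_real_derivative_powr[OF assms(2)]])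
  from convex_on_imp_above_tangent[OF powr_convex[OF assms(1)] _ _ _ this, of x]
  show ?thesis using assms False by (simp add: interior_open)
qed

text \<open>
  Integrate the tangent inequality at the average of \<open>h\<close>: the linear term integrates to zero.\<close>
lemma jensen_interval:
  fixes h :: "real \<Rightarrow> real"
  assumes q: "q \<ge> 1" and ab: "a < b" and h: "continuous_on {a..b} h" "\<And>t. t \<in> {a..b} \<Longrightarrow> h t \<ge> 0"
  shows "(integral {a..b} h / (b - a)) powr q \<le> integral {a..b} (\<lambda>t. h t powr q) / (b - a)"
proof -
  define A where "A = integral {a..b} h / (b - a)"
  have c: "continuous_on {a..b} (\<lambda>t. h t powr q)"
    using q h by (intro continuous_on_powr' continuous_intros) auto
  have A0: "A \<ge> 0" unfolding A_def using ab h by (intro divide_nonneg_pos integral_nonneg integrable_continuous_interval) auto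
  show ?thesis
  proof (cases "A = 0")
    case True
    then show ?thesis using ab c by (auto simp: A_def[symmetric] intro!: divide_nonneg_pos integral_nonneg integrable_continuous_interval)
  next
    case False
    have i: "h integrable_on {a..b}" using h by (intro integrable_continuous_interval)
    have hA: "integral {a..b} (\<lambda>t. h t - A) = integral {a..b} h - (b - a) * A"
      using ab i by (subst integral_diff) auto
    have "integral {a..b} (\<lambda>t. A powr q + q * A powr (q - 1) * (h t - A)) \<le> integral {a..b} (\<lambda>t. h t powr q)"
      using A0 False h by (intro integral_le integrable_continuous_interval c continuous_intros powr_above_tangent q) auto
    also have "integral {a..b} (\<lambda>t. A powr q + q * A powr (q - 1) * (h t - A)) =
        (b - a) * A powr q + q * A powr (q - 1) * (integral {a..b} h - (b - a) * A)"
      using ab i by (subst integral_add) (auto intro!: integrable_continuous_interval continuous_intros h simp: hA)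
    also have "integral {a..b} h - (b - a) * A = 0" using ab by (simp add: A_def)
    finally show ?thesis using ab by (simp add: A_def[symmetric] field_simps)
  qed
qed

text \<open>
  Jensen's inequality at each point of the sphere, followed by Fubini's theorem. The right-hand side
  is kept as an integral over the parameter, which the maximum principle for contractions needs; a
  supremum over the parameter would lose too much there.\<close>
lemma powr_integral_average:
  fixes g :: "real \<Rightarrow> complex ^ 'N \<Rightarrow> real" and f :: "complex ^ 'N \<Rightarrow> real"
  assumes q: "q \<ge> 1" and ab: "a < b"
    and g: "continuous_on ({a..b} \<times> sph) (\<lambda>(t, x). g t x)" "\<And>t x. t \<in> {a..b} \<Longrightarrow> x \<in> sph \<Longrightarrow> g t x \<ge> 0"
    and f: "continuous_on sph f" "\<And>x. x \<in> sph \<Longrightarrow> f x \<ge> 0"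
    and le: "\<And>x. x \<in> sph \<Longrightarrow> f x \<le> integral {a..b} (\<lambda>t. g t x) / (b - a)"
  shows "(\<integral>x. f x powr q \<partial>sphere_measure) \<le> integral {a..b} (\<lambda>t. \<integral>x. g t x powr q \<partial>sphere_measure) / (b - a)"
    and "(\<lambda>t. \<integral>x. g t x powr q \<partial>sphere_measure) integrable_on {a..b}"
proof -
  let ?\<sigma> = "sphere_measure :: (complex ^ 'N) measure"
  \<comment> \<open>Extended by zero off the compact set, so that it is Borel on the whole product.\<close>
  define k where "k = (\<lambda>y. indicator ({a..b} \<times> sph) y *\<^sub>R (case y of (t, x) \<Rightarrow> g t x powr q))"
  have cq: "continuous_on ({a..b} \<times> sph) (\<lambda>(t, x). g t x powr q)"
    using g q unfolding split_beta by (intro continuous_on_powr' continuous_intros) auto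
  have cqx: "continuous_on {a..b} (\<lambda>t. g t x powr q)" if "x \<in> sph" for x
    using continuous_on_compose2[OF cq, of "{a..b}" "\<lambda>t. (t, x)"] that
    by (simp add: image_subset_iff continuous_on_Pair)
  have cx: "continuous_on {a..b} (\<lambda>t. g t x)" if "x \<in> sph" for x
    using continuous_on_compose2[OF g(1), of "{a..b}" "\<lambda>t. (t, x)"] that
    by (simp add: image_subset_iff continuous_on_Pair)
  have cl: "closed ({a..b} \<times> (sph :: (complex ^ 'N) set))" by (intro closed_Times) auto
  have km: "k \<in> borel_measurable borel" unfolding k_def
    using cl by (intro borel_measurable_continuous_on_indicator cq) auto
  have id: "(\<lambda>y. y) \<in> measurable (lborel \<Otimes>\<^sub>M ?\<sigma>) (borel :: (real \<times> (complex ^ 'N)) measure)"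
  proof -
    have "(\<lambda>x. x) \<in> measurable (restrict_space borel sph) (borel :: (complex ^ 'N) measure)"
      by (rule measurable_restrict_space1) simp
    then have "(\<lambda>x. x) \<in> measurable ?\<sigma> (borel :: (complex ^ 'N) measure)"
      by (simp add: measurable_cong_sets[OF sets_sphere_measure refl])
    then have "(\<lambda>y. (fst y, snd y)) \<in> measurable (lborel \<Otimes>\<^sub>M ?\<sigma>) (borel \<Otimes>\<^sub>M (borel :: (complex ^ 'N) measure))"
      by (intro measurable_Pair) (auto intro: measurable_compose[OF measurable_snd])
    then show ?thesis by (simp add: borel_prod)
  qed
  have kM: "k \<in> borel_measurable (lborel \<Otimes>\<^sub>M ?\<sigma>)"
    using measurable_compose[OF id km] by simp
  have "bounded ((\<lambda>(t, x). g t x powr q) ` ({a..b} \<times> sph))"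
    by (intro compact_imp_bounded compact_continuous_image cq compact_Times compact_sph compact_Icc)
  then obtain B where B: "\<And>t x. t \<in> {a..b} \<Longrightarrow> x \<in> sph \<Longrightarrow> norm (g t x powr q) \<le> B"
    unfolding bounded_iff by (metis (no_types, lifting) SigmaI case_prod_conv imageI)
  interpret P: pair_sigma_finite "lborel :: real measure" ?\<sigma> by unfold_locales
  have kint: "integrable (lborel \<Otimes>\<^sub>M ?\<sigma>) k"
  proof (rule integrableI_bounded_set[of "{a..b} \<times> sph" _ _ B])
    have S: "sph \<in> sets ?\<sigma>" using sets.top[of ?\<sigma>] by (simp add: space_sphere_measure)
    then show "{a..b} \<times> sph \<in> sets (lborel \<Otimes>\<^sub>M ?\<sigma>)" by (intro pair_measureI) auto
    have "emeasure (lborel \<Otimes>\<^sub>M ?\<sigma>) ({a..b} \<times> sph) = emeasure lborel {a..b} * emeasure ?\<sigma> sph"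
      by (rule sphere_prob.emeasure_pair_measure_Times) (use S in auto)
    also have "\<dots> < \<infinity>" using ab by (simp add: emeasure_sph ennreal_mult_less_top)
    finally show "emeasure (lborel \<Otimes>\<^sub>M ?\<sigma>) ({a..b} \<times> sph) < \<infinity>" .
    show "AE y in lborel \<Otimes>\<^sub>M ?\<sigma>. y \<in> {a..b} \<times> sph \<longrightarrow> norm (k y) \<le> B"
      using B by (intro AE_I2) (auto simp: k_def)
    show "AE y in lborel \<Otimes>\<^sub>M ?\<sigma>. y \<notin> {a..b} \<times> sph \<longrightarrow> k y = 0"
      by (intro AE_I2) (auto simp: k_def)
  qed (rule kM)
  then have kint': "integrable (lborel \<Otimes>\<^sub>M ?\<sigma>) (case_prod (\<lambda>t x. k (t, x)))" by simp
  have inner: "(\<integral>x. k (t, x) \<partial>?\<sigma>) = indicator {a..b} t *\<^sub>R (\<integral>x. g t x powr q \<partial>?\<sigma>)" for t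
    by (cases "t \<in> {a..b}") (auto simp: k_def space_sphere_measure intro!: Bochner_Integration.integral_cong)
  have seti: "set_integrable lborel {a..b} (\<lambda>t. \<integral>x. g t x powr q \<partial>?\<sigma>)"
    unfolding set_integrable_def using P.integrable_fst[OF kint'] by (simp add: inner)
  show "(\<lambda>t. \<integral>x. g t x powr q \<partial>?\<sigma>) integrable_on {a..b}"
    by (rule set_borel_integral_eq_integral(1)[OF seti])
  have outer: "(\<integral>t. k (t, x) \<partial>lborel) = integral {a..b} (\<lambda>t. g t x powr q)" if "x \<in> sph" for x
  proof -
    have "set_integrable lborel {a..b} (\<lambda>t. g t x powr q)"
      by (rule borel_integrable_atLeastAtMost') (rule cqx[OF that])
    from set_borel_integral_eq_integral(2)[OF this] that show ?thesis
      by (simp add: set_lebesgue_integral_def k_def indicator_def of_bool_def cong: if_cong)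
  qed
  have "integrable ?\<sigma> (\<lambda>x. \<integral>t. k (t, x) \<partial>lborel)" using P.integrable_snd[OF kint'] .
  moreover have "integrable ?\<sigma> (\<lambda>x. \<integral>t. k (t, x) \<partial>lborel) \<longleftrightarrow>
      integrable ?\<sigma> (\<lambda>x. integral {a..b} (\<lambda>t. g t x powr q))"
    by (rule Bochner_Integration.integrable_cong[OF refl]) (simp add: outer space_sphere_measure)
  ultimately have oint: "integrable ?\<sigma> (\<lambda>x. integral {a..b} (\<lambda>t. g t x powr q))" by blast
  have "(\<integral>x. f x powr q \<partial>?\<sigma>) \<le> (\<integral>x. integral {a..b} (\<lambda>t. g t x powr q) / (b - a) \<partial>?\<sigma>)"
  proof (rule integral_mono)
    show "integrable ?\<sigma> (\<lambda>x. f x powr q)"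
      using f q by (intro integrable_sphere_measure continuous_on_powr' continuous_intros) auto
    show "integrable ?\<sigma> (\<lambda>x. integral {a..b} (\<lambda>t. g t x powr q) / (b - a))"
      using oint by simp
    fix x assume "x \<in> space ?\<sigma>"
    then have x: "x \<in> sph" by (simp add: space_sphere_measure)
    have "f x powr q \<le> (integral {a..b} (\<lambda>t. g t x) / (b - a)) powr q"
      using f(2)[OF x] le[OF x] q by (intro powr_mono2) auto
    also have "\<dots> \<le> integral {a..b} (\<lambda>t. g t x powr q) / (b - a)"
      by (rule jensen_interval[OF q ab cx[OF x]]) (use g x in auto)
    finally show "f x powr q \<le> integral {a..b} (\<lambda>t. g t x powr q) / (b - a)" .
  qed
  also have "\<dots> = (\<integral>x. integral {a..b} (\<lambda>t. g t x powr q) \<partial>?\<sigma>) / (b - a)"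
    by simp
  also have "(\<integral>x. integral {a..b} (\<lambda>t. g t x powr q) \<partial>?\<sigma>) = (\<integral>x. (\<integral>t. k (t, x) \<partial>lborel) \<partial>?\<sigma>)"
    by (rule Bochner_Integration.integral_cong[OF refl]) (simp add: outer space_sphere_measure)
  also have "(\<integral>x. (\<integral>t. k (t, x) \<partial>lborel) \<partial>?\<sigma>) = (\<integral>t. (\<integral>x. k (t, x) \<partial>?\<sigma>) \<partial>lborel)"
    by (rule P.Fubini_integral[OF kint'])
  also have "\<dots> = integral {a..b} (\<lambda>t. \<integral>x. g t x powr q \<partial>?\<sigma>)"
    using set_borel_integral_eq_integral(2)[OF seti] by (simp add: inner set_lebesgue_integral_def)
  finally show "(\<integral>x. f x powr q \<partial>?\<sigma>) \<le> integral {a..b} (\<lambda>t. \<integral>x. g t x powr q \<partial>?\<sigma>) / (b - a)" .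
qed

section \<open>Integral means over spheres\<close>

abbreviation cont_sphere :: "real \<Rightarrow> (complex ^ 'N \<Rightarrow> complex) \<Rightarrow> bool" where
  "cont_sphere r g \<equiv> continuous_on sph (\<lambda>\<zeta>. g (r *\<^sub>R \<zeta>))"

lemma cont_sphere_holo: "holo f \<Longrightarrow> 0 < r \<Longrightarrow> r < 1 \<Longrightarrow> cont_sphere r f"
  by (rule continuous_on_holo_compose) (auto intro!: continuous_intros)

lemma exponent_ge_1:
  assumes "1 \<le> p" "p \<noteq> \<infinity>" shows "enn2real p \<ge> 1"
  using assms by (cases p) (auto simp: top_ennreal.rep_eq ennreal_1[symmetric] simp del: ennreal_1)

lemma continuous_on_cmod_powr:
  "q \<ge> 1 \<Longrightarrow> continuous_on S h \<Longrightarrow> continuous_on S (\<lambda>x. cmod (h x) powr q)"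
  by (intro continuous_on_powr' continuous_intros) auto

lemma int_mean_le_iff_finite:
  assumes p: "1 \<le> p" "p \<noteq> \<infinity>" and B: "B \<ge> 0"
  shows "int_mean p r g \<le> ennreal B \<longleftrightarrow>
    (\<integral>\<zeta>. cmod (g (r *\<^sub>R \<zeta>)) powr enn2real p \<partial>sphere_measure) \<le> B powr enn2real p" (is "_ \<longleftrightarrow> ?I \<le> _")
proof -
  let ?q = "enn2real p"
  have q: "?q \<ge> 1" by (rule exponent_ge_1[OF p])
  have I0: "?I \<ge> 0" by (rule integral_nonneg_AE) auto
  have "?I powr (1 / ?q) \<le> B \<longleftrightarrow> ?I \<le> B powr ?q"
  proof
    assume "?I powr (1 / ?q) \<le> B"
    then have "(?I powr (1 / ?q)) powr ?q \<le> B powr ?q" using q by (intro powr_mono2) auto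
    then show "?I \<le> B powr ?q" using q I0 by (simp add: powr_powr)
  next
    assume "?I \<le> B powr ?q"
    then have "?I powr (1 / ?q) \<le> (B powr ?q) powr (1 / ?q)" using q I0 by (intro powr_mono2) auto
    then show "?I powr (1 / ?q) \<le> B" using q B by (simp add: powr_powr)
  qed
  then show ?thesis using p B by (simp add: int_mean_def)
qed

lemma int_mean_le_iff_infinite:
  fixes g :: "complex ^ 'N \<Rightarrow> complex"
  assumes g: "cont_sphere r g" and B: "B \<ge> 0"
  shows "int_mean \<infinity> r g \<le> ennreal B \<longleftrightarrow> (\<forall>\<zeta>\<in>sph. cmod (g (r *\<^sub>R \<zeta>)) \<le> B)"
proof
  assume le: "int_mean \<infinity> r g \<le> ennreal B"
  show "\<forall>\<zeta>\<in>sph. cmod (g (r *\<^sub>R \<zeta>)) \<le> B"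
  proof (rule ccontr)
    let ?h = "\<lambda>\<zeta>. cmod (g (r *\<^sub>R \<zeta>))"
    assume "\<not> (\<forall>\<zeta>\<in>sph. cmod (g (r *\<^sub>R \<zeta>)) \<le> B)"
    then obtain z where z: "z \<in> sph" "?h z > B" by force
    have "continuous_on sph ?h" using g by (intro continuous_intros)
    then obtain V where V: "open V" "V \<inter> sph = ?h -` {B<..} \<inter> sph"
      unfolding continuous_on_open_invariant by (metis open_greaterThan)
    have "V \<inter> sph \<noteq> {}" using z unfolding V(2) by auto
    then have pos: "emeasure sphere_measure (V \<inter> sph) > 0" by (rule sphere_measure_open_pos[OF V(1)])
    have "AE \<zeta> in sphere_measure. ennreal (?h \<zeta>) \<le> int_mean \<infinity> r g"
      unfolding int_mean_def by (simp add: esssup_AE)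
    then have "AE \<zeta> in sphere_measure. \<not> (\<zeta> \<in> V \<inter> sph)"
      unfolding V(2)
    proof eventually_elim
      case (elim x)
      then have "ennreal (?h x) \<le> ennreal B" using le by (rule order_trans)
      then show ?case using B by auto
    qed
    then have "emeasure sphere_measure (V \<inter> sph) = 0"
      by (subst AE_iff_measurable[symmetric, where P = "\<lambda>x. \<not> (x \<in> V \<inter> sph)"])
         (use V(1) in \<open>auto simp: space_sphere_measure sets_sphere_measure sets_restrict_space_iff\<close>)
    with pos show False by simp
  qed
next
  assume le: "\<forall>\<zeta>\<in>sph. cmod (g (r *\<^sub>R \<zeta>)) \<le> B"
  have "(\<lambda>\<zeta>. ennreal (cmod (g (r *\<^sub>R \<zeta>)))) \<in> borel_measurable sphere_measure"
    by (intro measurable_compose[OF _ measurable_ennreal] borel_measurable_sphere_measure continuous_intros g)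
  then show "int_mean \<infinity> r g \<le> ennreal B"
    unfolding int_mean_def using le
    by (auto simp: space_sphere_measure ennreal_leI intro!: esssup_I AE_I2)
qed

text \<open>
  A substitute for Minkowski's integral inequality, for all exponents at once. Only absolute values
  are compared, so the coefficients in an integral representation of \<open>F\<close> may depend on the point.\<close>
lemma int_mean_average:
  fixes F :: "complex ^ 'N \<Rightarrow> complex" and G :: "real \<Rightarrow> complex ^ 'N \<Rightarrow> complex"
  assumes p: "1 \<le> p" and ab: "a < b" and B: "B \<ge> 0"
    and G: "continuous_on ({a..b} \<times> sph) (\<lambda>(t, \<zeta>). G t (r *\<^sub>R \<zeta>))" and F: "cont_sphere r F"
    and le: "\<And>\<zeta>. \<zeta> \<in> sph \<Longrightarrow> cmod (F (r *\<^sub>R \<zeta>)) \<le> integral {a..b} (\<lambda>t. cmod (G t (r *\<^sub>R \<zeta>))) / (b - a)"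
    and GB: "\<And>t. t \<in> {a..b} \<Longrightarrow> int_mean p r (G t) \<le> ennreal B"
  shows "int_mean p r F \<le> ennreal B"
proof (cases "p = \<infinity>")
  case True
  have Gt: "cont_sphere r (G t)" if "t \<in> {a..b}" for t
    using continuous_on_compose2[OF G, of sph "\<lambda>\<zeta>. (t, \<zeta>)"] that
    by (simp add: image_subset_iff continuous_on_Pair)
  have Gx: "continuous_on {a..b} (\<lambda>t. G t (r *\<^sub>R \<zeta>))" if "\<zeta> \<in> sph" for \<zeta>
    using continuous_on_compose2[OF G, of "{a..b}" "\<lambda>t. (t, \<zeta>)"] that
    by (simp add: image_subset_iff continuous_on_Pair)
  have "cmod (F (r *\<^sub>R \<zeta>)) \<le> B" if z: "\<zeta> \<in> sph" for \<zeta>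
  proof -
    have "integral {a..b} (\<lambda>t. cmod (G t (r *\<^sub>R \<zeta>))) \<le> integral {a..b} (\<lambda>t. B)"
      using GB z True int_mean_le_iff_infinite[OF Gt B]
      by (intro integral_le integrable_continuous_interval continuous_intros Gx) auto
    also have "\<dots> = (b - a) * B" using ab by simp
    finally have "integral {a..b} (\<lambda>t. cmod (G t (r *\<^sub>R \<zeta>))) / (b - a) \<le> B"
      using ab by (simp add: divide_le_eq mult.commute)
    with le[OF z] show ?thesis by simp
  qed
  then show ?thesis using True int_mean_le_iff_infinite[OF F B] by blast
next
  case False
  let ?q = "enn2real p"
  have q: "?q \<ge> 1" by (rule exponent_ge_1[OF p False])
  have 1: "continuous_on ({a..b} \<times> sph) (\<lambda>(t, \<zeta>). cmod (G t (r *\<^sub>R \<zeta>)))"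
    using continuous_on_norm[OF G] by (simp add: split_beta)
  have 2: "continuous_on sph (\<lambda>\<zeta>. cmod (F (r *\<^sub>R \<zeta>)))" using F by (intro continuous_intros)
  note avg = powr_integral_average[OF q ab 1 _ 2 _ le]
  have "(\<integral>x. cmod (F (r *\<^sub>R x)) powr ?q \<partial>sphere_measure) \<le>
      integral {a..b} (\<lambda>t. \<integral>x. cmod (G t (r *\<^sub>R x)) powr ?q \<partial>sphere_measure) / (b - a)"
    by (rule avg(1)) auto
  also have "\<dots> \<le> integral {a..b} (\<lambda>t. B powr ?q) / (b - a)"
    using ab GB int_mean_le_iff_finite[OF p False B]
    by (intro divide_right_mono integral_le avg(2)) auto
  also have "\<dots> = B powr ?q" using ab by simp
  finally show ?thesis using int_mean_le_iff_finite[OF p False B] by blast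
qed

text \<open>
  Real linear isometries are admitted because the quaternionic rotations used for tangential
  derivatives are not complex linear.\<close>
lemma int_mean_isometry:
  fixes T :: "complex ^ 'N \<Rightarrow> complex ^ 'N"
  assumes p: "1 \<le> p" and lin: "linear T" and iso: "\<And>x. norm (T x) = norm x"
    and g: "cont_sphere r g" and B: "B \<ge> 0" and le: "int_mean p r g \<le> ennreal B"
  shows "int_mean p r (\<lambda>z. g (T z)) \<le> ennreal B"
proof -
  have T: "T (r *\<^sub>R z) = r *\<^sub>R T z" for z using lin by (rule linear_scale)
  have bl: "bounded_linear T" using lin by (simp add: linear_conv_bounded_linear)
  have gT: "cont_sphere r (\<lambda>z. g (T z))" unfolding T
    by (rule continuous_on_compose2[OF g]) (use bl iso in \<open>auto intro: linear_continuous_on\<close>)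
  show ?thesis
  proof (cases "p = \<infinity>")
    case True
    with le have "\<forall>\<zeta>\<in>sph. cmod (g (r *\<^sub>R \<zeta>)) \<le> B" using int_mean_le_iff_infinite[OF g B] by blast
    then have "\<forall>\<zeta>\<in>sph. cmod (g (T (r *\<^sub>R \<zeta>))) \<le> B" by (simp add: T iso)
    with True show ?thesis using int_mean_le_iff_infinite[OF gT B] by blast
  next
    case False
    let ?h = "\<lambda>\<zeta>. cmod (g (r *\<^sub>R \<zeta>)) powr enn2real p"
    have "?h \<in> borel_measurable sphere_measure"
      by (intro borel_measurable_sphere_measure continuous_on_cmod_powr exponent_ge_1 p False g)
    from integral_distr[OF sphere_measure_distr_isometry(1)[OF lin iso] this]
    have "(\<integral>\<zeta>. ?h (T \<zeta>) \<partial>sphere_measure) = (\<integral>\<zeta>. ?h \<zeta> \<partial>sphere_measure)"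
      by (simp add: sphere_measure_distr_isometry(2)[OF lin iso])
    with le show ?thesis by (simp add: int_mean_le_iff_finite[OF p False B] T)
  qed
qed

text \<open>
  The sum is at most the number of terms times the largest one. The loss of a constant
  that depends only on the number of terms is harmless for bounds up to constants.\<close>
lemma sum_powr_le:
  fixes x :: "'k \<Rightarrow> real"
  assumes K: "finite K" and x: "\<And>k. k \<in> K \<Longrightarrow> x k \<ge> 0" and q: "q \<ge> 1"
  shows "(\<Sum>k\<in>K. x k) powr q \<le> real (card K) powr q * (\<Sum>k\<in>K. x k powr q)"
proof (cases "K = {}")
  case False
  define m where "m = Max (x ` K)"
  have m: "m \<in> x ` K" unfolding m_def using K False by (intro Max_in) auto
  then obtain k0 where k0: "k0 \<in> K" "m = x k0" by blast
  have "(\<Sum>k\<in>K. x k) \<le> real (card K) * m"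
    unfolding m_def by (rule sum_bounded_above) (use K in auto)
  then have "(\<Sum>k\<in>K. x k) powr q \<le> (real (card K) * m) powr q"
    using q x by (intro powr_mono2 sum_nonneg) auto
  also have "\<dots> = real (card K) powr q * x k0 powr q" using k0 x by (simp add: powr_mult)
  also have "\<dots> \<le> real (card K) powr q * (\<Sum>k\<in>K. x k powr q)"
    using k0 K by (intro mult_left_mono member_le_sum) auto
  finally show ?thesis .
qed simp

lemma int_mean_sum:
  fixes F :: "complex ^ 'N \<Rightarrow> complex" and G :: "'k \<Rightarrow> complex ^ 'N \<Rightarrow> complex"
  assumes p: "1 \<le> p" and B: "B \<ge> 0" and c: "c \<ge> 0" and K: "finite K"
    and G: "\<And>k. k \<in> K \<Longrightarrow> cont_sphere r (G k)" and F: "cont_sphere r F"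
    and le: "\<And>\<zeta>. \<zeta> \<in> sph \<Longrightarrow> cmod (F (r *\<^sub>R \<zeta>)) \<le> c * (\<Sum>k\<in>K. cmod (G k (r *\<^sub>R \<zeta>)))"
    and GB: "\<And>k. k \<in> K \<Longrightarrow> int_mean p r (G k) \<le> ennreal B"
  shows "int_mean p r F \<le> ennreal (c * real (card K) ^ 2 * B)"
proof -
  let ?n = "real (card K)"
  have nn: "?n \<le> ?n ^ 2" by (cases "card K") (auto simp: power2_eq_square)
  have B': "c * ?n ^ 2 * B \<ge> 0" using B c by simp
  show ?thesis
  proof (cases "p = \<infinity>")
    case True
    have "cmod (F (r *\<^sub>R \<zeta>)) \<le> c * ?n ^ 2 * B" if z: "\<zeta> \<in> sph" for \<zeta>
    proof -
      have "(\<Sum>k\<in>K. cmod (G k (r *\<^sub>R \<zeta>))) \<le> ?n * B"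
        by (rule sum_bounded_above) (use GB G True int_mean_le_iff_infinite[OF G B] z in auto)
      also have "\<dots> \<le> ?n ^ 2 * B" using nn B by (rule mult_right_mono)
      finally have "c * (\<Sum>k\<in>K. cmod (G k (r *\<^sub>R \<zeta>))) \<le> c * (?n ^ 2 * B)" using c by (rule mult_left_mono)
      with le[OF z] show ?thesis by (simp add: mult.assoc)
    qed
    then show ?thesis using True int_mean_le_iff_infinite[OF F B'] by blast
  next
    case False
    let ?q = "enn2real p"
    have q: "?q \<ge> 1" by (rule exponent_ge_1[OF p False])
    have Gi: "integrable sphere_measure (\<lambda>x. cmod (G k (r *\<^sub>R x)) powr ?q)" if "k \<in> K" for k
      by (intro integrable_sphere_measure continuous_on_cmod_powr q G that)
    have "(\<integral>x. cmod (F (r *\<^sub>R x)) powr ?q \<partial>sphere_measure) \<le>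
        (\<integral>x. c powr ?q * (?n powr ?q * (\<Sum>k\<in>K. cmod (G k (r *\<^sub>R x)) powr ?q)) \<partial>sphere_measure)"
    proof (rule integral_mono)
      show "integrable sphere_measure (\<lambda>x. cmod (F (r *\<^sub>R x)) powr ?q)"
        by (intro integrable_sphere_measure continuous_on_cmod_powr q F)
      show "integrable sphere_measure (\<lambda>x. c powr ?q * (?n powr ?q * (\<Sum>k\<in>K. cmod (G k (r *\<^sub>R x)) powr ?q)))"
        using Gi by (intro integrable_mult_right Bochner_Integration.integrable_sum)
      fix x :: "complex ^ 'N" assume "x \<in> space sphere_measure"
      then have x: "x \<in> sph" by (simp add: space_sphere_measure)
      have "cmod (F (r *\<^sub>R x)) powr ?q \<le> (c * (\<Sum>k\<in>K. cmod (G k (r *\<^sub>R x)))) powr ?q"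
        using le[OF x] q by (intro powr_mono2) auto
      also have "\<dots> = c powr ?q * (\<Sum>k\<in>K. cmod (G k (r *\<^sub>R x))) powr ?q"
        using c by (simp add: powr_mult sum_nonneg)
      also have "\<dots> \<le> c powr ?q * (?n powr ?q * (\<Sum>k\<in>K. cmod (G k (r *\<^sub>R x)) powr ?q))"
        by (intro mult_left_mono sum_powr_le K q) auto
      finally show "cmod (F (r *\<^sub>R x)) powr ?q \<le> c powr ?q * (?n powr ?q * (\<Sum>k\<in>K. cmod (G k (r *\<^sub>R x)) powr ?q))" .
    qed
    also have "\<dots> = c powr ?q * (?n powr ?q * (\<Sum>k\<in>K. \<integral>x. cmod (G k (r *\<^sub>R x)) powr ?q \<partial>sphere_measure))"
      using Gi by (simp add: Bochner_Integration.integral_sum)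
    also have "\<dots> \<le> c powr ?q * (?n powr ?q * (?n * B powr ?q))"
      using GB int_mean_le_iff_finite[OF p False B]
      by (intro mult_left_mono sum_bounded_above) auto
    also have "\<dots> \<le> c powr ?q * (?n powr ?q * (?n powr ?q * B powr ?q))"
    proof (intro mult_left_mono mult_right_mono)
      show "?n \<le> ?n powr ?q"
        using powr_mono[of 1 ?q ?n] q by (cases "card K = 0") auto
    qed auto
    also have "\<dots> = (c * ?n ^ 2 * B) powr ?q"
      using c B by (simp add: powr_mult power2_eq_square mult_ac)
    finally show ?thesis using int_mean_le_iff_finite[OF p False B'] by blast
  qed
qed

text \<open>
  For finite exponents this is Fatou's lemma, for the infinite exponent it holds pointwise.\<close>
lemma int_mean_Fatou:
  fixes F :: "complex ^ 'N \<Rightarrow> complex" and G :: "nat \<Rightarrow> complex ^ 'N \<Rightarrow> complex"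
  assumes p: "1 \<le> p" and B: "B \<ge> 0" and G: "\<And>m. cont_sphere r (G m)" and F: "cont_sphere r F"
    and lim: "\<And>\<zeta>. \<zeta> \<in> sph \<Longrightarrow> (\<lambda>m. G m (r *\<^sub>R \<zeta>)) \<longlonglongrightarrow> F (r *\<^sub>R \<zeta>)"
    and GB: "\<And>m. int_mean p r (G m) \<le> ennreal B"
  shows "int_mean p r F \<le> ennreal B"
proof (cases "p = \<infinity>")
  case True
  have "cmod (F (r *\<^sub>R \<zeta>)) \<le> B" if z: "\<zeta> \<in> sph" for \<zeta>
    by (rule Lim_bounded[OF tendsto_norm[OF lim[OF z]]])
       (use GB G True int_mean_le_iff_infinite[OF G B] z in blast)
  then show ?thesis using True int_mean_le_iff_infinite[OF F B] by blast
next
  case False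
  let ?q = "enn2real p"
  have q: "?q \<ge> 1" by (rule exponent_ge_1[OF p False])
  let ?g = "\<lambda>m x. cmod (G m (r *\<^sub>R x)) powr ?q" and ?f = "\<lambda>x. cmod (F (r *\<^sub>R x)) powr ?q"
  have gi: "integrable sphere_measure (?g m)" for m
    by (intro integrable_sphere_measure continuous_on_cmod_powr q G)
  have fi: "integrable sphere_measure ?f"
    by (intro integrable_sphere_measure continuous_on_cmod_powr q F)
  have "(\<integral>\<^sup>+x. ennreal (?f x) \<partial>sphere_measure) = (\<integral>\<^sup>+x. liminf (\<lambda>m. ennreal (?g m x)) \<partial>sphere_measure)"
  proof (rule nn_integral_cong)
    fix x :: "complex ^ 'N" assume "x \<in> space sphere_measure"
    then have "x \<in> sph" by (simp add: space_sphere_measure)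
    then have "(\<lambda>m. ennreal (?g m x)) \<longlonglongrightarrow> ennreal (?f x)"
      using q by (intro tendsto_intros lim tendsto_powr') auto
    then show "ennreal (?f x) = liminf (\<lambda>m. ennreal (?g m x))"
      by (rule lim_imp_Liminf[OF sequentially_bot, symmetric])
  qed
  also have "\<dots> \<le> liminf (\<lambda>m. \<integral>\<^sup>+x. ennreal (?g m x) \<partial>sphere_measure)"
    by (rule nn_integral_liminf) (use gi in auto)
  also have "\<dots> \<le> ennreal (B powr ?q)"
  proof (rule Liminf_le)
    show "\<forall>\<^sub>F m in sequentially. (\<integral>\<^sup>+x. ennreal (?g m x) \<partial>sphere_measure) \<le> ennreal (B powr ?q)"
      using GB unfolding int_mean_le_iff_finite[OF p False B]
      by (intro always_eventually allI) (simp add: nn_integral_eq_integral[OF gi] ennreal_leI)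
  qed (rule sequentially_bot)
  finally have "(\<integral>x. ?f x \<partial>sphere_measure) \<le> B powr ?q"
    by (simp add: nn_integral_eq_integral[OF fi])
  then show ?thesis using int_mean_le_iff_finite[OF p False B] by blast
qed

section \<open>Composition with contractions\<close>

lemma inner_smult_left: "inner (c *s u) v = inner u (cnj c *s (v :: complex ^ 'N))"
  by (simp add: inner_vec_def inner_complex_def algebra_simps)

definition contractions :: "(complex ^ 'N ^ 'N) set" where
  "contractions = {A. \<forall>z. norm (A *v z) \<le> norm z}"

lemma continuous_on_matrix_vector_mult [continuous_intros]:
  fixes f :: "'a::topological_space \<Rightarrow> complex ^ 'N ^ 'N"
  assumes "continuous_on S f" "continuous_on S g"
  shows "continuous_on S (\<lambda>x. f x *v g x)"
  unfolding matrix_vector_mult_def using assms by (intro continuous_intros)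

lemma norm_entry_le_1:
  fixes A :: "complex ^ 'N ^ 'N"
  assumes "A \<in> contractions" shows "cmod (A $ i $ j) \<le> 1"
proof -
  have "A $ i $ j = (A *v axis j 1) $ i" by (simp add: matrix_vector_mult_def axis_def if_distrib cong: if_cong)
  also have "cmod \<dots> \<le> norm (A *v axis j 1)" by (rule Finite_Cartesian_Product.norm_nth_le)
  also have "\<dots> \<le> norm (axis j 1 :: complex ^ 'N)" using assms unfolding contractions_def by blast
  also have "\<dots> = 1" by simp
  finally show ?thesis .
qed

lemma compact_contractions: "compact (contractions :: (complex ^ 'N ^ 'N) set)"
  unfolding compact_eq_bounded_closed
proof
  have "norm A \<le> real CARD('N) * real CARD('N)" if A: "A \<in> contractions" for A :: "complex ^ 'N ^ 'N"
  proof -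
    have "norm (A $ i) \<le> real CARD('N)" for i
    proof -
      have "norm (A $ i) \<le> (\<Sum>j\<in>UNIV. cmod (A $ i $ j))" by (simp add: norm_vec_def L2_set_le_sum)
      also have "\<dots> \<le> (\<Sum>j\<in>(UNIV :: 'N set). 1)" by (rule sum_mono) (rule norm_entry_le_1[OF A])
      finally show ?thesis by simp
    qed
    then have "(\<Sum>i\<in>UNIV. norm (A $ i)) \<le> (\<Sum>i\<in>(UNIV :: 'N set). real CARD('N))" by (intro sum_mono)
    moreover have "norm A \<le> (\<Sum>i\<in>UNIV. norm (A $ i))" by (simp add: norm_vec_def L2_set_le_sum)
    ultimately show ?thesis by simp
  qed
  then show "bounded (contractions :: (complex ^ 'N ^ 'N) set)" unfolding bounded_iff by blast
  have "closed {A :: complex ^ 'N ^ 'N. norm (A *v z) \<le> norm z}" for z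
    by (intro closed_Collect_le continuous_intros)
  then have "closed (\<Inter>z. {A :: complex ^ 'N ^ 'N. norm (A *v z) \<le> norm z})" by (intro closed_INT) auto
  moreover have "(\<Inter>z. {A :: complex ^ 'N ^ 'N. norm (A *v z) \<le> norm z}) = contractions"
    by (auto simp: contractions_def)
  ultimately show "closed (contractions :: (complex ^ 'N ^ 'N) set)" by simp
qed

text \<open>
  The matrix of \<open>z \<mapsto> \<langle>z, x\<rangle> w\<close>.\<close>
definition rank1 :: "complex ^ 'N \<Rightarrow> complex ^ 'N \<Rightarrow> complex ^ 'N ^ 'N" where
  "rank1 w x = (\<chi> i j. w $ i * cnj (x $ j))"

lemma rank1_mult: "rank1 w x *v z = hermitian_inner z x *s w"
  by (simp add: vec_eq_iff rank1_def matrix_vector_mult_def hermitian_inner_def sum_distrib_left mult_ac)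

lemma rank1_smult: "rank1 (l *s w) x *v z = l *s (rank1 w x *v z)"
  by (simp add: rank1_mult vector_smult_assoc mult.commute)

lemma rank1_nonzero:
  assumes "w \<noteq> 0" "x \<noteq> 0" shows "rank1 w x \<noteq> 0"
proof -
  obtain i j where "w $ i \<noteq> 0" "x $ j \<noteq> 0" using assms by (auto simp: vec_eq_iff)
  then have "rank1 w x $ i $ j \<noteq> 0" by (simp add: rank1_def)
  then show ?thesis by (metis zero_index)
qed

lemma hermitian_inner_bound: "cmod (hermitian_inner z x) \<le> norm z * norm x"
proof -
  have "cmod (hermitian_inner z x) \<le> (\<Sum>i\<in>UNIV. \<bar>cmod (z $ i)\<bar> * \<bar>cmod (x $ i)\<bar>)"
    unfolding hermitian_inner_def by (rule order_trans[OF norm_sum]) (simp add: norm_mult)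
  also have "\<dots> \<le> norm z * norm x" unfolding norm_vec_def by (rule L2_set_mult_ineq)
  finally show ?thesis .
qed

lemma Re_hermitian_inner: "Re (hermitian_inner z x) = inner z x"
  by (simp add: hermitian_inner_def inner_vec_def inner_complex_def)

lemma hermitian_inner_smult: "hermitian_inner (c *s z) x = c * hermitian_inner z x"
  by (simp add: hermitian_inner_def sum_distrib_left mult_ac)

lemma hermitian_inner_add: "hermitian_inner (y + z) x = hermitian_inner y x + hermitian_inner z x"
  by (simp add: hermitian_inner_def sum.distrib algebra_simps)

text \<open>
  Real orthogonality to a complex subspace is complex orthogonality; this allows the orthogonal
  complements below to be taken with respect to the real inner product.\<close>
lemma hermitian_inner_eq_0:
  assumes "inner z x = 0" "inner (- \<i> *s z) x = 0" shows "hermitian_inner z x = 0"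
proof -
  have "Re (hermitian_inner z x) = 0" using assms by (simp add: Re_hermitian_inner)
  moreover have "Re (- \<i> * hermitian_inner z x) = 0"
    using assms by (simp only: hermitian_inner_smult[symmetric] Re_hermitian_inner)
  ultimately show ?thesis by (simp add: complex_eq_iff)
qed

text \<open>
  The quadratic form \<open>norm z ^ 2 - norm (T z) ^ 2\<close> is nonnegative, and so its zeros belong to the
  kernel of its polar form.\<close>
lemma contraction_inner_preserved:
  fixes T :: "'a::real_inner \<Rightarrow> 'a"
  assumes lin: "linear T" and c: "\<And>z. norm (T z) \<le> norm z" and s: "norm (T s) = norm s"
  shows "inner (T s) (T y) = inner s y"
proof (rule ccontr)
  define Q where "Q z = (norm z)\<^sup>2 - (norm (T z))\<^sup>2" for z
  define b where "b = inner s y - inner (T s) (T y)"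
  assume "inner (T s) (T y) \<noteq> inner s y"
  then have b: "b \<noteq> 0" by (simp add: b_def)
  have Q0: "Q z \<ge> 0" for z unfolding Q_def using c by (simp add: power_mono)
  \<comment> \<open>Close to the minimiser \<open>- b / Q y\<close> of the quadratic in \<open>t\<close>, but defined also for \<open>Q y = 0\<close>.\<close>
  define t where "t = - b / (Q y + 1)"
  have "Q (s + t *\<^sub>R y) = Q s + 2 * t * b + t\<^sup>2 * Q y"
    unfolding Q_def b_def linear_add[OF lin] linear_scale[OF lin] power2_norm_eq_inner
    by (simp add: inner_simps inner_commute algebra_simps power2_eq_square)
  also have "Q s = 0" using s by (simp add: Q_def)
  also have "0 + 2 * t * b + t\<^sup>2 * Q y = - (b\<^sup>2) * (Q y + 2) / (Q y + 1)\<^sup>2"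
  proof -
    have "Q y + 1 \<noteq> 0" using Q0[of y] by linarith
    then show ?thesis by (simp add: t_def power2_eq_square divide_simps) (simp add: algebra_simps)
  qed
  also have "\<dots> < 0" using b Q0[of y] by (intro divide_neg_pos mult_neg_pos) auto
  finally show False using Q0[of "s + t *\<^sub>R y"] by simp
qed

text \<open>
  The vectors \<open>S\<close> whose norm is preserved by the contraction form a subspace. Its orthogonal
  complement is not trivial, is mapped into the orthogonal complement of the image of \<open>S\<close>, and there
  the norm decreases by a factor \<open>k < 1\<close> by compactness. Hence one may add any map of norm at
  most \<open>1 - k\<close> that vanishes on \<open>S\<close> and has its range orthogonal to the image of \<open>S\<close>.\<close>
lemma contraction_perturbation:
  fixes A :: "complex ^ 'N ^ 'N"
  assumes A: "A \<in> contractions" and z0: "norm (A *v z0) \<noteq> norm z0"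
  obtains w x where "rank1 w x \<noteq> 0" "\<And>l. cmod l \<le> 1 \<Longrightarrow> A + rank1 (l *s w) x \<in> contractions"
proof -
  have c: "norm (A *v z) \<le> norm z" for z using A by (simp add: contractions_def)
  have lin: "linear ((*v) A)"
    by (intro linearI) (simp_all add: matrix_vector_right_distrib scaleR_eq_smult vector_scalar_commute)
  define S where "S = {z. norm (A *v z) = norm z}"
  have pres: "inner (A *v s) (A *v y) = inner s y" if "s \<in> S" for s y
    using contraction_inner_preserved[OF lin c] that by (simp add: S_def)
  have Ssm: "a *s s \<in> S" if "s \<in> S" for a s
    using that by (simp add: S_def vector_scalar_commute norm_smult)
  have sub: "subspace S"
  proof (rule subspaceI)
    show "0 \<in> S" by (simp add: S_def)
    show "a *\<^sub>R s \<in> S" if "s \<in> S" for a s using Ssm[OF that] by (simp add: scaleR_eq_smult)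
    show "s + s' \<in> S" if "s \<in> S" "s' \<in> S" for s s'
    proof -
      have "(norm (A *v (s + s')))\<^sup>2 = (norm (s + s'))\<^sup>2"
        using that pres by (simp add: power2_norm_eq_inner matrix_vector_right_distrib inner_simps)
      then show ?thesis by (simp add: S_def)
    qed
  qed
  then have spanS: "span S = S" by (simp add: span_eq_iff)
  have "S \<noteq> UNIV" using z0 by (auto simp: S_def)
  then have dimS: "dim S < DIM(complex ^ 'N)"
    using dim_eq_full[of S] dim_subset_UNIV[of S] spanS by (metis le_neq_implies_less)
  obtain x where x: "x \<noteq> 0" "\<And>s. s \<in> S \<Longrightarrow> inner x s = 0"
    using orthogonal_to_subspace_exists[OF dimS] spanS by (auto simp: orthogonal_def)
  have "dim ((*v) A ` S) < DIM(complex ^ 'N)"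
    using dim_image_le[OF lin, of S] dimS by linarith
  from orthogonal_to_subspace_exists[OF this] obtain y where
    y: "y \<noteq> 0" "\<And>s. s \<in> S \<Longrightarrow> inner y (A *v s) = 0"
    by (metis imageI orthogonal_def span_base)
  have hx: "hermitian_inner s x = 0" if "s \<in> S" for s
    using x(2)[OF that] x(2)[OF Ssm[OF that, of "- \<i>"]]
    by (intro hermitian_inner_eq_0) (simp_all add: inner_commute)
  have hy: "inner (A *v s) (a *s y) = 0" if "s \<in> S" for s a
    using y(2)[OF Ssm[OF that, of "cnj a"]]
    by (simp add: vector_scalar_commute inner_commute[of y] inner_smult_left)
  define P where "P = {t :: complex ^ 'N. norm t = 1 \<and> (\<forall>s\<in>S. inner t s = 0)}"
  have "compact P"
  proof -
    have "P = sphere 0 1 \<inter> (\<Inter>s\<in>S. {t. inner t s = 0})" by (auto simp: P_def)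
    moreover have "closed {t. inner t s = 0}" for s :: "complex ^ 'N"
      by (intro closed_Collect_eq continuous_intros)
    ultimately show ?thesis by (simp add: compact_Int_closed closed_INT)
  qed
  moreover have "(1 / norm x) *\<^sub>R x \<in> P" using x by (simp add: P_def)
  then have "P \<noteq> {}" by blast
  moreover have "continuous_on P (\<lambda>t. norm (A *v t))" by (intro continuous_intros)
  ultimately obtain t0 where t0: "t0 \<in> P" "\<And>t. t \<in> P \<Longrightarrow> norm (A *v t) \<le> norm (A *v t0)"
    using continuous_attains_sup[of P "\<lambda>t. norm (A *v t)"] by blast
  define k where "k = norm (A *v t0)"
  have "t0 \<notin> S" using t0(1) by (auto simp: P_def)
  then have k1: "k < 1" using c[of t0] t0(1) by (auto simp: k_def P_def S_def)
  have At: "norm (A *v t) \<le> k * norm t" if "\<And>s. s \<in> S \<Longrightarrow> inner t s = 0" for t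
  proof (cases "t = 0")
    case False
    then have "(1 / norm t) *\<^sub>R t \<in> P" using that by (simp add: P_def)
    from t0(2)[OF this] show ?thesis
      using False by (simp add: k_def linear_scale[OF lin] divide_simps)
  qed simp
  define w where "w = complex_of_real ((1 - k) / (norm x * norm y)) *s y"
  have nw: "norm x * norm w = 1 - k" using x y k1
    by (simp add: w_def norm_smult norm_of_real del: of_real_divide of_real_mult of_real_diff)
  show ?thesis
  proof (rule that)
    have "w \<noteq> 0" using nw k1 by auto
    then show "rank1 w x \<noteq> 0" using x(1) by (rule rank1_nonzero)
    fix l :: complex assume l: "cmod l \<le> 1"
    show "A + rank1 (l *s w) x \<in> contractions"
      unfolding contractions_def
    proof (intro CollectI allI)
      fix z
      obtain s t where st: "s \<in> S" "\<And>s. s \<in> S \<Longrightarrow> inner t s = 0" "z = s + t"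
        using orthogonal_subspace_decomp_exists[of S z] spanS by (metis orthogonal_def)
      define d where "d = A *v t + (hermitian_inner t x * l) *s w"
      have eq: "(A + rank1 (l *s w) x) *v z = A *v s + d"
        using hx[OF st(1)]
        by (simp add: st(3) d_def matrix_vector_mult_add_rdistrib matrix_vector_right_distrib rank1_mult
            hermitian_inner_add vector_smult_assoc)
      have "norm d \<le> k * norm t + cmod (hermitian_inner t x) * cmod l * norm w"
        unfolding d_def by (intro norm_triangle_le add_mono At st(2)) (auto simp: norm_smult norm_mult)
      also have "cmod (hermitian_inner t x) * cmod l * norm w \<le> (norm t * norm x) * 1 * norm w"
        by (intro mult_mono hermitian_inner_bound l) auto
      also have "k * norm t + (norm t * norm x) * 1 * norm w = norm t * (k + norm x * norm w)"
        by (simp add: algebra_simps)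
      also have "\<dots> = norm t" by (simp add: nw)
      finally have d: "norm d \<le> norm t" by simp
      have orth: "inner (A *v s) d = 0"
        unfolding d_def inner_add_right
        using pres[OF st(1), of t] st(2)[OF st(1)] hy[OF st(1)]
        by (simp add: inner_commute w_def vector_smult_assoc)
      have "(norm (A *v s + d))\<^sup>2 = (norm (A *v s))\<^sup>2 + (norm d)\<^sup>2"
        using orth by (simp add: power2_norm_eq_inner inner_simps inner_commute)
      also have "\<dots> \<le> (norm s)\<^sup>2 + (norm t)\<^sup>2"
        using c[of s] d by (intro add_mono power_mono) auto
      also have "\<dots> = (norm z)\<^sup>2"
        using st(2)[OF st(1)] by (simp add: st(3) power2_norm_eq_inner inner_simps inner_commute)
      finally show "norm ((A + rank1 (l *s w) x) *v z) \<le> norm z"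
        by (simp add: eq power2_le_iff_abs_le)
    qed
  qed
qed

text \<open>
  The cross terms have mean zero over the circle. The second summand is the strict gain that
  excludes maxima at contractions which are not isometries.\<close>
lemma norm_rank1_circle:
  fixes A :: "complex ^ 'N ^ 'N"
  shows "((\<lambda>t. (norm (A + rank1 (cis t *s w) x))\<^sup>2) has_integral
    2 * pi * ((norm A)\<^sup>2 + (norm (rank1 w x))\<^sup>2)) {0..2*pi}"
proof -
  define E F where "E = rank1 w x" and "F = rank1 (\<i> *s w) x"
  have E: "rank1 (cis t *s w) x = cos t *\<^sub>R E + sin t *\<^sub>R F" for t
    by (simp add: E_def F_def rank1_def vec_eq_iff cis.ctr complex_eq_iff algebra_simps)
  have nE: "norm (rank1 (cis t *s w) x) = norm E" for t
    by (simp add: E_def rank1_def norm_vec_def norm_mult L2_set_def power_mult_distrib)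
  have "(norm (A + rank1 (cis t *s w) x))\<^sup>2 =
      (norm A)\<^sup>2 + (norm E)\<^sup>2 + 2 * (cos t * inner A E + sin t * inner A F)" for t
  proof -
    have "(norm (A + rank1 (cis t *s w) x))\<^sup>2 =
        (norm A)\<^sup>2 + (norm (rank1 (cis t *s w) x))\<^sup>2 + 2 * inner A (rank1 (cis t *s w) x)"
      by (simp add: power2_norm_eq_inner inner_simps inner_commute)
    then show ?thesis by (simp add: nE) (simp add: E inner_simps)
  qed
  moreover have "((\<lambda>t. (norm A)\<^sup>2 + (norm E)\<^sup>2 + 2 * (cos t * inner A E + sin t * inner A F)) has_integral
      (((norm A)\<^sup>2 + (norm E)\<^sup>2) * (2*pi) + 2 * (sin (2*pi) * inner A E - cos (2*pi) * inner A F)) -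
      (((norm A)\<^sup>2 + (norm E)\<^sup>2) * 0 + 2 * (sin 0 * inner A E - cos 0 * inner A F))) {0..2*pi}"
    by (rule fundamental_theorem_of_calculus)
       (auto intro!: derivative_eq_intros simp: has_real_derivative_iff_has_vector_derivative[symmetric])
  ultimately show ?thesis by (simp add: E_def mult.commute)
qed

text \<open>
  The maximum principle on the set of contractions. A small multiple of the squared Frobenius
  norm is added to the integral to make it strictly subharmonic; by the mean value property the sum
  cannot have its maximum at the centre of a disc of contractions. So the maximum is attained at an
  isometry, where the integral is that of \<open>f\<close> itself. Then the multiple tends to zero.\<close>
lemma power_integral_contraction:
  fixes f :: "complex ^ 'N \<Rightarrow> complex" and A :: "complex ^ 'N ^ 'N"
  assumes f: "holo f" and r: "0 < r" "r < 1" and q: "q \<ge> 1" and A: "A \<in> contractions"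
  shows "(\<integral>\<zeta>. cmod (f (r *\<^sub>R (A *v \<zeta>))) powr q \<partial>sphere_measure)
    \<le> (\<integral>\<zeta>. cmod (f (r *\<^sub>R \<zeta>)) powr q \<partial>sphere_measure)"
proof -
  let ?\<sigma> = "sphere_measure :: (complex ^ 'N) measure"
  define \<Psi> where "\<Psi> A = (\<integral>\<zeta>. cmod (f (r *\<^sub>R (A *v \<zeta>))) powr q \<partial>?\<sigma>)" for A :: "complex ^ 'N ^ 'N"
  define M where "M = (\<integral>\<zeta>. cmod (f (r *\<^sub>R \<zeta>)) powr q \<partial>?\<sigma>)"
  have inball: "r *\<^sub>R (A *v \<zeta>) \<in> ball 0 1" if "A \<in> contractions" "\<zeta> \<in> sph" for A :: "complex ^ 'N ^ 'N" and \<zeta>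
  proof -
    have "norm (A *v \<zeta>) \<le> norm \<zeta>" using that(1) unfolding contractions_def by blast
    then have "norm (A *v \<zeta>) \<le> 1" using that(2) by simp
    then have "r * norm (A *v \<zeta>) \<le> r * 1" using r by (intro mult_left_mono) auto
    then have "r * norm (A *v \<zeta>) < 1" using r by linarith
    then show ?thesis using r by simp
  qed
  let ?h = "\<lambda>(A :: complex ^ 'N ^ 'N) \<zeta>. cmod (f (r *\<^sub>R (A *v \<zeta>))) powr q"
  have conth: "continuous_on (contractions \<times> sph) (\<lambda>x. ?h (fst x) (snd x))"
    by (intro continuous_on_cmod_powr q continuous_on_holo_compose[OF f] continuous_intros)
       (use inball in auto)
  have cont1: "continuous_on sph (?h A)" if "A \<in> contractions" for A
    using continuous_on_compose2[OF conth, of sph "\<lambda>\<zeta>. (A, \<zeta>)"] that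
    by (simp add: image_subset_iff continuous_on_Pair)
  have cont2: "continuous_on contractions (\<lambda>A. ?h A \<zeta>)" if "\<zeta> \<in> sph" for \<zeta>
    using continuous_on_compose2[OF conth, of contractions "\<lambda>A. (A, \<zeta>)"] that
    by (simp add: image_subset_iff continuous_on_Pair)
  have "bounded ((\<lambda>x. ?h (fst x) (snd x)) ` (contractions \<times> sph))"
    by (intro compact_imp_bounded compact_continuous_image conth compact_Times compact_sph compact_contractions)
  then obtain B where B: "\<And>A \<zeta>. A \<in> contractions \<Longrightarrow> \<zeta> \<in> sph \<Longrightarrow> norm (?h A \<zeta>) \<le> B"
    unfolding bounded_iff by force
  have cont\<Psi>: "continuous_on contractions \<Psi>"
    unfolding continuous_on_sequentially comp_def
  proof (intro allI ballI impI, elim conjE)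
    fix X and A :: "complex ^ 'N ^ 'N"
    assume A: "A \<in> contractions" and X: "\<forall>n. X n \<in> contractions" and lim: "X \<longlonglongrightarrow> A"
    show "(\<lambda>n. \<Psi> (X n)) \<longlonglongrightarrow> \<Psi> A"
      unfolding \<Psi>_def
    proof (rule integral_dominated_convergence[where w = "\<lambda>_. B"])
      show "?h A \<in> borel_measurable ?\<sigma>" by (rule borel_measurable_sphere_measure[OF cont1[OF A]])
      show "?h (X n) \<in> borel_measurable ?\<sigma>" for n
        using X by (intro borel_measurable_sphere_measure cont1) auto
      show "AE \<zeta> in ?\<sigma>. (\<lambda>n. ?h (X n) \<zeta>) \<longlonglongrightarrow> ?h A \<zeta>"
      proof (rule AE_I2)
        fix \<zeta> assume "\<zeta> \<in> space ?\<sigma>"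
        then have "\<zeta> \<in> sph" by (simp add: space_sphere_measure)
        from cont2[OF this] show "(\<lambda>n. ?h (X n) \<zeta>) \<longlonglongrightarrow> ?h A \<zeta>"
          unfolding continuous_on_sequentially comp_def using A X lim by blast
      qed
      show "AE \<zeta> in ?\<sigma>. norm (?h (X n) \<zeta>) \<le> B" for n
        using B X by (intro AE_I2) (simp add: space_sphere_measure)
    qed simp
  qed
  obtain R where R: "\<And>A :: complex ^ 'N ^ 'N. A \<in> contractions \<Longrightarrow> norm A \<le> R"
    using compact_imp_bounded[OF compact_contractions] unfolding bounded_iff by blast
  have step: "\<Psi> A \<le> M + e * R\<^sup>2" if A: "A \<in> contractions" and e: "e > 0" for A e
  proof -
    define \<Phi> where "\<Phi> A = \<Psi> A + e * (norm A)\<^sup>2" for A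
    have "continuous_on contractions \<Phi>" unfolding \<Phi>_def by (intro continuous_intros cont\<Psi>)
    then obtain C where C: "C \<in> contractions" "\<And>A. A \<in> contractions \<Longrightarrow> \<Phi> A \<le> \<Phi> C"
      using continuous_attains_sup[OF compact_contractions, of \<Phi>] A by blast
    have iso: "norm (C *v z) = norm z" for z
    proof (rule ccontr)
      assume "norm (C *v z) \<noteq> norm z"
      then obtain w x where wx: "rank1 w x \<noteq> 0" "\<And>l. cmod l \<le> 1 \<Longrightarrow> C + rank1 (l *s w) x \<in> contractions"
        using contraction_perturbation[OF C(1)] by metis
      define D where "D t = C + rank1 (cis t *s w) x" for t
      have D: "D t \<in> contractions" for t unfolding D_def by (rule wx) simp
      have Dv: "D t *v \<zeta> = C *v \<zeta> + cis t *s (rank1 w x *v \<zeta>)" for t \<zeta>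
        by (simp add: D_def matrix_vector_mult_add_rdistrib rank1_smult)
      have cDz: "continuous_on {0..2*pi} (\<lambda>t. f (r *\<^sub>R (D t *v \<zeta>)))" if "\<zeta> \<in> sph" for \<zeta>
      proof (rule continuous_on_holo_compose[OF f])
        show "continuous_on {0..2*pi} (\<lambda>t. r *\<^sub>R (D t *v \<zeta>))"
          unfolding Dv by (intro continuous_intros)
      qed (use inball D that in auto)
      have cD: "continuous_on ({0..2*pi} \<times> sph) (\<lambda>(t, \<zeta>). cmod (f (r *\<^sub>R (D t *v \<zeta>))))"
        unfolding split_beta
      proof (intro continuous_on_norm continuous_on_holo_compose[OF f])
        show "continuous_on ({0..2*pi} \<times> sph) (\<lambda>y. r *\<^sub>R (D (fst y) *v snd y))"
          unfolding Dv by (intro continuous_intros)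
      qed (use inball D in auto)
      have cC: "continuous_on sph (\<lambda>\<zeta>. cmod (f (r *\<^sub>R (C *v \<zeta>))))"
        by (intro continuous_on_norm continuous_on_holo_compose[OF f] continuous_intros)
           (use inball C in auto)
      have mean: "cmod (f (r *\<^sub>R (C *v \<zeta>))) \<le> integral {0..2*pi} (\<lambda>t. cmod (f (r *\<^sub>R (D t *v \<zeta>)))) / (2*pi - 0)"
        if z: "\<zeta> \<in> sph" for \<zeta>
      proof -
        have eq: "r *\<^sub>R (C *v \<zeta>) + l *s (r *\<^sub>R (rank1 w x *v \<zeta>)) = r *\<^sub>R ((C + rank1 (l *s w) x) *v \<zeta>)" for l
          by (simp add: matrix_vector_mult_add_rdistrib rank1_smult scaleR_add_right scaleR_eq_smult
              vector_smult_assoc mult.commute)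
        have "((\<lambda>t. f (r *\<^sub>R (D t *v \<zeta>))) has_integral (2 * pi * f (r *\<^sub>R (C *v \<zeta>)))) {0..2*pi}"
          using slice_mean[OF f, of "r *\<^sub>R (C *v \<zeta>)" "r *\<^sub>R (rank1 w x *v \<zeta>)"] inball[OF wx(2) z]
          unfolding eq D_def by blast
        then have "2 * pi * f (r *\<^sub>R (C *v \<zeta>)) = integral {0..2*pi} (\<lambda>t. f (r *\<^sub>R (D t *v \<zeta>)))"
          by (simp add: integral_unique)
        then have "2 * pi * cmod (f (r *\<^sub>R (C *v \<zeta>))) = cmod (integral {0..2*pi} (\<lambda>t. f (r *\<^sub>R (D t *v \<zeta>))))"
          by (metis abs_of_nonneg norm_mult norm_of_real pi_ge_zero mult_nonneg_nonneg zero_le_numeral)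
        also have "\<dots> \<le> integral {0..2*pi} (\<lambda>t. cmod (f (r *\<^sub>R (D t *v \<zeta>))))"
          by (rule integral_norm_bound_integral) (use cDz[OF z] in \<open>auto intro!: integrable_continuous_interval continuous_intros\<close>)
        finally show ?thesis by (simp add: le_divide_eq mult.commute)
      qed
      note avg = powr_integral_average[OF q _ cD _ cC _ mean]
      have "\<Psi> C \<le> integral {0..2*pi} (\<lambda>t. \<Psi> (D t)) / (2*pi - 0)"
        unfolding \<Psi>_def by (rule avg(1)) auto
      also have "\<dots> \<le> integral {0..2*pi} (\<lambda>t. \<Phi> C - e * (norm (D t))\<^sup>2) / (2*pi - 0)"
      proof (intro divide_right_mono integral_le)
        show "(\<lambda>t. \<Psi> (D t)) integrable_on {0..2*pi}" unfolding \<Psi>_def by (rule avg(2)) auto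
        show "(\<lambda>t. \<Phi> C - e * (norm (D t))\<^sup>2) integrable_on {0..2*pi}"
          unfolding D_def using norm_rank1_circle[of C w x]
          by (intro integrable_diff integrable_on_mult_right integrable_const_ivl) blast
        show "\<Psi> (D t) \<le> \<Phi> C - e * (norm (D t))\<^sup>2" for t
          using C(2)[OF D[of t]] by (simp add: \<Phi>_def)
      qed simp
      also have "integral {0..2*pi} (\<lambda>t. \<Phi> C - e * (norm (D t))\<^sup>2) =
          2 * pi * (\<Phi> C - e * ((norm C)\<^sup>2 + (norm (rank1 w x))\<^sup>2))"
      proof -
        have "((\<lambda>t. \<Phi> C - e * (norm (D t))\<^sup>2) has_integral
            (2 * pi * \<Phi> C - e * (2 * pi * ((norm C)\<^sup>2 + (norm (rank1 w x))\<^sup>2)))) {0..2*pi}"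
          unfolding D_def
          using has_integral_const_real[of "\<Phi> C" 0 "2*pi"]
          by (intro has_integral_diff has_integral_mult_right norm_rank1_circle) (simp add: mult.commute)
        then show ?thesis by (simp add: integral_unique algebra_simps)
      qed
      also have "2 * pi * (\<Phi> C - e * ((norm C)\<^sup>2 + (norm (rank1 w x))\<^sup>2)) / (2*pi - 0) =
          \<Phi> C - e * ((norm C)\<^sup>2 + (norm (rank1 w x))\<^sup>2)"
        by simp
      also have "\<dots> = \<Psi> C - e * (norm (rank1 w x))\<^sup>2"
        by (simp add: \<Phi>_def algebra_simps)
      finally have "e * (norm (rank1 w x))\<^sup>2 \<le> 0" by simp
      with e wx(1) show False by (simp add: mult_le_0_iff)
    qed
    have "\<Psi> C = M"
    proof -
      have lin: "linear ((*v) C)"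
        by (intro linearI) (simp_all add: matrix_vector_right_distrib scaleR_eq_smult vector_scalar_commute)
      have "(\<lambda>\<zeta>. cmod (f (r *\<^sub>R \<zeta>)) powr q) \<in> borel_measurable ?\<sigma>"
        by (intro borel_measurable_sphere_measure continuous_on_cmod_powr q cont_sphere_holo f r)
      from integral_distr[OF sphere_measure_distr_isometry(1)[OF lin iso] this]
      show ?thesis unfolding \<Psi>_def M_def by (simp add: sphere_measure_distr_isometry(2)[OF lin iso])
    qed
    have "\<Psi> A \<le> \<Phi> A" using e by (simp add: \<Phi>_def)
    also have "\<dots> \<le> \<Phi> C" by (rule C(2)[OF A])
    also have "\<dots> = M + e * (norm C)\<^sup>2" by (simp add: \<Phi>_def \<open>\<Psi> C = M\<close>)
    also have "\<dots> \<le> M + e * R\<^sup>2" using e R[OF C(1)] by (intro add_left_mono mult_left_mono power_mono) auto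
    finally show ?thesis .
  qed
  have "\<Psi> A \<le> M"
  proof (rule field_le_epsilon)
    fix d :: real assume d: "d > 0"
    have "\<Psi> A \<le> M + d / (R\<^sup>2 + 1) * R\<^sup>2" using d by (intro step A divide_pos_pos) (auto intro: add_nonneg_pos)
    also have "d / (R\<^sup>2 + 1) * R\<^sup>2 \<le> d" using d by (simp add: divide_le_eq add_nonneg_pos)
    finally show "\<Psi> A \<le> M + d" by simp
  qed
  then show ?thesis by (simp add: \<Psi>_def M_def)
qed

lemma ball_operators_norm_le:
  assumes U: "U \<in> ball_operators" shows "norm (U z) \<le> norm z"
proof (rule ccontr)
  assume n: "\<not> norm (U z) \<le> norm z"
  define c where "c = complex_of_real (1 / norm (U z))"
  have "c *s z \<in> ball 0 1" using n by (simp add: c_def norm_smult divide_less_eq norm_divide)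
  from ball_operators_ball[OF U this] have "norm (c *s U z) < 1" by (simp add: ball_operators_smult[OF U])
  moreover have "norm (c *s U z) = 1" using n norm_ge_zero[of z] by (auto simp: c_def norm_smult norm_divide)
  ultimately show False by simp
qed

text \<open>
  For the infinite exponent the maximum principle on the complex line through the given point suffices.\<close>
lemma int_mean_contraction:
  fixes f :: "complex ^ 'N \<Rightarrow> complex"
  assumes p: "1 \<le> p" and r: "0 < r" "r < 1" and B: "B \<ge> 0"
    and f: "holo f" and U: "U \<in> ball_operators" and le: "int_mean p r f \<le> ennreal B"
  shows "int_mean p r (\<lambda>z. f (U z)) \<le> ennreal B"
proof (cases "p = \<infinity>")
  case True
  have fB: "cmod (f (r *\<^sub>R \<zeta>)) \<le> B" if "\<zeta> \<in> sph" for \<zeta>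
    using that le int_mean_le_iff_infinite[OF cont_sphere_holo[OF f r] B] True by blast
  have "cmod (f (U (r *\<^sub>R \<zeta>))) \<le> B" if z: "\<zeta> \<in> sph" for \<zeta>
  proof -
    define v where "v = U (r *\<^sub>R \<zeta>)"
    have nv: "norm v \<le> r" using ball_operators_norm_le[OF U, of "r *\<^sub>R \<zeta>"] z r by (simp add: v_def)
    obtain z0 l where z0: "norm z0 = r" "cmod l \<le> 1" "v = l *s z0"
    proof (cases "v = 0")
      case True
      show ?thesis by (rule that[of "r *\<^sub>R \<zeta>" 0]) (use True z r in auto)
    next
      case False
      show ?thesis
      proof (rule that[of "(r / norm v) *\<^sub>R v" "complex_of_real (norm v / r)"])
        show "norm ((r / norm v) *\<^sub>R v) = r" using False r by simp
        show "cmod (complex_of_real (norm v / r)) \<le> 1" using nv r by (simp only: norm_of_real) simp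
        show "v = complex_of_real (norm v / r) *s (r / norm v) *\<^sub>R v"
          using False r by (simp add: scaleR_eq_smult vector_smult_assoc)
      qed
    qed
    have inb: "l *s z0 \<in> ball 0 1" if "l \<in> cball 0 1" for l
    proof -
      have "cmod l * r \<le> 1 * r" using that r by (intro mult_right_mono) auto
      then have "cmod l * r < 1" using r by linarith
      then show ?thesis by (simp add: norm_smult z0(1))
    qed
    have h: "(\<lambda>l. f (l *s z0)) holomorphic_on cball 0 1" by (rule slice_holomorphic[OF f inb])
    have "cmod (f (l *s z0)) \<le> B"
    proof (rule maximum_modulus_frontier[of "\<lambda>l. f (l *s z0)" "cball 0 1"])
      show "(\<lambda>l. f (l *s z0)) holomorphic_on interior (cball 0 1)"
        by (rule holomorphic_on_subset[OF h interior_subset])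
      show "continuous_on (closure (cball 0 1)) (\<lambda>l. f (l *s z0))"
        using holomorphic_on_imp_continuous_on[OF h] by simp
      fix l :: complex assume "l \<in> frontier (cball 0 1)"
      then have "cmod l = 1" by simp
      then have "(1 / r) *\<^sub>R (l *s z0) \<in> sph" using r by (simp add: norm_smult z0(1))
      from fB[OF this] show "cmod (f (l *s z0)) \<le> B" using r by simp
    qed (use z0 in auto)
    then show ?thesis by (simp add: v_def[symmetric] z0(3))
  qed
  then show ?thesis
    using True int_mean_le_iff_infinite[OF cont_sphere_holo[OF holo_compose_operator[OF U f] r] B] by blast
next
  case False
  have lin: "Vector_Spaces.linear (*s) (*s) U" using U by (simp add: ball_operators_def)
  have mU: "matrix U *v z = U z" for z by (rule matrix_works[OF lin])
  have "matrix U \<in> contractions" by (simp add: contractions_def mU ball_operators_norm_le[OF U])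
  from power_integral_contraction[OF f r exponent_ge_1[OF p False] this]
  have "(\<integral>\<zeta>. cmod (f (U (r *\<^sub>R \<zeta>))) powr enn2real p \<partial>sphere_measure)
      \<le> (\<integral>\<zeta>. cmod (f (r *\<^sub>R \<zeta>)) powr enn2real p \<partial>sphere_measure)"
    by (simp add: mU scaleR_eq_smult ball_operators_smult[OF U])
  then show ?thesis using le unfolding int_mean_le_iff_finite[OF p False B] by linarith
qed

section \<open>Tangential derivatives\<close>

lemma int_mean_dominated:
  fixes F G :: "complex ^ 'N \<Rightarrow> complex"
  assumes p: "1 \<le> p" and B: "B \<ge> 0" and c: "c \<ge> 0" and G: "cont_sphere r G" and F: "cont_sphere r F"
    and le: "\<And>\<zeta>. \<zeta> \<in> sph \<Longrightarrow> cmod (F (r *\<^sub>R \<zeta>)) \<le> c * cmod (G (r *\<^sub>R \<zeta>))"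
    and GB: "int_mean p r G \<le> ennreal B"
  shows "int_mean p r F \<le> ennreal (c * B)"
  using int_mean_sum[OF p B c, where K = "{()}" and r = r and G = "\<lambda>_. G" and F = F] G F le GB by simp

lemma continuous_on_cderiv:
  fixes f :: "complex ^ 'N \<Rightarrow> complex"
  assumes f: "holo f" and a: "continuous_on S a" and b: "continuous_on S b"
    and ball: "\<And>x. x \<in> S \<Longrightarrow> a x \<in> ball 0 1"
  shows "continuous_on S (\<lambda>x. cderiv f (a x) (b x))"
proof -
  have "continuous_on S (\<lambda>x. \<Sum>i\<in>UNIV. b x $ i * partial_deriv i f (a x))"
    by (intro continuous_on_sum continuous_on_mult continuous_on_holo_compose[OF holo_partial_deriv[OF f]] a ball)
       (intro continuous_intros b)
  then show ?thesis
    by (rule continuous_on_eq) (simp only: cderiv_eq_sum_partial_deriv[OF f ball])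
qed

lemma cmod_integral_le:
  fixes g :: "real \<Rightarrow> complex"
  assumes "continuous_on {a..b} g"
  shows "cmod (integral {a..b} g) \<le> integral {a..b} (\<lambda>t. cmod (g t))"
  by (rule integral_norm_bound_integral)
     (use assms in \<open>auto intro!: integrable_continuous_interval continuous_intros\<close>)

lemma sph_scale_ball: "0 < r \<Longrightarrow> r < 1 \<Longrightarrow> \<zeta> \<in> sph \<Longrightarrow> r *\<^sub>R \<zeta> \<in> ball (0 :: complex ^ 'N) 1"
  by simp

text \<open>
  A direction orthogonal to \<open>z\<close> for the Hermitian inner product, in the plane of the coordinates \<open>i\<close>
  and \<open>j\<close>. It depends antilinearly on \<open>z\<close>.\<close>
definition tangent :: "'N \<Rightarrow> 'N \<Rightarrow> complex ^ 'N \<Rightarrow> complex ^ 'N" where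
  "tangent i j z = cnj (z $ j) *s axis i 1 - cnj (z $ i) *s axis j 1"

lemma continuous_on_tangent [continuous_intros]:
  "continuous_on S g \<Longrightarrow> continuous_on S (\<lambda>x. tangent i j (g x))"
  unfolding tangent_def by (intro continuous_intros)

text \<open>
  Left multiplication of the quaternion \<open>a + b j\<close> by the unit quaternion \<open>c - s e j\<close>.\<close>
lemma quaternion_rotation:
  fixes a b e :: complex
  assumes "cmod e = 1" "c\<^sup>2 + s\<^sup>2 = 1"
  shows "(cmod (of_real c * a + e * of_real s * cnj b))\<^sup>2 + (cmod (of_real c * b - e * of_real s * cnj a))\<^sup>2
    = (cmod a)\<^sup>2 + (cmod b)\<^sup>2"
proof -
  have e: "e * cnj e = 1" using assms(1) by (metis complex_norm_square of_real_1 one_power2)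
  have cs: "(of_real c)\<^sup>2 + (of_real s)\<^sup>2 = (1 :: complex)"
    using assms(2) by (metis of_real_1 of_real_add of_real_power)
  have "complex_of_real ((cmod (of_real c * a + e * of_real s * cnj b))\<^sup>2 + (cmod (of_real c * b - e * of_real s * cnj a))\<^sup>2)
      = ((of_real c)\<^sup>2 + (e * cnj e) * (of_real s)\<^sup>2) * (a * cnj a + b * cnj b)"
    unfolding of_real_add complex_norm_square by (simp add: power2_eq_square algebra_simps)
  also have "\<dots> = complex_of_real ((cmod a)\<^sup>2 + (cmod b)\<^sup>2)"
    unfolding e of_real_add complex_norm_square by (simp add: cs)
  finally show ?thesis using of_real_eq_iff by blast
qed

text \<open>
  The point \<open>cos s z + sin s e u\<close> on the circle in the tangential direction \<open>u\<close> at \<open>z\<close> is obtained in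
  two steps: the quaternionic rotation \<open>plane_rot\<close> moves the coordinates \<open>i\<close> and \<open>j\<close> and keeps the
  others, which \<open>plane_damp\<close> then multiplies by \<open>cos s\<close>. The first is an isometry that is only real
  linear, the second a complex linear contraction.\<close>
definition plane_rot :: "'N \<Rightarrow> 'N \<Rightarrow> real \<Rightarrow> complex \<Rightarrow> complex ^ 'N \<Rightarrow> complex ^ 'N" where
  "plane_rot i j s e z = (\<chi> k. if k = i then of_real (cos s) * z $ i + e * of_real (sin s) * cnj (z $ j)
     else if k = j then of_real (cos s) * z $ j - e * of_real (sin s) * cnj (z $ i) else z $ k)"

definition plane_damp :: "'N \<Rightarrow> 'N \<Rightarrow> real \<Rightarrow> complex ^ 'N \<Rightarrow> complex ^ 'N" where
  "plane_damp i j s z = (\<chi> k. if k = i \<or> k = j then z $ k else of_real (cos s) * z $ k)"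

lemma linear_plane_rot: "linear (plane_rot i j s e)"
  by (rule linearI) (simp_all add: plane_rot_def vec_eq_iff scaleR_eq_smult algebra_simps)

lemma norm_plane_rot:
  fixes z :: "complex ^ 'N"
  assumes ij: "i \<noteq> j" and e: "cmod e = 1"
  shows "norm (plane_rot i j s e z) = norm z"
proof -
  let ?w = "plane_rot i j s e z"
  have split: "(\<Sum>k\<in>UNIV. h k) = h i + h j + (\<Sum>k\<in>UNIV - {i, j}. h k)" for h :: "'N \<Rightarrow> real"
  proof -
    have "(\<Sum>k\<in>UNIV. h k) = (\<Sum>k\<in>UNIV - {i, j}. h k) + (\<Sum>k\<in>{i, j}. h k)"
      by (rule sum.subset_diff) auto
    then show ?thesis using ij by simp
  qed
  have "(\<Sum>k\<in>UNIV. (cmod (?w $ k))\<^sup>2) = (\<Sum>k\<in>UNIV. (cmod (z $ k))\<^sup>2)"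
    unfolding split using ij quaternion_rotation[OF e, of "cos s" "sin s" "z $ i" "z $ j"]
    by (simp add: plane_rot_def)
  then show ?thesis by (simp add: norm_vec_def L2_set_def)
qed

lemma plane_damp_ball_operator: "plane_damp i j s \<in> (ball_operators :: (complex ^ 'N \<Rightarrow> complex ^ 'N) set)"
proof -
  have le: "norm (plane_damp i j s z) \<le> norm z" for z :: "complex ^ 'N"
    unfolding norm_vec_def
  proof (rule L2_set_mono)
    fix k
    have "\<bar>cos s\<bar> * cmod (z $ k) \<le> 1 * cmod (z $ k)" by (rule mult_right_mono) auto
    then show "cmod (plane_damp i j s z $ k) \<le> cmod (z $ k)"
      by (simp add: plane_damp_def norm_mult)
  qed simp
  have "plane_damp i j s ` ball 0 1 \<subseteq> (ball 0 1 :: (complex ^ 'N) set)"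
  proof (rule image_subsetI)
    fix z :: "complex ^ 'N" assume "z \<in> ball 0 1"
    then show "plane_damp i j s z \<in> ball 0 1" using le[of z] by simp
  qed
  moreover have "Vector_Spaces.linear (*s) (*s) (plane_damp i j s :: complex ^ 'N \<Rightarrow> _)"
    by (simp add: Vector_Spaces.linear_iff vec.vector_space_axioms) 
       (simp add: plane_damp_def vec_eq_iff algebra_simps)
  ultimately show ?thesis by (simp add: ball_operators_def)
qed

lemma plane_damp_rot:
  assumes "i \<noteq> j"
  shows "plane_damp i j s (plane_rot i j s e z) = of_real (cos s) *s z + e *s (of_real (sin s) *s tangent i j z)"
  using assms by (simp add: plane_damp_def plane_rot_def tangent_def vec_eq_iff axis_def algebra_simps)

lemma plane_damp_rot_ball:
  assumes ij: "i \<noteq> j" and z: "z \<in> ball (0 :: complex ^ 'N) 1" and l: "cmod l \<le> 1"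
  shows "of_real (cos s) *s z + l *s (of_real (sin s) *s tangent i j z) \<in> ball 0 1"
proof -
  let ?P = "\<lambda>l. of_real (cos s) *s z + l *s (of_real (sin s) *s tangent i j z)"
  have unit: "norm (?P e) \<le> norm z" if "cmod e = 1" for e
    unfolding plane_damp_rot[OF ij, symmetric]
    using ball_operators_norm_le[OF plane_damp_ball_operator, of i j s "plane_rot i j s e z"]
    by (simp add: norm_plane_rot[OF ij that])
  obtain e where e: "cmod e = 1" "l = of_real (cmod l) * e"
  proof (cases "l = 0")
    case False
    then show ?thesis by (intro that[of "l / of_real (cmod l)"]) (auto simp: norm_divide)
  qed (auto intro: that[of 1])
  \<comment> \<open>A point of the closed disc lies on a segment joining two opposite points of the circle.\<close>
  have "?P l = ((1 + cmod l) / 2) *\<^sub>R ?P e + ((1 - cmod l) / 2) *\<^sub>R ?P (- e)"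
    by (subst (1) e(2)) (simp add: vec_eq_iff scaleR_eq_smult field_simps)
  then have "norm (?P l) \<le> norm (((1 + cmod l) / 2) *\<^sub>R ?P e) + norm (((1 - cmod l) / 2) *\<^sub>R ?P (- e))"
    by (metis norm_triangle_ineq)
  also have "\<dots> = ((1 + cmod l) / 2) * norm (?P e) + ((1 - cmod l) / 2) * norm (?P (- e))"
    using l by simp
  also have "\<dots> \<le> ((1 + cmod l) / 2) * norm z + ((1 - cmod l) / 2) * norm z"
    using l by (intro add_mono mult_left_mono unit) (auto simp: e(1))
  also have "\<dots> = norm z" by (simp add: field_simps)
  finally show ?thesis using z by simp
qed

text \<open>
  Cauchy's formula on the circle of radius \<open>sin s\<close> in the tangential direction bounds the derivative by
  an average of values of \<open>g\<close>. For a fixed angle the points of these circles are the images of the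
  sphere under a rotation followed by a contraction.\<close>
lemma int_mean_tangent_slice:
  fixes g :: "complex ^ 'N \<Rightarrow> complex"
  assumes p: "1 \<le> p" and r: "0 < r" "r < 1" and B: "B \<ge> 0" and ij: "i \<noteq> j"
    and g: "holo g" and le: "int_mean p r g \<le> ennreal B"
  shows "int_mean p r (\<lambda>z. cderiv g (of_real (cos s) *s z) (of_real (sin s) *s tangent i j z)) \<le> ennreal B"
proof (rule int_mean_average[OF p, where a = 0 and b = "2*pi" and
      G = "\<lambda>t z. g (of_real (cos s) *s z + cis t *s (of_real (sin s) *s tangent i j z))"])
  note ball = plane_damp_rot_ball[OF ij sph_scale_ball[OF r], where s = s]
  have ball0: "of_real (cos s) *s (r *\<^sub>R \<zeta>) \<in> ball 0 1" if "\<zeta> \<in> sph" for \<zeta> :: "complex ^ 'N"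
    using ball[OF that, of 0] by simp
  show "continuous_on ({0..2*pi} \<times> sph) (\<lambda>(t, \<zeta>). g (of_real (cos s) *s (r *\<^sub>R \<zeta>) +
      cis t *s (of_real (sin s) *s tangent i j (r *\<^sub>R \<zeta>))))"
    unfolding split_beta
    by (rule continuous_on_holo_compose[OF g], intro continuous_intros) (use ball in \<open>auto simp del: mem_ball\<close>)
  show "cont_sphere r (\<lambda>z. cderiv g (of_real (cos s) *s z) (of_real (sin s) *s tangent i j z))"
    by (rule continuous_on_cderiv[OF g]) (intro continuous_intros | use ball0 in \<open>simp del: mem_ball\<close>)+
  show "cmod (cderiv g (of_real (cos s) *s (r *\<^sub>R \<zeta>)) (of_real (sin s) *s tangent i j (r *\<^sub>R \<zeta>))) \<le>
      integral {0..2*pi} (\<lambda>t. cmod (g (of_real (cos s) *s (r *\<^sub>R \<zeta>) +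
        cis t *s (of_real (sin s) *s tangent i j (r *\<^sub>R \<zeta>))))) / (2*pi - 0)"
    if z: "\<zeta> \<in> sph" for \<zeta> :: "complex ^ 'N"
  proof -
    let ?a = "of_real (cos s) *s (r *\<^sub>R \<zeta>)" and ?b = "of_real (sin s) *s tangent i j (r *\<^sub>R \<zeta>)"
    have "2 * pi * cderiv g ?a ?b = integral {0..2*pi} (\<lambda>t. cis (- t) * g (?a + cis t *s ?b))"
      by (rule integral_unique[OF slice_mean_deriv[OF g ball[OF z]], symmetric])
    then have "cmod (2 * pi * cderiv g ?a ?b) \<le> integral {0..2*pi} (\<lambda>t. cmod (cis (- t) * g (?a + cis t *s ?b)))"
      by (simp only:) (intro cmod_integral_le continuous_on_mult continuous_on_holo_compose[OF g] ball[OF z],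
        (intro continuous_intros | simp)+)
    then have "2 * pi * cmod (cderiv g ?a ?b) \<le> integral {0..2*pi} (\<lambda>t. cmod (g (?a + cis t *s ?b)))"
      by (simp only: norm_mult norm_cis norm_of_real mult_1) simp
    then show ?thesis by (simp add: le_divide_eq mult.commute)
  qed
  show "int_mean p r (\<lambda>z. g (of_real (cos s) *s z + cis t *s (of_real (sin s) *s tangent i j z))) \<le> ennreal B" for t
  proof -
    let ?D = "plane_damp i j s :: complex ^ 'N \<Rightarrow> _" and ?T = "plane_rot i j s (cis t) :: complex ^ 'N \<Rightarrow> _"
    have "int_mean p r (\<lambda>z. g (?D z)) \<le> ennreal B"
      by (rule int_mean_contraction[OF p r B g plane_damp_ball_operator le])
    from int_mean_isometry[OF p linear_plane_rot _
        cont_sphere_holo[OF holo_compose_operator[OF plane_damp_ball_operator g] r] B this, of i j s "cis t"]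
    show ?thesis by (simp add: norm_plane_rot[OF ij] plane_damp_rot[OF ij])
  qed
qed (use B in auto)

text \<open>
  The formula \<open>f'(z) u = \<integral> (R f)'(s z) u ds\<close> over \<open>0 \<le> s \<le> 1\<close> after the substitution
  of \<open>cos s\<close> for \<open>s\<close>. The factor \<open>sin s\<close> that arises is the radius of the circle on which Cauchy's
  formula is applied, so the two cancel and no singularity is left at \<open>s = 0\<close>.\<close>
lemma cderiv_tangent_integral:
  fixes f :: "complex ^ 'N \<Rightarrow> complex"
  assumes f: "holo f" and z: "z \<in> ball 0 1"
  shows "((\<lambda>s. cderiv (euler_op f) (of_real (cos s) *s z) (of_real (sin s) *s u)) has_integral cderiv f z u) {0..pi/2}"
proof -
  define g where "g = (\<lambda>x. cderiv f x u)"
  have g: "holo g" unfolding g_def by (rule holo_cderiv_dir[OF f])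
  have ball: "of_real (cos s) *s z \<in> ball 0 1" for s
  proof -
    have "\<bar>cos s\<bar> * norm z \<le> 1 * norm z" by (rule mult_right_mono) auto
    then have "\<bar>cos s\<bar> * norm z < 1" using z by simp
    then show ?thesis by (simp add: norm_smult)
  qed
  define F where "F = (\<lambda>s. - (of_real (cos s) * g (of_real (cos s) *s z)))"
  have vd: "(F has_vector_derivative cderiv (euler_op f) (of_real (cos s) *s z) (of_real (sin s) *s u)) (at s)" for s
  proof -
    define w where "w = of_real (cos s) *s z"
    have w: "w \<in> ball 0 1" unfolding w_def by (rule ball)
    have co: "((\<lambda>s. complex_of_real (cos s)) has_vector_derivative of_real (- sin s)) (at s)"
      by (rule has_vector_derivative_of_real) (auto intro!: derivative_eq_intros)
    have "((\<lambda>l. g (l *s z)) has_field_derivative cderiv g w z) (at (of_real (cos s)))"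
      unfolding w_def by (rule holo_slice_deriv0[OF g ball])
    from field_vector_diff_chain_at[OF co this]
    have gd: "((\<lambda>s. g (of_real (cos s) *s z)) has_vector_derivative of_real (- sin s) * cderiv g w z) (at s)"
      by (simp add: comp_def)
    have "(F has_vector_derivative - (of_real (cos s) * (of_real (- sin s) * cderiv g w z) + of_real (- sin s) * g w)) (at s)"
      unfolding F_def w_def
      by (rule has_vector_derivative_minus, rule has_vector_derivative_mult[OF co gd[unfolded w_def]])
    moreover have "- (of_real (cos s) * (of_real (- sin s) * cderiv g w z) + of_real (- sin s) * g w) =
        cderiv (euler_op f) w (of_real (sin s) *s u)"
    proof -
      have "cderiv (euler_op f) w u = g w + of_real (cos s) * cderiv g w z"
        using cderiv_euler_op[OF f w, of u] cderiv_smult[OF g w, of "of_real (cos s)" z]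
        by (simp add: g_def w_def)
      then show ?thesis by (simp add: cderiv_smult[OF holo_euler_op[OF f] w] algebra_simps)
    qed
    ultimately show ?thesis by (simp add: w_def)
  qed
  have "((\<lambda>s. cderiv (euler_op f) (of_real (cos s) *s z) (of_real (sin s) *s u)) has_integral F (pi/2) - F 0) {0..pi/2}"
    by (rule fundamental_theorem_of_calculus, simp, rule has_vector_derivative_at_within, rule vd)
  then show ?thesis by (simp add: F_def g_def)
qed

lemma cont_sphere_tangent:
  fixes f :: "complex ^ 'N \<Rightarrow> complex"
  assumes f: "holo f" and r: "0 < r" "r < 1"
  shows "cont_sphere r (\<lambda>z. c * cderiv f z (tangent i j z))"
proof (rule continuous_on_mult[OF continuous_on_const])
  show "continuous_on sph (\<lambda>\<zeta>. cderiv f (r *\<^sub>R \<zeta>) (tangent i j (r *\<^sub>R \<zeta>)))"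
  proof (rule continuous_on_cderiv[OF f])
    show "continuous_on sph (\<lambda>\<zeta> :: complex ^ 'N. r *\<^sub>R \<zeta>)" by (intro continuous_intros)
    then show "continuous_on sph (\<lambda>\<zeta> :: complex ^ 'N. tangent i j (r *\<^sub>R \<zeta>))" by (rule continuous_on_tangent)
  qed (rule sph_scale_ball[OF r])
qed

text \<open>
  The factor \<open>2 / \<pi>\<close> turns the integral over \<open>0 \<le> s \<le> \<pi>/2\<close> into an average.\<close>
lemma int_mean_tangent:
  fixes f :: "complex ^ 'N \<Rightarrow> complex"
  assumes p: "1 \<le> p" and r: "0 < r" "r < 1" and B: "B \<ge> 0" and ij: "i \<noteq> j"
    and f: "holo f" and le: "int_mean p r (euler_op f) \<le> ennreal B"
  shows "int_mean p r (\<lambda>z. of_real (2 / pi) * cderiv f z (tangent i j z)) \<le> ennreal B"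
proof (rule int_mean_average[OF p, where a = 0 and b = "pi/2" and
      G = "\<lambda>s z. cderiv (euler_op f) (of_real (cos s) *s z) (of_real (sin s) *s tangent i j z)"])
  have ball: "of_real (cos s) *s (r *\<^sub>R \<zeta>) \<in> ball 0 1" if "\<zeta> \<in> sph" for \<zeta> :: "complex ^ 'N" and s
    using plane_damp_rot_ball[OF ij sph_scale_ball[OF r that], of 0 s] by simp
  show c: "continuous_on ({0..pi/2} \<times> sph) (\<lambda>(s, \<zeta>). cderiv (euler_op f) (of_real (cos s) *s (r *\<^sub>R \<zeta>))
      (of_real (sin s) *s tangent i j (r *\<^sub>R \<zeta>)))"
    unfolding split_beta
    by (rule continuous_on_cderiv[OF holo_euler_op[OF f]]) (intro continuous_intros | use ball in \<open>auto simp del: mem_ball\<close>)+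
  show "cont_sphere r (\<lambda>z. of_real (2 / pi) * cderiv f z (tangent i j z))"
    by (rule cont_sphere_tangent[OF f r])
  show "int_mean p r (\<lambda>z. cderiv (euler_op f) (of_real (cos s) *s z) (of_real (sin s) *s tangent i j z)) \<le> ennreal B" for s
    by (rule int_mean_tangent_slice[OF p r B ij holo_euler_op[OF f] le])
  show "cmod (of_real (2 / pi) * cderiv f (r *\<^sub>R \<zeta>) (tangent i j (r *\<^sub>R \<zeta>))) \<le>
      integral {0..pi/2} (\<lambda>s. cmod (cderiv (euler_op f) (of_real (cos s) *s (r *\<^sub>R \<zeta>))
      (of_real (sin s) *s tangent i j (r *\<^sub>R \<zeta>)))) / (pi/2 - 0)" if z: "\<zeta> \<in> sph" for \<zeta> :: "complex ^ 'N"
  proof -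
    have "cmod (cderiv f (r *\<^sub>R \<zeta>) (tangent i j (r *\<^sub>R \<zeta>))) =
        cmod (integral {0..pi/2} (\<lambda>s. cderiv (euler_op f) (of_real (cos s) *s (r *\<^sub>R \<zeta>))
          (of_real (sin s) *s tangent i j (r *\<^sub>R \<zeta>))))"
      using cderiv_tangent_integral[OF f sph_scale_ball[OF r z], of "tangent i j (r *\<^sub>R \<zeta>)"] by (simp only: integral_unique)
    also have "\<dots> \<le> integral {0..pi/2} (\<lambda>s. cmod (cderiv (euler_op f) (of_real (cos s) *s (r *\<^sub>R \<zeta>))
          (of_real (sin s) *s tangent i j (r *\<^sub>R \<zeta>))))"
      by (rule cmod_integral_le, rule continuous_on_cderiv[OF holo_euler_op[OF f]])
         (intro continuous_intros | use ball[OF z] in \<open>simp del: mem_ball\<close>)+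
    finally show ?thesis by (simp add: norm_mult norm_divide field_simps)
  qed
qed (use B in auto)

text \<open>
  The vector \<open>norm z ^ 2\<close> times the \<open>i\<close>-th coordinate vector is the sum of a multiple of \<open>z\<close> and of
  multiples of the tangential directions in the planes of \<open>i\<close> and \<open>j\<close>.\<close>
lemma norm_partial_deriv_le:
  fixes f :: "complex ^ 'N \<Rightarrow> complex"
  assumes f: "holo f" and z: "z \<in> ball 0 1"
  shows "(norm z)\<^sup>2 * cmod (partial_deriv i f z) \<le> norm z *
    (cmod (euler_op f z) + (\<Sum>j\<in>UNIV - {i}. cmod (cderiv f z (tangent i j z))))"
proof -
  have tangent: "cderiv f z (tangent i j z) = cnj (z $ j) * partial_deriv i f z - cnj (z $ i) * partial_deriv j f z" for j
  proof -
    have "tangent i j z $ k = (if k = i then cnj (z $ j) else 0) - (if k = j then cnj (z $ i) else 0)" for k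
      by (simp add: tangent_def axis_def)
    then show ?thesis
      by (simp add: cderiv_eq_sum_partial_deriv[OF f z] left_diff_distrib sum_subtractf if_distrib[of "\<lambda>x. x * _"] cong: if_cong)
  qed
  have n2: "complex_of_real ((norm z)\<^sup>2) = (\<Sum>j\<in>UNIV. z $ j * cnj (z $ j))"
    by (simp add: norm_vec_def L2_set_def sum_nonneg complex_norm_square[symmetric])
  have "(\<Sum>j\<in>UNIV. z $ j * cderiv f z (tangent i j z)) =
      of_real ((norm z)\<^sup>2) * partial_deriv i f z - cnj (z $ i) * euler_op f z"
    unfolding n2 euler_op_eq_sum_partial_deriv[OF f z] tangent
    by (simp add: right_diff_distrib sum_subtractf sum_distrib_left sum_distrib_right mult_ac)
  then have "of_real ((norm z)\<^sup>2) * partial_deriv i f z = cnj (z $ i) * euler_op f z + (\<Sum>j\<in>UNIV - {i}. z $ j * cderiv f z (tangent i j z))"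
    by (simp add: sum.remove[of UNIV i] tangent)
  then have "(norm z)\<^sup>2 * cmod (partial_deriv i f z) = cmod (cnj (z $ i) * euler_op f z + (\<Sum>j\<in>UNIV - {i}. z $ j * cderiv f z (tangent i j z)))"
    by (metis norm_mult norm_of_real abs_power2)
  also have "\<dots> \<le> cmod (z $ i) * cmod (euler_op f z) + (\<Sum>j\<in>UNIV - {i}. cmod (z $ j) * cmod (cderiv f z (tangent i j z)))"
    by (rule order_trans[OF norm_triangle_ineq] add_mono order_trans[OF norm_sum] | simp add: norm_mult)+
  also have "\<dots> \<le> norm z * cmod (euler_op f z) + (\<Sum>j\<in>UNIV - {i}. norm z * cmod (cderiv f z (tangent i j z)))"
    by (intro add_mono sum_mono mult_right_mono Finite_Cartesian_Product.norm_nth_le) auto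
  finally show ?thesis by (simp add: sum_distrib_left algebra_simps)
qed

abbreviation means_bounded :: "ennreal \<Rightarrow> real \<Rightarrow> (complex ^ 'N \<Rightarrow> complex) \<Rightarrow> bool" where
  "means_bounded p B f \<equiv> (\<forall>r. 0 < r \<longrightarrow> r < 1 \<longrightarrow> int_mean p r f \<le> ennreal B)"

text \<open>
  The coefficients of the decomposition are of size \<open>1 / r\<close> on the sphere of radius \<open>r\<close>, hence bounded
  for \<open>r \<ge> 1/2\<close>. Smaller radii reduce to \<open>r = 1/2\<close> because \<open>z \<mapsto> 2 r z\<close> is then a contraction.\<close>
lemma means_bounded_partial_deriv:
  fixes f :: "complex ^ 'N \<Rightarrow> complex"
  assumes p: "1 \<le> p" and B: "B \<ge> 0" and f: "holo f" and le: "means_bounded p B (euler_op f)"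
  shows "means_bounded p (4 * real CARD('N) ^ 2 * B) (partial_deriv i f)"
proof (intro allI impI)
  fix r :: real assume r: "0 < r" "r < 1"
  let ?B = "4 * real CARD('N) ^ 2 * B"
  have B': "?B \<ge> 0" using B by simp
  have large: "int_mean p r (partial_deriv i f) \<le> ennreal ?B" if r: "1/2 \<le> r" "r < 1" for r
  proof -
    have r0: "0 < r" using r by simp
    \<comment> \<open>For \<open>j = i\<close> the direction vanishes; its place is taken by \<open>R f\<close>.\<close>
    define G where "G j = (if j = i then euler_op f else (\<lambda>z. of_real (2 / pi) * cderiv f z (tangent i j z)))" for j
    show ?thesis
    proof (rule int_mean_sum[OF p B, where c = 4 and K = "UNIV :: 'N set" and G = G])
      show "cont_sphere r (G j)" for j
      proof (cases "j = i")
        case False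
        then show ?thesis using cont_sphere_tangent[OF f r0 r(2), of "of_real (2 / pi)" i j] by (simp add: G_def)
      qed (simp add: G_def cont_sphere_holo[OF holo_euler_op[OF f] r0 r(2)])
      show "cont_sphere r (partial_deriv i f)" by (rule cont_sphere_holo[OF holo_partial_deriv[OF f] r0 r(2)])
      show "int_mean p r (G j) \<le> ennreal B" for j
        using le r0 r int_mean_tangent[OF p r0 r(2) B _ f, of i j] by (simp add: G_def)
      show "cmod (partial_deriv i f (r *\<^sub>R \<zeta>)) \<le> 4 * (\<Sum>j\<in>UNIV. cmod (G j (r *\<^sub>R \<zeta>)))" if z: "\<zeta> \<in> sph" for \<zeta>
      proof -
        let ?z = "r *\<^sub>R \<zeta>"
        have nz: "norm ?z = r" using z r0 by simp
        have "(\<Sum>j\<in>UNIV. cmod (G j ?z)) = cmod (euler_op f ?z) + (\<Sum>j\<in>UNIV - {i}. 2 / pi * cmod (cderiv f ?z (tangent i j ?z)))"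
          by (subst sum.remove[of UNIV i]) (auto simp: G_def norm_mult norm_divide intro!: sum.cong)
        also have "2 * \<dots> \<ge> cmod (euler_op f ?z) + (\<Sum>j\<in>UNIV - {i}. cmod (cderiv f ?z (tangent i j ?z)))"
        proof -
          have "cmod (cderiv f ?z (tangent i j ?z)) \<le> 2 * (2 / pi * cmod (cderiv f ?z (tangent i j ?z)))" for j
            using mult_right_mono[of 1 "4 / pi" "cmod (cderiv f ?z (tangent i j ?z))"] pi_less_4 by (simp add: field_simps)
          then have "(\<Sum>j\<in>UNIV - {i}. cmod (cderiv f ?z (tangent i j ?z))) \<le>
              2 * (\<Sum>j\<in>UNIV - {i}. 2 / pi * cmod (cderiv f ?z (tangent i j ?z)))"
            unfolding sum_distrib_left by (intro sum_mono)
          then show ?thesis unfolding distrib_left using norm_ge_zero[of "euler_op f ?z"] by linarith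
        qed
        finally have 1: "cmod (euler_op f ?z) + (\<Sum>j\<in>UNIV - {i}. cmod (cderiv f ?z (tangent i j ?z))) \<le> 2 * (\<Sum>j\<in>UNIV. cmod (G j ?z))" .
        have "r * (r * cmod (partial_deriv i f ?z)) \<le> r * (cmod (euler_op f ?z) + (\<Sum>j\<in>UNIV - {i}. cmod (cderiv f ?z (tangent i j ?z))))"
          using norm_partial_deriv_le[OF f sph_scale_ball[OF r0 r(2) z], of i] unfolding nz
          by (simp add: power2_eq_square mult.assoc)
        then have "r * cmod (partial_deriv i f ?z) \<le> cmod (euler_op f ?z) + (\<Sum>j\<in>UNIV - {i}. cmod (cderiv f ?z (tangent i j ?z)))"
          using r0 by simp
        moreover have "1/2 * cmod (partial_deriv i f ?z) \<le> r * cmod (partial_deriv i f ?z)" using r by (intro mult_right_mono) auto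
        ultimately show ?thesis using 1 by linarith
      qed
    qed auto
  qed
  show "int_mean p r (partial_deriv i f) \<le> ennreal ?B"
  proof (cases "1/2 \<le> r")
    case False
    define U where "U = (\<lambda>z :: complex ^ 'N. complex_of_real (2 * r) *s z)"
    have U: "U \<in> ball_operators"
    proof -
      have "norm (U z) < 1" if "norm z < 1" for z
      proof -
        have "2 * r * norm z \<le> 1 * norm z" using False by (intro mult_right_mono) auto
        then show ?thesis using that r by (simp add: U_def norm_smult norm_mult)
      qed
      moreover have "Vector_Spaces.linear (*s) (*s) U"
        by (simp add: Vector_Spaces.linear_iff vec.vector_space_axioms U_def vec_eq_iff algebra_simps)
      ultimately show ?thesis by (auto simp: ball_operators_def)
    qed
    have "int_mean p (1/2) (\<lambda>z. partial_deriv i f (U z)) \<le> ennreal ?B"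
      by (rule int_mean_contraction[OF p _ _ B' holo_partial_deriv[OF f] U large]) auto
    moreover have Ur: "U ((1/2) *\<^sub>R \<zeta>) = r *\<^sub>R \<zeta>" for \<zeta>
      by (simp add: U_def scaleR_eq_smult vector_smult_assoc)
    have "int_mean p (1/2) (\<lambda>z. partial_deriv i f (U z)) = int_mean p r (partial_deriv i f)"
      unfolding int_mean_def by (simp only: Ur)
    ultimately show ?thesis by simp
  qed (use large r in auto)
qed

section \<open>Differences and the Euler operator\<close>

text \<open>
  The difference is the integral of \<open>f'(V z) (U z - z)\<close> over the segment of contractions \<open>V\<close> from the
  identity to \<open>U\<close>; in mean, the partial derivatives at \<open>V z\<close> are controlled by those at \<open>z\<close>, and these by \<open>R f\<close>.\<close>
lemma means_bounded_op_diff: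
  fixes f :: "complex ^ 'N \<Rightarrow> complex"
  assumes p: "1 \<le> p" and B: "B \<ge> 0" and f: "holo f" and le: "means_bounded p B (euler_op f)"
    and U: "U \<in> ball_operators" and d: "\<And>z. norm (U z - z) \<le> d * norm z" "d \<ge> 0"
  shows "means_bounded p (4 * real CARD('N) ^ 4 * d * B) (op_diff U f)"
proof (intro allI impI)
  fix r :: real assume r: "0 < r" "r < 1"
  define V where "V t z = z + complex_of_real t *s (U z - z)" for t :: real and z :: "complex ^ 'N"
  have Vnorm: "norm (V t z) \<le> norm z" if "0 \<le> t" "t \<le> 1" for t z
  proof -
    have "V t z = (1 - t) *\<^sub>R z + t *\<^sub>R U z" by (simp add: V_def scaleR_eq_smult vec_eq_iff algebra_simps)
    then have "norm (V t z) \<le> (1 - t) * norm z + t * norm (U z)"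
      using that norm_triangle_ineq[of "(1 - t) *\<^sub>R z" "t *\<^sub>R U z"] by simp
    also have "\<dots> \<le> (1 - t) * norm z + t * norm z"
      using that ball_operators_norm_le[OF U, of z] by (intro add_left_mono mult_left_mono) auto
    finally show ?thesis by (simp add: algebra_simps)
  qed
  have V: "V t \<in> ball_operators" if t: "0 \<le> t" "t \<le> 1" for t
  proof -
    have "V t ` ball 0 1 \<subseteq> ball 0 1"
    proof (rule image_subsetI)
      fix z :: "complex ^ 'N" assume "z \<in> ball 0 1"
      then show "V t z \<in> ball 0 1" using Vnorm[OF t, of z] by simp
    qed
    moreover have "U (x + y) = U x + U y" for x y
      using U by (simp add: ball_operators_def Vector_Spaces.linear_iff)
    then have "Vector_Spaces.linear (*s) (*s) (V t)"
      by (simp add: Vector_Spaces.linear_iff vec.vector_space_axioms V_def ball_operators_smult[OF U]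
          vec_eq_iff algebra_simps)
    ultimately show ?thesis by (simp add: ball_operators_def)
  qed
  have contU: "continuous_on S U" for S
    by (rule linear_continuous_on[OF ball_operators_bounded_linear[OF U]])
  have contUr: "continuous_on S (\<lambda>x. U (r *\<^sub>R g x))" if "continuous_on S g" for S and g :: "'x::topological_space \<Rightarrow> _"
    by (rule continuous_on_compose2[OF contU[of UNIV]]) (intro continuous_intros that, simp)
  have Vball: "V t (r *\<^sub>R \<zeta>) \<in> ball 0 1" if "0 \<le> t" "t \<le> 1" "\<zeta> \<in> sph" for t \<zeta>
    by (rule ball_operators_ball[OF V[OF that(1,2)] sph_scale_ball[OF r that(3)]])
  let ?K = "4 * real CARD('N) ^ 2 * B"
  let ?G = "\<lambda>t z. cderiv f (V t z) (U z - z)"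
  have B': "?K \<ge> 0" using B by simp
  show "int_mean p r (op_diff U f) \<le> ennreal (4 * real CARD('N) ^ 4 * d * B)"
  proof (rule int_mean_average[OF p, where a = 0 and b = 1 and G = ?G])
    show cont: "continuous_on ({0..1} \<times> sph) (\<lambda>(t, \<zeta>). ?G t (r *\<^sub>R \<zeta>))"
      unfolding split_beta
    proof (rule continuous_on_cderiv[OF f])
      show "continuous_on ({0..1} \<times> sph) (\<lambda>x. V (fst x) (r *\<^sub>R snd x))"
        unfolding V_def by (intro continuous_intros contUr)
      show "continuous_on ({0..1} \<times> sph) (\<lambda>x. U (r *\<^sub>R snd x) - r *\<^sub>R snd x)"
        by (intro continuous_intros contUr)
    qed (use Vball in auto)
    show "cont_sphere r (op_diff U f)" by (rule cont_sphere_holo[OF holo_op_diff[OF U f] r])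
    show "int_mean p r (?G t) \<le> ennreal (4 * real CARD('N) ^ 4 * d * B)" if "t \<in> {0..1}" for t
    proof -
      from that have t: "0 \<le> t" "t \<le> 1" by auto
      have "int_mean p r (?G t) \<le> ennreal (d * real (card (UNIV :: 'N set)) ^ 2 * ?K)"
      proof (rule int_mean_sum[OF p B' d(2) finite[of "UNIV :: 'N set"], where G = "\<lambda>i z. partial_deriv i f (V t z)"])
        show "cont_sphere r (\<lambda>z. partial_deriv i f (V t z))" for i
          by (rule cont_sphere_holo[OF holo_compose_operator[OF V[OF t] holo_partial_deriv[OF f]] r])
        show "cont_sphere r (?G t)"
          using continuous_on_compose2[OF cont, of sph "\<lambda>\<zeta>. (t, \<zeta>)"] that
          by (simp add: image_subset_iff continuous_on_Pair)
        show "int_mean p r (\<lambda>z. partial_deriv i f (V t z)) \<le> ennreal ?K" for i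
          using int_mean_contraction[OF p r B' holo_partial_deriv[OF f] V[OF t]] means_bounded_partial_deriv[OF p B f le] r by blast
        show "cmod (?G t (r *\<^sub>R \<zeta>)) \<le> d * (\<Sum>i\<in>UNIV. cmod (partial_deriv i f (V t (r *\<^sub>R \<zeta>))))" if z: "\<zeta> \<in> sph" for \<zeta>
        proof -
          let ?z = "r *\<^sub>R \<zeta>"
          have "norm (U ?z - ?z) \<le> d * norm ?z" by (rule d(1))
          also have "\<dots> \<le> d * 1" using z r d(2) by (intro mult_left_mono) auto
          finally have n: "norm (U ?z - ?z) \<le> d" by simp
          have "?G t ?z = (\<Sum>i\<in>UNIV. (U ?z - ?z) $ i * partial_deriv i f (V t ?z))"
            by (rule cderiv_eq_sum_partial_deriv[OF f Vball[OF t z]])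
          also have "cmod \<dots> \<le> (\<Sum>i\<in>UNIV. cmod ((U ?z - ?z) $ i) * cmod (partial_deriv i f (V t ?z)))"
            by (rule order_trans[OF norm_sum]) (simp add: norm_mult)
          also have "\<dots> \<le> (\<Sum>i\<in>UNIV. d * cmod (partial_deriv i f (V t ?z)))"
            by (intro sum_mono mult_right_mono order_trans[OF Finite_Cartesian_Product.norm_nth_le n]) auto
          finally show ?thesis by (simp add: sum_distrib_left)
        qed
      qed
      also have "d * real (card (UNIV :: 'N set)) ^ 2 * ?K = 4 * real CARD('N) ^ 4 * d * B"
        by (simp add: power4_eq_xxxx power2_eq_square)
      finally show ?thesis .
    qed
    show "cmod (op_diff U f (r *\<^sub>R \<zeta>)) \<le> integral {0..1} (\<lambda>t. cmod (?G t (r *\<^sub>R \<zeta>))) / (1 - 0)"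
      if z: "\<zeta> \<in> sph" for \<zeta>
    proof -
      let ?z = "r *\<^sub>R \<zeta>"
      have "((\<lambda>t. f (V t ?z)) has_vector_derivative ?G t ?z) (at t within {0..1})" if "t \<in> {0..1}" for t
      proof -
        have "?z + complex_of_real t *s (U ?z - ?z) \<in> ball 0 1"
          using Vball[OF _ _ z, of t] that unfolding V_def by simp
        from holo_slice_deriv[OF f this]
        have "((\<lambda>l. f (?z + l *s (U ?z - ?z))) has_field_derivative ?G t ?z) (at (of_real t))"
          by (simp add: V_def)
        from field_vector_diff_chain_at[OF has_vector_derivative_of_real[OF DERIV_ident] this]
        have "((\<lambda>t. f (V t ?z)) has_vector_derivative ?G t ?z) (at t)" by (simp add: comp_def V_def)
        then show ?thesis by (rule has_vector_derivative_at_within)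
      qed
      then have "((\<lambda>t. ?G t ?z) has_integral f (V 1 ?z) - f (V 0 ?z)) {0..1}"
        by (intro fundamental_theorem_of_calculus) auto
      then have "op_diff U f ?z = integral {0..1} (\<lambda>t. ?G t ?z)"
        by (simp add: integral_unique op_diff_def V_def)
      moreover have "continuous_on {0..1} (\<lambda>t. ?G t ?z)"
        using continuous_on_compose2[OF cont, of "{0..1}" "\<lambda>t. (t, \<zeta>)"] z
        by (simp add: image_subset_iff continuous_on_Pair)
      ultimately show ?thesis using cmod_integral_le by simp
    qed
  qed (use B d in auto)
qed

lemma means_bounded_cong:
  fixes f g :: "complex ^ 'N \<Rightarrow> complex"
  assumes p: "1 \<le> p" and B: "B \<ge> 0" and f: "holo f" and eq: "\<And>z. z \<in> ball 0 1 \<Longrightarrow> g z = f z"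
    and le: "means_bounded p B f"
  shows "means_bounded p B g"
proof (intro allI impI)
  fix r :: real assume r: "0 < r" "r < 1"
  have "int_mean p r g \<le> ennreal (1 * B)"
    by (rule int_mean_dominated[OF p B _ cont_sphere_holo[OF f r] cont_sphere_holo[OF holo_cong[OF f eq] r]])
       (use le r eq[OF sph_scale_ball[OF r]] in auto)
  then show "int_mean p r g \<le> ennreal B" by simp
qed

lemma means_bounded_op_diff_funpow:
  fixes f :: "complex ^ 'N \<Rightarrow> complex"
  assumes p: "1 \<le> p" and U: "U \<in> ball_operators" and d: "\<And>z. norm (U z - z) \<le> d * norm z" "d \<ge> 0"
    and f: "holo f" and B: "B \<ge> 0" and le: "means_bounded p B ((euler_op ^^ n) f)"
  shows "means_bounded p ((4 * real CARD('N) ^ 4 * d) ^ n * B) ((op_diff U ^^ n) f)"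
  using f B le
proof (induction n arbitrary: f B)
  case (Suc n)
  let ?K = "4 * real CARD('N) ^ 4 * d"
  have K: "?K * B \<ge> 0" using Suc.prems d by simp
  have "means_bounded p (?K * B) (op_diff U ((euler_op ^^ n) f))"
    using means_bounded_op_diff[OF p Suc.prems(2) holo_euler_op_funpow[OF Suc.prems(1)] _ U d, of n] Suc.prems(3) by simp
  then have "means_bounded p (?K * B) ((euler_op ^^ n) (op_diff U f))"
    using means_bounded_cong[OF p K holo_op_diff[OF U holo_euler_op_funpow[OF Suc.prems(1)]]
        euler_op_funpow_op_diff[OF U Suc.prems(1)]] by blast
  from Suc.IH[OF holo_op_diff[OF U Suc.prems(1)] K this] show ?case
    by (simp add: funpow_swap1 mult_ac)
qed simp

lemma int_mean_const:
  assumes p: "1 \<le> p" shows "int_mean p r (\<lambda>z :: complex ^ 'N. c) \<le> ennreal (cmod c)"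
proof (cases "p = \<infinity>")
  case True
  then show ?thesis using int_mean_le_iff_infinite[where r = r and g = "\<lambda>z :: complex ^ 'N. c" and B = "cmod c"] by simp
next
  case False
  then show ?thesis
    by (subst int_mean_le_iff_finite[OF p False]) (use sphere_prob.prob_space[where ?'N = 'N] in simp_all)
qed

text \<open>
  Integration by parts: the derivative of \<open>t f(e\<^sup>i\<^sup>t z)\<close> is \<open>i t (R f)(e\<^sup>i\<^sup>t z) + f(e\<^sup>i\<^sup>t z)\<close>, and the last
  term has mean \<open>f(0)\<close>.\<close>
lemma has_integral_euler_op_rotation:
  fixes f :: "complex ^ 'N \<Rightarrow> complex"
  assumes f: "holo f" and z: "z \<in> ball 0 1"
  shows "((\<lambda>t. \<i> * of_real t * euler_op f (cis t *s z)) has_integral 2 * pi * (f z - f 0)) {0..2*pi}"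
proof -
  have ball: "l *s z \<in> ball 0 1" if "cmod l \<le> 1" for l
  proof -
    have "cmod l * norm z \<le> 1 * norm z" using that by (intro mult_right_mono) auto
    then have "cmod l * norm z < 1" using z by simp
    then show ?thesis by (simp add: norm_smult)
  qed
  have cball: "cis t *s z \<in> ball 0 1" for t by (rule ball) simp
  have d: "((\<lambda>t. of_real t * f (cis t *s z)) has_vector_derivative
      (\<i> * of_real t * euler_op f (cis t *s z) + f (cis t *s z))) (at t)" for t
  proof -
    have c: "(cis has_vector_derivative \<i> * cis t) (at t)"
      unfolding has_vector_derivative_def
      by (auto intro!: derivative_eq_intros simp: scaleR_conv_of_real mult_ac)
    from field_vector_diff_chain_at[OF c holo_slice_deriv0[OF f cball]]
    have "((\<lambda>t. f (cis t *s z)) has_vector_derivative \<i> * euler_op f (cis t *s z)) (at t)"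
      by (simp add: comp_def euler_op_def cderiv_smult[OF f cball] mult.assoc)
    from has_vector_derivative_mult[OF has_vector_derivative_of_real[OF DERIV_ident] this]
    show ?thesis by (simp add: mult_ac)
  qed
  have 1: "((\<lambda>t. \<i> * of_real t * euler_op f (cis t *s z) + f (cis t *s z)) has_integral
      of_real (2*pi) * f (cis (2*pi) *s z) - of_real 0 * f (cis 0 *s z)) {0..2*pi}"
    by (rule fundamental_theorem_of_calculus, simp, rule has_vector_derivative_at_within, rule d)
  have 2: "((\<lambda>t. f (cis t *s z)) has_integral (2 * pi * f 0)) {0..2*pi}"
    using slice_mean[OF f, of 0 z] ball by simp
  show ?thesis using has_integral_diff[OF 1 2] by (simp add: right_diff_distrib)
qed

lemma means_bounded_of_euler_op:
  fixes f :: "complex ^ 'N \<Rightarrow> complex"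
  assumes p: "1 \<le> p" and B: "B \<ge> 0" and f: "holo f" and le: "means_bounded p B (euler_op f)"
  shows "\<exists>B'\<ge>0. means_bounded p B' f"
proof (intro exI conjI allI impI)
  \<comment> \<open>The constant \<open>f 0\<close>, which \<open>R f\<close> does not see, is bounded separately.\<close>
  define M where "M = max (2 * pi * B) (cmod (f 0))"
  have M: "M \<ge> 0" by (simp add: M_def le_max_iff_disj)
  show "4 * M \<ge> 0" using M by simp
  fix r :: real assume r: "0 < r" "r < 1"
  have cball: "cis t *s (r *\<^sub>R \<zeta>) \<in> ball 0 1" if "\<zeta> \<in> sph" for \<zeta> :: "complex ^ 'N" and t
    using that r by (simp add: norm_smult)
  have holo0: "holo (\<lambda>z. f z - f 0)" by (rule holo_diff[OF f]) (rule holoI[where D = "\<lambda>_ _. 0"], auto)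
  let ?G = "\<lambda>t z. \<i> * of_real t * euler_op f (cis t *s z)"
  have 1: "int_mean p r (\<lambda>z. f z - f 0) \<le> ennreal (2 * pi * B)"
  proof (rule int_mean_average[OF p, where a = 0 and b = "2*pi" and G = ?G])
    show cont: "continuous_on ({0..2*pi} \<times> sph) (\<lambda>(t, \<zeta>). ?G t (r *\<^sub>R \<zeta>))"
      unfolding split_beta
      by (rule continuous_on_mult, intro continuous_intros, rule continuous_on_holo_compose[OF holo_euler_op[OF f]],
          intro continuous_intros) (use cball in \<open>auto simp del: mem_ball\<close>)
    show "cont_sphere r (\<lambda>z. f z - f 0)" by (rule cont_sphere_holo[OF holo0 r])
    show "cmod (f (r *\<^sub>R \<zeta>) - f 0) \<le> integral {0..2*pi} (\<lambda>t. cmod (?G t (r *\<^sub>R \<zeta>))) / (2*pi - 0)"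
      if z: "\<zeta> \<in> sph" for \<zeta>
    proof -
      have "cmod (2 * pi * (f (r *\<^sub>R \<zeta>) - f 0)) = cmod (integral {0..2*pi} (\<lambda>t. ?G t (r *\<^sub>R \<zeta>)))"
        using has_integral_euler_op_rotation[OF f sph_scale_ball[OF r z]] by (simp only: integral_unique)
      also have "\<dots> \<le> integral {0..2*pi} (\<lambda>t. cmod (?G t (r *\<^sub>R \<zeta>)))"
        by (rule cmod_integral_le)
           (use continuous_on_compose2[OF cont, of "{0..2*pi}" "\<lambda>t. (t, \<zeta>)"] z in
             \<open>simp add: image_subset_iff continuous_on_Pair\<close>)
      finally have "2 * pi * cmod (f (r *\<^sub>R \<zeta>) - f 0) \<le> integral {0..2*pi} (\<lambda>t. cmod (?G t (r *\<^sub>R \<zeta>)))"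
        by (simp add: norm_mult)
      then show ?thesis by (simp add: le_divide_eq mult.commute)
    qed
    show "int_mean p r (?G t) \<le> ennreal (2 * pi * B)" if t: "t \<in> {0..2*pi}" for t
    proof -
      have lin: "linear (\<lambda>z :: complex ^ 'N. cis t *s z)"
        by (rule linearI) (simp_all add: vec_eq_iff scaleR_eq_smult algebra_simps)
      have R: "int_mean p r (\<lambda>z. euler_op f (cis t *s z)) \<le> ennreal B"
        using le r by (intro int_mean_isometry[OF p lin _ cont_sphere_holo[OF holo_euler_op[OF f] r] B]) (auto simp: norm_smult)
      have c1: "cont_sphere r (\<lambda>z. euler_op f (cis t *s z))"
        by (rule continuous_on_holo_compose[OF holo_euler_op[OF f]], intro continuous_intros)
           (use cball in \<open>auto simp del: mem_ball\<close>)
      show ?thesis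
        by (rule int_mean_dominated[OF p B _ c1 _ _ R])
           (use t c1 in \<open>auto simp: norm_mult intro!: mult_right_mono continuous_intros\<close>)
    qed
  qed (use B in auto)
  have "int_mean p r f \<le> ennreal (1 * real (card (UNIV :: bool set)) ^ 2 * M)"
  proof (rule int_mean_sum[OF p M, where G = "\<lambda>b. if b then (\<lambda>z. f z - f 0) else (\<lambda>z. f 0)"])
    show "int_mean p r (if b then (\<lambda>z. f z - f 0) else (\<lambda>z. f 0)) \<le> ennreal M" for b
      using order_trans[OF 1 ennreal_leI[of _ M]] order_trans[OF int_mean_const[OF p, of r "f 0"] ennreal_leI[of _ M]]
      by (auto simp: M_def)
    show "cont_sphere r (if b then (\<lambda>z. f z - f 0) else (\<lambda>z. f 0))" for b
      using cont_sphere_holo[OF holo0 r] by auto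
    show "cmod (f (r *\<^sub>R \<zeta>)) \<le> 1 * (\<Sum>b\<in>UNIV. cmod ((if b then (\<lambda>z. f z - f 0) else (\<lambda>z. f 0)) (r *\<^sub>R \<zeta>)))" for \<zeta>
      using norm_triangle_ineq[of "f (r *\<^sub>R \<zeta>) - f 0" "f 0"] by (simp add: UNIV_bool)
  qed (auto intro: cont_sphere_holo[OF f r])
  then show "int_mean p r f \<le> ennreal (4 * M)" by simp
qed

lemma means_bounded_of_euler_op_funpow:
  fixes f :: "complex ^ 'N \<Rightarrow> complex"
  assumes p: "1 \<le> p" and f: "holo f" and "\<exists>B\<ge>0. means_bounded p B ((euler_op ^^ n) f)"
  shows "\<exists>B\<ge>0. means_bounded p B f"
  using assms(3)
proof (induction n)
  case (Suc n)
  then obtain B where B: "B \<ge> 0" "means_bounded p B (euler_op ((euler_op ^^ n) f))" by auto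
  then show ?case using Suc.IH means_bounded_of_euler_op[OF p B(1) holo_euler_op_funpow[OF f]] by blast
qed simp

section \<open>Moduli of continuity\<close>

lemma hardy_norm_le_iff: "hardy_norm p f \<le> ennreal B \<longleftrightarrow> means_bounded p B f"
  by (auto simp: hardy_norm_def SUP_le_iff)

lemma hardy_norm_finite_iff: "hardy_norm p f < top \<longleftrightarrow> (\<exists>B\<ge>0. means_bounded p B f)"
proof
  assume "hardy_norm p f < top"
  then have "hardy_norm p f \<le> ennreal (enn2real (hardy_norm p f))" by (simp add: less_top)
  then show "\<exists>B\<ge>0. means_bounded p B f" unfolding hardy_norm_le_iff by (metis enn2real_nonneg)
next
  assume "\<exists>B\<ge>0. means_bounded p B f"
  then show "hardy_norm p f < top"
    unfolding hardy_norm_le_iff[symmetric] by (metis ennreal_less_top le_less_trans)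
qed

lemma hardy_sobolev_iff:
  fixes f :: "complex ^ 'N \<Rightarrow> complex"
  assumes p: "1 \<le> p" and n: "n \<ge> 1"
  shows "f \<in> hardy_sobolev n p \<longleftrightarrow> holo f \<and> (\<exists>B\<ge>0. means_bounded p B ((euler_op ^^ n) f))"
proof (cases "holo f")
  case True
  have eq: "radial_deriv n f z = (euler_op ^^ n) f z" if "z \<in> ball 0 1" for z
    by (rule radial_deriv_eq_euler_op[OF True n that])
  have h: "holo (radial_deriv n f)" by (rule holo_cong[OF holo_euler_op_funpow[OF True] eq])
  have "means_bounded p B (radial_deriv n f) \<longleftrightarrow> means_bounded p B ((euler_op ^^ n) f)" if "B \<ge> 0" for B
    using means_bounded_cong[OF p that holo_euler_op_funpow[OF True] eq] means_bounded_cong[OF p that h eq[symmetric]] by blast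
  then show ?thesis
    using True h by (auto simp: hardy_sobolev_def hardy_space_def hardy_norm_finite_iff)
qed (simp add: hardy_sobolev_def)

lemma hermitian_inner_self: "hermitian_inner z z = of_real ((norm z)\<^sup>2)"
  by (simp add: hermitian_inner_def norm_vec_def L2_set_def sum_nonneg complex_norm_square[symmetric])

lemma unitary_group_subset: "(unitary_group :: (complex ^ 'N \<Rightarrow> complex ^ 'N) set) \<subseteq> ball_operators"
proof
  fix U :: "complex ^ 'N \<Rightarrow> complex ^ 'N" assume U: "U \<in> unitary_group"
  have "norm (U z) = norm z" for z
  proof -
    have "hermitian_inner (U z) (U z) = hermitian_inner z z" using U by (simp add: unitary_group_def)
    then have "(norm (U z))\<^sup>2 = (norm z)\<^sup>2" unfolding hermitian_inner_self of_real_eq_iff .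
    then show ?thesis by simp
  qed
  with U show "U \<in> ball_operators" by (auto simp: unitary_group_def ball_operators_def)
qed

lemma modulus_le_modulus_plus: "modulus n p f \<delta> \<le> modulus_plus n p f \<delta>"
  unfolding modulus_def modulus_plus_def
  by (rule SUP_subset_mono) (use unitary_group_subset in auto)

definition rotation :: "real \<Rightarrow> complex ^ 'N \<Rightarrow> complex ^ 'N" where
  "rotation t z = cis t *s z"

lemma rot_diff_eq_op_diff: "rot_diff t = op_diff (rotation t)"
  by (simp add: fun_eq_iff rot_diff_def op_diff_def rotation_def cis_conv_exp)

lemma rotation_unitary: "(rotation t :: complex ^ 'N \<Rightarrow> complex ^ 'N) \<in> unitary_group"
proof -
  have "cis t * x * (cis (- t) * y) = x * y" for x y :: complex
    by (simp add: cis_mult mult.left_commute mult.assoc[symmetric] mult.commute)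
  then have key: "cis t * x * (cnj (cis t) * y) = x * y" for x y :: complex by (simp only: cis_cnj)
  have "hermitian_inner (rotation t z) (rotation t w) = hermitian_inner z w" for z w :: "complex ^ 'N"
    by (simp only: hermitian_inner_def rotation_def vector_smult_component complex_cnj_mult key)
  moreover have "Vector_Spaces.linear (*s) (*s) (rotation t :: complex ^ 'N \<Rightarrow> _)"
    by (simp add: Vector_Spaces.linear_iff vec.vector_space_axioms rotation_def vec_eq_iff algebra_simps)
  ultimately show ?thesis by (simp add: unitary_group_def)
qed

lemma onorm_rotation: "onorm (\<lambda>z :: complex ^ 'N. rotation t z - z) \<le> \<bar>t\<bar>"
proof (rule onorm_le)
  fix z :: "complex ^ 'N"
  have "rotation t z - z = (cis t - 1) *s z" by (simp add: rotation_def vec_eq_iff algebra_simps)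
  then have "norm (rotation t z - z) = cmod (cis t - 1) * norm z" by (simp only: norm_smult)
  then show "norm (rotation t z - z) \<le> \<bar>t\<bar> * norm z"
    using cmod_cis_diff_1_le[of t] by (simp only: mult_right_mono norm_ge_zero)
qed

lemma modulus_minus_le_modulus: "modulus_minus n p f \<delta> \<le> modulus n p (f :: complex ^ 'N \<Rightarrow> complex) \<delta>"
  unfolding modulus_minus_def
proof (rule SUP_least)
  fix t :: real assume "t \<in> {t. \<bar>t\<bar> < \<delta>}"
  then have "onorm (\<lambda>z :: complex ^ 'N. rotation t z - z) < \<delta>" using le_less_trans[OF onorm_rotation[where ?'N = 'N and t = t]] by blast
  then show "hardy_norm p ((rot_diff t ^^ n) f) \<le> modulus n p f \<delta>"
    unfolding modulus_def rot_diff_eq_op_diff by (intro SUP_upper) (simp add: rotation_unitary)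
qed

lemma big_O_power_mono:
  assumes "big_O_power n \<omega>'" "\<And>\<delta>. \<omega> \<delta> \<le> \<omega>' \<delta>" shows "big_O_power n \<omega>"
  using assms unfolding big_O_power_def by (meson order_trans)

lemma hardy_sobolev_imp_modulus_plus:
  fixes f :: "complex ^ 'N \<Rightarrow> complex"
  assumes p: "1 \<le> p" and n: "n \<ge> 1" and f: "f \<in> hardy_sobolev n p"
  shows "big_O_power n (modulus_plus n p f)"
proof -
  from f obtain B where h: "holo f" and B: "B \<ge> 0" "means_bounded p B ((euler_op ^^ n) f)"
    using hardy_sobolev_iff[OF p n] by blast
  let ?K = "4 * real CARD('N) ^ 4"
  have "modulus_plus n p f \<delta> \<le> ennreal (?K ^ n * B * \<delta> ^ n)" if d: "0 < \<delta>" "\<delta> < 1" for \<delta>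
    unfolding modulus_plus_def
  proof (rule SUP_least)
    fix U :: "complex ^ 'N \<Rightarrow> complex ^ 'N" assume "U \<in> {U \<in> ball_operators. onorm (\<lambda>z. U z - z) < \<delta>}"
    then have U: "U \<in> ball_operators" "onorm (\<lambda>z. U z - z) < \<delta>" by auto
    have bl: "bounded_linear (\<lambda>z. U z - z)"
      by (intro bounded_linear_sub ball_operators_bounded_linear[OF U(1)] bounded_linear_ident)
    have nz: "norm (U z - z) \<le> \<delta> * norm z" for z
      using onorm[OF bl, of z] U(2) mult_right_mono[of "onorm (\<lambda>z. U z - z)" \<delta> "norm z"] by simp
    have "means_bounded p ((?K * \<delta>) ^ n * B) ((op_diff U ^^ n) f)"
      by (rule means_bounded_op_diff_funpow[OF p U(1) nz _ h B]) (use d in simp)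
    moreover have "(?K * \<delta>) ^ n * B = ?K ^ n * B * \<delta> ^ n" by (simp add: power_mult_distrib mult_ac)
    ultimately show "hardy_norm p ((op_diff U ^^ n) f) \<le> ennreal (?K ^ n * B * \<delta> ^ n)"
      unfolding hardy_norm_le_iff by metis
  qed
  then show ?thesis unfolding big_O_power_def by blast
qed

lemma holo_rot_diff_funpow: "holo f \<Longrightarrow> holo ((rot_diff t ^^ n) f)"
  unfolding rot_diff_eq_op_diff
  by (induction n) (use rotation_unitary unitary_group_subset in \<open>auto intro: holo_op_diff\<close>)

text \<open>
  Divide the bound by \<open>t\<^sup>n\<close> and let \<open>t\<close> tend to zero along a sequence.\<close>
lemma modulus_minus_imp_hardy_sobolev:
  fixes f :: "complex ^ 'N \<Rightarrow> complex"
  assumes p: "1 \<le> p" and n: "n \<ge> 1" and f: "holo f" and bigO: "big_O_power n (modulus_minus n p f)"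
  shows "f \<in> hardy_sobolev n p"
proof -
  from bigO obtain C0 where C0: "\<And>\<delta>. 0 < \<delta> \<Longrightarrow> \<delta> < 1 \<Longrightarrow> modulus_minus n p f \<delta> \<le> ennreal (C0 * \<delta> ^ n)"
    unfolding big_O_power_def by blast
  \<comment> \<open>The constant of the hypothesis may be negative, in which case the modulus vanishes.\<close>
  define C where "C = max C0 0"
  have C: "modulus_minus n p f \<delta> \<le> ennreal (C * \<delta> ^ n)" if "0 < \<delta>" "\<delta> < 1" for \<delta>
    by (rule order_trans[OF C0[OF that]]) (use that in \<open>auto simp: C_def intro!: ennreal_leI mult_right_mono\<close>)
  \<comment> \<open>The modulus at \<open>\<delta>\<close> only sees \<open>t < \<delta>\<close>, so it is used at \<open>2 t\<close>, which must be below \<open>1\<close>.\<close>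
  define t where "t m = 1 / real (m + 3)" for m :: nat
  have t: "t m > 0" "2 * t m < 1" for m by (auto simp: t_def field_simps)
  have "means_bounded p (C * 2 ^ n) ((euler_op ^^ n) f)"
  proof (intro allI impI)
    fix r :: real assume r: "0 < r" "r < 1"
    define G where "G m z = (rot_diff (t m) ^^ n) f z / of_real (t m) ^ n" for m and z :: "complex ^ 'N"
    have hG: "cont_sphere r (G m)" for m
      unfolding G_def using cont_sphere_holo[OF holo_rot_diff_funpow[OF f] r]
      by (intro continuous_on_divide continuous_on_const) (use t[of m] in auto)
    have C': "C * 2 ^ n \<ge> 0" by (simp add: C_def)
    have GB: "int_mean p r (G m) \<le> ennreal (C * 2 ^ n)" for m
    proof -
      have "hardy_norm p ((rot_diff (t m) ^^ n) f) \<le> modulus_minus n p f (2 * t m)"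
        unfolding modulus_minus_def by (rule SUP_upper) (use t[of m] in simp)
      also have "\<dots> \<le> ennreal (C * (2 * t m) ^ n)" using t[of m] by (intro C) auto
      finally have 1: "int_mean p r ((rot_diff (t m) ^^ n) f) \<le> ennreal (C * (2 * t m) ^ n)"
        unfolding hardy_norm_le_iff using r by blast
      have "int_mean p r (G m) \<le> ennreal (1 / t m ^ n * (C * (2 * t m) ^ n))"
        by (rule int_mean_dominated[OF p _ _ cont_sphere_holo[OF holo_rot_diff_funpow[OF f] r] hG _ 1])
           (use t[of m] in \<open>auto simp: G_def C_def norm_divide norm_power\<close>)
      also have "1 / t m ^ n * (C * (2 * t m) ^ n) = C * 2 ^ n"
        using t[of m] by (simp add: power_mult_distrib)
      finally show ?thesis .
    qed
    have hF: "cont_sphere r (\<lambda>z. \<i> ^ n * (euler_op ^^ n) f z)"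
      by (rule continuous_on_mult[OF continuous_on_const cont_sphere_holo[OF holo_euler_op_funpow[OF f] r]])
    have t0: "t \<longlonglongrightarrow> 0"
      unfolding t_def using LIMSEQ_ignore_initial_segment[OF lim_inverse_n', of 3] by simp
    have tn0: "t m \<noteq> 0" for m using t[of m] by simp
    have "int_mean p r (\<lambda>z. \<i> ^ n * (euler_op ^^ n) f z) \<le> ennreal (C * 2 ^ n)"
      by (rule int_mean_Fatou[OF p C' hG hF _ GB])
         (simp only: G_def, rule rot_diff_quotient_tendsto[OF f sph_scale_ball[OF r] t0 tn0])
    from int_mean_dominated[OF p C' _ hF cont_sphere_holo[OF holo_euler_op_funpow[OF f] r] _ this, where c = 1]
    show "int_mean p r ((euler_op ^^ n) f) \<le> ennreal (C * 2 ^ n)" by (simp add: norm_mult norm_power)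
  qed
  moreover have "C * 2 ^ n \<ge> 0" by (simp add: C_def)
  ultimately show ?thesis using hardy_sobolev_iff[OF p n] f by blast
qed

theorem theorem1p4:
  fixes n :: nat and p :: ennreal
  assumes "n \<ge> 1" and "1 \<le> p"
  shows "(hardy_sobolev n p :: (complex ^ 'N \<Rightarrow> complex) set) \<subseteq> hardy_space p
    \<and> (\<forall>f \<in> (hardy_space p :: (complex ^ 'N \<Rightarrow> complex) set).
         (f \<in> hardy_sobolev n p \<longleftrightarrow> big_O_power n (modulus n p f))
       \<and> (f \<in> hardy_sobolev n p \<longleftrightarrow> big_O_power n (modulus_minus n p f))
       \<and> (f \<in> hardy_sobolev n p \<longleftrightarrow> big_O_power n (modulus_plus n p f)))"
proof (intro conjI ballI subsetI)
  fix f :: "complex ^ 'N \<Rightarrow> complex" assume "f \<in> hardy_sobolev n p"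
  then have f: "holo f" and "\<exists>B\<ge>0. means_bounded p B ((euler_op ^^ n) f)"
    using hardy_sobolev_iff[OF assms(2,1)] by blast+
  then have "\<exists>B\<ge>0. means_bounded p B f" by (rule means_bounded_of_euler_op_funpow[OF assms(2)])
  with f show "f \<in> hardy_space p" by (simp add: hardy_space_def hardy_norm_finite_iff)
next
  fix f :: "complex ^ 'N \<Rightarrow> complex" assume "f \<in> hardy_space p"
  then have f: "holo f" by (simp add: hardy_space_def)
  note plus = hardy_sobolev_imp_modulus_plus[OF assms(2,1), of f]
  note minus = modulus_minus_imp_hardy_sobolev[OF assms(2,1) f]
  have 1: "big_O_power n (modulus n p f)" if "big_O_power n (modulus_plus n p f)"
    using that modulus_le_modulus_plus by (rule big_O_power_mono)
  have 2: "big_O_power n (modulus_minus n p f)" if "big_O_power n (modulus n p f)"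
    using that modulus_minus_le_modulus by (rule big_O_power_mono)
  show "f \<in> hardy_sobolev n p \<longleftrightarrow> big_O_power n (modulus n p f)"
    "f \<in> hardy_sobolev n p \<longleftrightarrow> big_O_power n (modulus_minus n p f)"
    "f \<in> hardy_sobolev n p \<longleftrightarrow> big_O_power n (modulus_plus n p f)"
    using plus minus 1 2 by blast+
qed

end
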